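(* Let $\Gamma$ be a countable discrete group, let $p\in[1,2)$, and let $A$ denote either $C_u^*(\Gamma)$ or $C_\lambda^*(\Gamma)$. Let $(f_n)_{n=1}^\infty$ be any sequence in $\mathcal M_p(\Gamma)$ and consider the sequence $(M_n)_{n=1}^\infty$ of Schur multipliers $M_n:=M_{\Phi(f_n)}$ on $A$. Then the set of asymptotically orthogonal decompositions of $(M_n)_n$ (in $B(A)$) with respect to $$\{M_{\Phi(f)} : f\in \mathcal M_p^{\le 1}(\Gamma)\}$$ is given by $$\Big\{ M_\xi:=\sum_{\widetilde\alpha\in\xi} M_{\Phi(\alpha)} \;:\; \xi \text{ is a limit point of } (\widetilde f_n)_n \text{ in } \widetilde{\mathcal X}_p(\Gamma)\Big\}$$ and contains all limit points of the sequence $(M_n)_n$ in the strong operator topology (the sum over the empty collection is understood as zero). Moreover, whenever the limit $\lim_{n\to\infty} M_n=M$ exists in the strong operator topology, every limit point $\xi\in\widetilde{\mathcal X}_p(\Gamma)$ of $(\widetilde f_n)_n$ satisfies $M=M_\xi=\sum_{\widetilde\alpha\in\xi}M_{\Phi(\alpha)}$.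
   Context: Matrices and algebras. $\Gamma$ is a countable discrete group, $\{\delta_x\}_{x\in\Gamma}$ the canonical orthonormal basis of $\ell^2(\Gamma)$. For $T\in B(\ell^2(\Gamma))$ put $T(x,y)=\langle\delta_x,T\delta_y\rangle$. $T$ has finite propagation if there is a finite $F\subset\Gamma$ such that $T(x,y)\neq0$ implies $xy^{-1}\in F$. The uniform Roe algebra $C_u^*(\Gamma)$ is the norm closure in $B(\ell^2(\Gamma))$ of the finite propagation operators. The reduced group $C^*$-algebra $C^*_\lambda(\Gamma)\subset B(\ell^2(\Gamma))$ is generated by the left regular representation $(\lambda(s)f)(x)=f(s^{-1}x)$. Schur multipliers. For a function $\varphi:\Gamma\to\mathbb C$, the Schur multiplier $M_\varphi$ (when it is well defined) is $T\mapsto[\varphi(xy^{-1})T(x,y)]_{x,y\in\Gamma}$ on $B(\ell^2(\Gamma))$; its restrictions to $C_u^*(\Gamma)$ and $C_\lambda^*(\Gamma)$ are bounded operators on those algebras, also denoted $M_\varphi$. For $f\in\ell^2(\Gamma)$, $\Phi(f)(s)=\sum_{t\in\Gamma}f(t)\overline{f(ts)}$; this is a positive definite function on $\Gamma$ depending only on the orbit of $f$ under the left action below, and $M_{\Phi(f)}$ is well defined. Functions and orbits. $\mathcal M_p(\Gamma)=\{f:\Gamma\to[0,1]:\|f\|_p=1\}$, $\mathcal M_p^{\le1}(\Gamma)=\{f:\Gamma\to[0,1]:\|f\|_p\le1\}$. $\Gamma$ acts on the left by $(\delta_s*f)(x)=f(s^{-1}x)$; $\widetilde f=\{\delta_s*f:s\in\Gamma\}$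 is the orbit of $f$. The space $\widetilde{\mathcal X}_p(\Gamma)$. It consists of all empty, finite or countable collections $\xi=\{\widetilde\alpha_i\}_{i\in I}$, $I\subset\mathbb N$, with $\alpha_i\in\mathcal M_p^{\le1}(\Gamma)$ and $\sum_{i\in I}\|\alpha_i\|_p^p\le1$; collections are unordered, counted with multiplicity, and the orbit $\widetilde 0$ of the zero function is disregarded (so $\{\widetilde0\}$ is identified with the empty collection). Its metric is defined as follows. Fix a proper left-invariant metric $d_\Gamma$ on $\Gamma$. For $k\ge2$ let $\mathcal F_k$ be the set of $g:\Gamma^k\to\mathbb R$ with $g(sx_1,\dots,sx_k)=g(x_1,\dots,x_k)$ for all $s,x_1,\dots,x_k\in\Gamma$ and $g(x_1,\dots,x_k)\to0$ as $\max_{i\ne j}d_\Gamma(x_i,x_j)\to\infty$. Fix a sequence $(g_r)_{r\ge1}$ in $\bigsqcup_{k\ge2}\mathcal F_k$, $g_r\in\mathcal F_{k_r}$, containing for each $k$ a subsequence uniformly dense in $\mathcal F_k$. Then $$\mathbf D_p(\xi,\xi')=\sum_{r\ge1}\frac{2^{-r}}{1+\|g_r\|_\infty}\Big|\sum_{\widetilde\alpha\in\xi}\sum_{x\in\Gamma^{k_r}}g_r(x)\prod_{i=1}^{k_r}\alpha(x_i)^p-\sum_{\widetilde\alpha\in\xi'}\sum_{x\in\Gamma^{k_r}}g_r(x)\prod_{i=1}^{k_r}\alpha(x_i)^p\Big| .$$ An orbit $\widetilde f$ with $f\in\mathcal M_p(\Gamma)$ is identified with $\{\widetilde f\}\in\widetilde{\mathcal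 X}_p(\Gamma)$. Asymptotically orthogonal decompositions. For a Banach space $X$, the strong operator topology on $B(X)$ is induced by the seminorms $T\mapsto\|Tx\|$, $x\in X$. For a sequence $(T_n)_n$ in $B(X)$ and $\mathcal S\subset B(X)$, an asymptotically orthogonal decomposition of $(T_n)_n$ with respect to $\mathcal S$ is a norm-convergent sum $\sum_{i\in I}S_i$, $I\subset\mathbb N$ (empty sum $=0$), with $S_i\in\mathcal S$ for all $i$, such that along some subsequence $T_n\to\sum_{i\in I}S_i$ in the strong operator topology and $\|T_n\|\to\sum_{i\in I}\|S_i\|$. *)

theory Defs
  imports "HOL-Analysis.Analysis"
begin

text \<open>
  The countable discrete group is a type of class \<^class>\<open>group_add\<close> and \<^class>\<open>countable\<close>.
  Despite the additive notation of \<^class>\<open>group_add\<close> the group need not be commutative: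
  \<open>x + y\<close> is the product \<open>xy\<close>, \<open>- x\<close> is the inverse of \<open>x\<close>, \<open>x - y\<close> is \<open>x\<close> times the
  inverse of \<open>y\<close>, and \<open>0\<close> is the neutral element.
\<close>

section \<open>The Hilbert space of square-summable functions\<close>

typedef 'a ell2 = "{f :: 'a \<Rightarrow> complex. (\<lambda>x. (cmod (f x))\<^sup>2) summable_on UNIV}"
  morphisms ell2_apply Abs_ell2
  by (intro exI[of _ "\<lambda>_. 0"]) simp

setup_lifting type_definition_ell2

lemma ell2_summable_add:
  assumes "(\<lambda>x. (cmod (f x))\<^sup>2) summable_on A" "(\<lambda>x. (cmod (g x))\<^sup>2) summable_on A"
  shows "(\<lambda>x. (cmod (f x + g x))\<^sup>2) summable_on A"
proof (rule summable_on_comparison_test)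
  show "(\<lambda>x. 2 * (cmod (f x))\<^sup>2 + 2 * (cmod (g x))\<^sup>2) summable_on A"
    by (intro summable_on_add summable_on_cmult_right assms)
  fix x
  have "(cmod (f x + g x))\<^sup>2 \<le> (cmod (f x) + cmod (g x))\<^sup>2"
    by (intro power_mono norm_triangle_ineq) simp
  also have "\<dots> \<le> 2 * (cmod (f x))\<^sup>2 + 2 * (cmod (g x))\<^sup>2"
    using sum_squares_bound[of "cmod (f x)" "cmod (g x)"] by (simp add: power2_sum)
  finally show "(cmod (f x + g x))\<^sup>2 \<le> 2 * (cmod (f x))\<^sup>2 + 2 * (cmod (g x))\<^sup>2" .
qed simp

lemma ell2_summable_mult:
  assumes "(\<lambda>x. (cmod (f x))\<^sup>2) summable_on A"
  shows "(\<lambda>x. (cmod (c * f x))\<^sup>2) summable_on A"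
  using summable_on_cmult_right[OF assms, of "(cmod c)\<^sup>2"]
  by (simp add: norm_mult power_mult_distrib)

lemma ell2_abs_summable_prod:
  assumes "(\<lambda>x. (cmod (f x))\<^sup>2) summable_on A" "(\<lambda>x. (cmod (g x))\<^sup>2) summable_on A"
  shows "(\<lambda>x. norm (cnj (f x) * g x)) summable_on A"
proof (rule summable_on_comparison_test)
  show "(\<lambda>x. (cmod (f x))\<^sup>2 + (cmod (g x))\<^sup>2) summable_on A"
    by (intro summable_on_add assms)
  fix x
  show "cmod (cnj (f x) * g x) \<le> (cmod (f x))\<^sup>2 + (cmod (g x))\<^sup>2"
    using sum_squares_bound[of "cmod (f x)" "cmod (g x)"]
      mult_nonneg_nonneg[OF norm_ge_zero[of "f x"] norm_ge_zero[of "g x"]]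
    unfolding norm_mult complex_mod_cnj mult.assoc by linarith
qed simp

text \<open>The inner product is linear in the second argument.\<close>

lift_definition cinner :: "'a ell2 \<Rightarrow> 'a ell2 \<Rightarrow> complex" is
  "\<lambda>u v. \<Sum>\<^sub>\<infinity>x. cnj (u x) * v x" .

lift_definition cscale :: "complex \<Rightarrow> 'a ell2 \<Rightarrow> 'a ell2" is "\<lambda>c f x. c * f x"
  by (simp add: ell2_summable_mult)

lift_definition ket :: "'a \<Rightarrow> 'a ell2" is "\<lambda>x y. if y = x then 1 else 0"
proof -
  fix x :: 'a
  have "(\<lambda>y. (cmod (if y = x then 1 else 0))\<^sup>2) summable_on {x}"
    by simp
  then show "(\<lambda>y. (cmod (if y = x then 1 else 0))\<^sup>2) summable_on UNIV"
    by (rule summable_on_cong_neutral[THEN iffD1, rotated -1]) auto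
qed

lemma cinner_self: "cinner u u = of_real (\<Sum>\<^sub>\<infinity>x. (cmod (ell2_apply u x))\<^sup>2)"
proof -
  have "(\<lambda>x. (cmod (ell2_apply u x))\<^sup>2) summable_on UNIV"
    using ell2_apply[of u] by simp
  from infsumI[OF has_sum_of_real[OF has_sum_infsum[OF this], where 'a = complex]]
  have "(\<Sum>\<^sub>\<infinity>x. of_real ((cmod (ell2_apply u x))\<^sup>2))
          = complex_of_real (\<Sum>\<^sub>\<infinity>x. (cmod (ell2_apply u x))\<^sup>2)" .
  moreover have "cnj z * z = of_real ((cmod z)\<^sup>2)" for z
    by (simp only: mult.commute[of "cnj z"] complex_norm_square)
  ultimately show ?thesis by (simp only: cinner.rep_eq)
qed

instantiation ell2 :: (type) real_inner
begin

lift_definition zero_ell2 :: "'a ell2" is "\<lambda>_. 0" by simp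
lift_definition plus_ell2 :: "'a ell2 \<Rightarrow> 'a ell2 \<Rightarrow> 'a ell2" is "\<lambda>f g x. f x + g x"
  by (rule ell2_summable_add)
lift_definition uminus_ell2 :: "'a ell2 \<Rightarrow> 'a ell2" is "\<lambda>f x. - f x" by simp
lift_definition minus_ell2 :: "'a ell2 \<Rightarrow> 'a ell2 \<Rightarrow> 'a ell2" is "\<lambda>f g x. f x - g x"
  subgoal for f g using ell2_summable_add[of f UNIV "\<lambda>x. - g x"] by simp
  done
lift_definition scaleR_ell2 :: "real \<Rightarrow> 'a ell2 \<Rightarrow> 'a ell2" is "\<lambda>r f x. r *\<^sub>R f x"
  subgoal for r f using ell2_summable_mult[of f UNIV "of_real r"] by (simp add: scaleR_conv_of_real)
  done

definition "inner u v = Re (cinner u v)" for u v :: "'a ell2"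
definition "norm u = sqrt (inner u u)" for u :: "'a ell2"
definition "dist u v = norm (u - v)" for u v :: "'a ell2"
definition "sgn u = inverse (norm u) *\<^sub>R u" for u :: "'a ell2"
definition "uniformity = (INF e\<in>{0<..}. principal {(u, v :: 'a ell2). dist u v < e})"
definition "open U = (\<forall>u\<in>U. \<forall>\<^sub>F (u', v) in uniformity. u' = u \<longrightarrow> v \<in> U)" for U :: "'a ell2 set"

instance
proof
  note defs = inner_ell2_def
  have summ: "(\<lambda>x. cnj (f x) * g x) summable_on UNIV"
    if "(\<lambda>x. (cmod (f x))\<^sup>2) summable_on UNIV" "(\<lambda>x. (cmod (g x))\<^sup>2) summable_on UNIV"
    for f g :: "'a \<Rightarrow> complex"
    by (rule abs_summable_summable[OF ell2_abs_summable_prod[OF that]])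
  fix u v w :: "'a ell2" and r s :: real
  show "u + v + w = u + (v + w)" by transfer (simp add: add.assoc)
  show "u + v = v + u" by transfer (simp add: add.commute)
  show "0 + u = u" by transfer simp
  show "- u + u = 0" by transfer simp
  show "u - v = u + - v" by transfer simp
  show "r *\<^sub>R (u + v) = r *\<^sub>R u + r *\<^sub>R v" by transfer (simp add: scaleR_add_right)
  show "(r + s) *\<^sub>R u = r *\<^sub>R u + s *\<^sub>R u" by transfer (simp add: scaleR_add_left)
  show "r *\<^sub>R s *\<^sub>R u = (r * s) *\<^sub>R u" by transfer simp
  show "1 *\<^sub>R u = u" by transfer simp
  show "dist u v = norm (u - v)" by (simp add: dist_ell2_def)
  show "sgn u = inverse (norm u) *\<^sub>R u" by (simp add: sgn_ell2_def)
  show "uniformity = (INF e\<in>{0<..}. principal {(u, v :: 'a ell2). dist u v < e})"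
    by (simp add: uniformity_ell2_def)
  show "open U = (\<forall>u\<in>U. \<forall>\<^sub>F (u', v) in uniformity. u' = u \<longrightarrow> v \<in> U)" for U :: "'a ell2 set"
    by (simp add: open_ell2_def)
  have "cinner u v = cnj (cinner v u)"
    by transfer (simp add: mult.commute flip: infsum_cnj)
  then show "inner u v = inner v u" by (simp add: defs)
  have "cinner (u + v) w = cinner u w + cinner v w"
    by transfer (simp add: distrib_right infsum_add summ)
  then show "inner (u + v) w = inner u w + inner v w" by (simp add: defs)
  have "cinner (r *\<^sub>R u) v = of_real r * cinner u v"
    by transfer (simp add: scaleR_conv_of_real mult.assoc summ flip: infsum_cmult_right)
  then show "inner (r *\<^sub>R u) v = r * inner u v" by (simp add: defs)
  have inner_self: "inner u u = (\<Sum>\<^sub>\<infinity>x. (cmod (ell2_apply u x))\<^sup>2)"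
    by (simp add: defs cinner_self)
  show "0 \<le> inner u u" unfolding inner_self by (intro infsum_nonneg) simp
  show "inner u u = 0 \<longleftrightarrow> u = 0"
  proof
    assume "inner u u = 0"
    then have "(cmod (ell2_apply u x))\<^sup>2 = 0" for x
      unfolding inner_self using ell2_apply[of u] by (intro nonneg_infsum_le_0D[of _ UNIV]) auto
    then show "u = 0" by (intro ell2_apply_inject[THEN iffD1] ext) (simp add: zero_ell2.rep_eq)
  qed (simp add: defs cinner.rep_eq zero_ell2.rep_eq)
  show "norm u = sqrt (inner u u)" by (simp add: norm_ell2_def)
qed

end

lemma ell2_norm_sq: "(norm u)\<^sup>2 = (\<Sum>\<^sub>\<infinity>x. (cmod (ell2_apply u x))\<^sup>2)"
  unfolding power2_norm_eq_inner inner_ell2_def cinner_self by simp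

lemma ell2_sum_le_norm_sq:
  assumes "finite F"
  shows "(\<Sum>x\<in>F. (cmod (ell2_apply u x))\<^sup>2) \<le> (norm u)\<^sup>2"
  unfolding ell2_norm_sq using ell2_apply[of u] assms
  by (intro finite_sum_le_infsum) auto

lemma ell2_apply_diff: "ell2_apply (u - v) x = ell2_apply u x - ell2_apply v x"
  by (simp add: minus_ell2.rep_eq)

instance ell2 :: (type) banach
proof
  fix X :: "nat \<Rightarrow> 'a ell2"
  assume C: "Cauchy X"
  have coord: "cmod (ell2_apply u x) \<le> norm u" for u :: "'a ell2" and x
    by (rule power2_le_imp_le) (use ell2_sum_le_norm_sq[of "{x}" u] in auto)
  have "Cauchy (\<lambda>n. ell2_apply (X n) x)" for x
  proof (rule CauchyI)
    fix e :: real assume "e > 0"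
    then obtain N where N: "\<forall>m\<ge>N. \<forall>n\<ge>N. norm (X m - X n) < e"
      using CauchyD[OF C] by blast
    have "cmod (ell2_apply (X m) x - ell2_apply (X n) x) < e" if "m \<ge> N" "n \<ge> N" for m n
    proof -
      have "cmod (ell2_apply (X m - X n) x) < e"
        using N that by (intro le_less_trans[OF coord]) auto
      then show ?thesis by (simp only: ell2_apply_diff)
    qed
    then show "\<exists>N. \<forall>m\<ge>N. \<forall>n\<ge>N. cmod (ell2_apply (X m) x - ell2_apply (X n) x) < e"
      by blast
  qed
  then have "\<exists>l. (\<lambda>n. ell2_apply (X n) x) \<longlonglongrightarrow> l" for x
    by (simp add: Cauchy_convergent_iff convergent_def)
  then have "\<exists>f. \<forall>x. (\<lambda>n. ell2_apply (X n) x) \<longlonglongrightarrow> f x" by (intro choice) blast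
  then obtain f where f: "\<And>x. (\<lambda>n. ell2_apply (X n) x) \<longlonglongrightarrow> f x" by blast
  have fin: "(\<Sum>x\<in>F. (cmod (ell2_apply (X m) x - f x))\<^sup>2) \<le> e\<^sup>2"
    if "finite F" "m \<ge> N" "\<forall>m\<ge>N. \<forall>n\<ge>N. norm (X m - X n) < e" for F m N e
  proof (rule LIMSEQ_le_const2)
    show "(\<lambda>n. \<Sum>x\<in>F. (cmod (ell2_apply (X m) x - ell2_apply (X n) x))\<^sup>2)
            \<longlonglongrightarrow> (\<Sum>x\<in>F. (cmod (ell2_apply (X m) x - f x))\<^sup>2)"
      by (intro tendsto_intros f)
    show "\<exists>N. \<forall>n\<ge>N. (\<Sum>x\<in>F. (cmod (ell2_apply (X m) x - ell2_apply (X n) x))\<^sup>2) \<le> e\<^sup>2"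
    proof (intro exI allI impI)
      fix n assume "n \<ge> N"
      have "norm (X m - X n) < e" using that(2,3) \<open>n \<ge> N\<close> by blast
      then have le: "(norm (X m - X n))\<^sup>2 \<le> e\<^sup>2" by (intro power_mono) simp_all
      have "(\<Sum>x\<in>F. (cmod (ell2_apply (X m - X n) x))\<^sup>2) \<le> (norm (X m - X n))\<^sup>2"
        using that(1) by (rule ell2_sum_le_norm_sq)
      also note le
      finally show "(\<Sum>x\<in>F. (cmod (ell2_apply (X m) x - ell2_apply (X n) x))\<^sup>2) \<le> e\<^sup>2"
        by (simp add: ell2_apply_diff)
    qed
  qed
  have summ: "(\<lambda>x. (cmod (ell2_apply (X m) x - f x))\<^sup>2) summable_on UNIV"
    if "m \<ge> N" "\<forall>m\<ge>N. \<forall>n\<ge>N. norm (X m - X n) < e" for m N e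
  proof (rule nonneg_bdd_above_summable_on)
    show "bdd_above (sum (\<lambda>x. (cmod (ell2_apply (X m) x - f x))\<^sup>2) ` {F. F \<subseteq> UNIV \<and> finite F})"
      by (rule bdd_aboveI2[where M = "e\<^sup>2"]) (rule fin[OF _ that], simp)
  qed simp
  obtain N0 where N0: "\<forall>m\<ge>N0. \<forall>n\<ge>N0. norm (X m - X n) < 1"
    using CauchyD[OF C, of 1] by auto
  have "(\<lambda>x. (cmod (f x))\<^sup>2) summable_on UNIV"
  proof -
    have "(\<lambda>x. (cmod (- (ell2_apply (X N0) x - f x)))\<^sup>2) summable_on UNIV"
      using summ[OF order_refl N0] by (simp only: norm_minus_cancel)
    then show ?thesis
      using ell2_summable_add[of "\<lambda>x. - (ell2_apply (X N0) x - f x)" UNIV "ell2_apply (X N0)"]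
        ell2_apply[of "X N0"] by simp
  qed
  then have L: "ell2_apply (Abs_ell2 f) = f" by (simp add: Abs_ell2_inverse)
  have "X \<longlonglongrightarrow> Abs_ell2 f"
  proof (rule LIMSEQ_I)
    fix e :: real assume "e > 0"
    then obtain N where N: "\<forall>m\<ge>N. \<forall>n\<ge>N. norm (X m - X n) < e / 2"
      using CauchyD[OF C, of "e / 2"] by auto
    have "norm (X m - Abs_ell2 f) < e" if "m \<ge> N" for m
    proof -
      have "(norm (X m - Abs_ell2 f))\<^sup>2 \<le> (e / 2)\<^sup>2"
        unfolding ell2_norm_sq ell2_apply_diff L
        by (rule infsum_le_finite_sums[OF summ[OF that N]]) (rule fin[OF _ that N])
      then have "norm (X m - Abs_ell2 f) \<le> e / 2"
        by (rule power2_le_imp_le) (use \<open>e > 0\<close> in auto)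
      then show ?thesis using \<open>e > 0\<close> by simp
    qed
    then show "\<exists>no. \<forall>n\<ge>no. norm (X n - Abs_ell2 f) < e" by blast
  qed
  then show "convergent X" by (auto simp: convergent_def)
qed


section \<open>Operators, the uniform Roe algebra and the reduced group algebra\<close>

text \<open>
  The type \<open>'a ell2 \<Rightarrow>\<^sub>L 'a ell2\<close> consists of real-linear bounded maps; the
  complex-linear ones among them form \<open>B(\<ell>\<^sup>2)\<close>, with the operator norm.
\<close>

definition bounded_ops :: "('a ell2 \<Rightarrow>\<^sub>L 'a ell2) set" where
  "bounded_ops = {T :: 'a ell2 \<Rightarrow>\<^sub>L 'a ell2. \<forall>c u. T (cscale c u) = cscale c (T u)}"

definition matrix_coeff :: "('a ell2 \<Rightarrow>\<^sub>L 'a ell2) \<Rightarrow> 'a \<Rightarrow> 'a \<Rightarrow> complex" where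
  "matrix_coeff T x y = cinner (ket x) (T (ket y))"

definition finite_propagation :: "('a::group_add ell2 \<Rightarrow>\<^sub>L 'a ell2) \<Rightarrow> bool" where
  "finite_propagation T \<longleftrightarrow> (\<exists>F. finite F \<and> (\<forall>x y. matrix_coeff T x y \<noteq> 0 \<longrightarrow> x - y \<in> F))"

definition uniform_roe_set :: "('a::group_add ell2 \<Rightarrow>\<^sub>L 'a ell2) set" where
  "uniform_roe_set = closure {T \<in> bounded_ops. finite_propagation T}"

definition is_adjoint :: "('a ell2 \<Rightarrow>\<^sub>L 'a ell2) \<Rightarrow> ('a ell2 \<Rightarrow>\<^sub>L 'a ell2) \<Rightarrow> bool" where
  "is_adjoint T' T \<longleftrightarrow> (\<forall>u v. cinner (T' u) v = cinner u (T v))"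

definition cstar_subalgebra :: "('a ell2 \<Rightarrow>\<^sub>L 'a ell2) set \<Rightarrow> bool" where
  "cstar_subalgebra S \<longleftrightarrow>
     S \<subseteq> bounded_ops \<and> closed S \<and> 0 \<in> S \<and>
     (\<forall>T\<in>S. \<forall>T'\<in>S. T + T' \<in> S) \<and>
     (\<forall>T\<in>S. \<forall>T'\<in>bounded_ops. \<forall>c. (\<forall>u. blinfun_apply T' u = cscale c (blinfun_apply T u)) \<longrightarrow> T' \<in> S) \<and>
     (\<forall>T\<in>S. \<forall>T'\<in>S. T o\<^sub>L T' \<in> S) \<and>
     (\<forall>T\<in>S. \<forall>T'\<in>bounded_ops. is_adjoint T' T \<longrightarrow> T' \<in> S)"

lift_definition translate_ell2 :: "'a::group_add \<Rightarrow> 'a ell2 \<Rightarrow> 'a ell2" is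
  "\<lambda>s f x. f (- s + x)"
proof -
  fix s :: 'a and f :: "'a \<Rightarrow> complex"
  assume "(\<lambda>x. (cmod (f x))\<^sup>2) summable_on UNIV"
  then show "(\<lambda>x. (cmod (f (- s + x)))\<^sup>2) summable_on UNIV"
    by (subst summable_on_reindex_bij_betw[where g = "\<lambda>x. - s + x" and B = UNIV])
       (auto intro!: bij_betwI[where g = "\<lambda>x. s + x"] simp: add.assoc[symmetric])
qed

lift_definition left_regular :: "'a::group_add \<Rightarrow> 'a ell2 \<Rightarrow>\<^sub>L 'a ell2" is translate_ell2
proof -
  fix s :: 'a
  have n: "norm (translate_ell2 s u) = norm u" for u
  proof -
    have "(norm (translate_ell2 s u))\<^sup>2 = (norm u)\<^sup>2"
      unfolding ell2_norm_sq translate_ell2.rep_eq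
      by (rule infsum_reindex_bij_betw[where g = "\<lambda>x. - s + x" and B = UNIV])
         (auto intro!: bij_betwI[where g = "\<lambda>x. s + x"] simp: add.assoc[symmetric])
    then show ?thesis by (simp add: power2_eq_iff_nonneg)
  qed
  show "bounded_linear (translate_ell2 s)"
  proof (rule bounded_linear_intro[where K = 1])
    show "translate_ell2 s (u + v) = translate_ell2 s u + translate_ell2 s v" for u v
      by transfer simp
    show "translate_ell2 s (r *\<^sub>R u) = r *\<^sub>R translate_ell2 s u" for r u
      by transfer simp
    show "norm (translate_ell2 s u) \<le> norm u * 1" for u by (simp add: n)
  qed
qed

text \<open>The C*-algebra generated by the left regular representation.\<close>

definition reduced_cstar_set :: "('a::group_add ell2 \<Rightarrow>\<^sub>L 'a ell2) set" where
  "reduced_cstar_set = \<Inter>{S. cstar_subalgebra S \<and> range left_regular \<subseteq> S}"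

lemma cscale_zero [simp]: "cscale c 0 = 0"
  by transfer simp

lemma cscale_add: "cscale c (u + v) = cscale c u + cscale c v"
  by transfer (simp add: algebra_simps)

lemma cscale_scaleR: "cscale c (r *\<^sub>R u) = r *\<^sub>R cscale c u"
  by transfer simp

lemma cscale_of_real: "cscale (of_real r) u = r *\<^sub>R u"
  by transfer (simp add: scaleR_conv_of_real)

lemma subspace_bounded_ops: "subspace bounded_ops"
  by (auto simp: subspace_def bounded_ops_def blinfun.add_left blinfun.scaleR_left cscale_add
      cscale_scaleR blinfun.zero_left)

lemma matrix_coeff_add: "matrix_coeff (S + T) x y = matrix_coeff S x y + matrix_coeff T x y"
proof -
  have summ: "(\<lambda>z. cnj (ell2_apply u z) * ell2_apply v z) summable_on UNIV" for u v :: "'a ell2"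
    using ell2_apply[of u] ell2_apply[of v]
    by (intro abs_summable_summable[OF ell2_abs_summable_prod]) auto
  show ?thesis
    by (simp add: matrix_coeff_def blinfun.add_left cinner.rep_eq plus_ell2.rep_eq distrib_left
        infsum_add[OF summ summ])
qed

lemma matrix_coeff_scaleR: "matrix_coeff (r *\<^sub>R T) x y = r *\<^sub>R matrix_coeff T x y"
  by (simp add: matrix_coeff_def blinfun.scaleR_left cinner.rep_eq scaleR_ell2.rep_eq infsum_scaleR_right)

lemma subspace_uniform_roe: "subspace (uniform_roe_set :: ('a::group_add ell2 \<Rightarrow>\<^sub>L 'a ell2) set)"
proof -
  let ?B = "{T :: 'a ell2 \<Rightarrow>\<^sub>L 'a ell2. T \<in> bounded_ops \<and> finite_propagation T}"
  have S: "subspace ?B"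
    unfolding subspace_def
  proof (intro conjI ballI allI)
    show "0 \<in> ?B"
      using subspace_bounded_ops
      by (auto simp: finite_propagation_def matrix_coeff_def blinfun.zero_left cinner.rep_eq
          zero_ell2.rep_eq subspace_def)
  next
    fix S T assume ST: "S \<in> ?B"
      "T \<in> ?B"
    then obtain F G where "finite F" "\<forall>x y. matrix_coeff S x y \<noteq> 0 \<longrightarrow> x - y \<in> F"
      "finite G" "\<forall>x y. matrix_coeff T x y \<noteq> 0 \<longrightarrow> x - y \<in> G"
      by (auto simp: finite_propagation_def)
    then have "finite (F \<union> G) \<and> (\<forall>x y. matrix_coeff (S + T) x y \<noteq> 0 \<longrightarrow> x - y \<in> F \<union> G)"
      by (auto simp: matrix_coeff_add) (metis add_0)
    then show "S + T \<in> ?B"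
      using ST subspace_bounded_ops subspace_add unfolding finite_propagation_def by blast
  next
    fix r T assume T: "T \<in> ?B"
    then show "r *\<^sub>R T \<in> ?B"
      using subspace_scale[OF subspace_bounded_ops]
      by (auto simp: finite_propagation_def matrix_coeff_scaleR)
  qed
  show ?thesis
    unfolding uniform_roe_set_def subspace_def
  proof (intro conjI ballI allI)
    show "0 \<in> closure ?B"
      by (rule subsetD[OF closure_subset subspace_0[OF S]])
  next
    fix U V assume "U \<in> closure ?B"
      "V \<in> closure ?B"
    then obtain u v where "\<And>n. u n \<in> ?B" "u \<longlonglongrightarrow> U" "\<And>n. v n \<in> ?B" "v \<longlonglongrightarrow> V"
      unfolding closure_sequential by blast
    then have "\<And>n. u n + v n \<in> ?B" "(\<lambda>n. u n + v n) \<longlonglongrightarrow> U + V"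
      using subspace_add[OF S] by (blast, intro tendsto_add)
    then show "U + V \<in> closure ?B"
      unfolding closure_sequential by (intro exI[of _ "\<lambda>n. u n + v n"]) blast
  next
    fix r U assume "U \<in> closure ?B"
    then obtain u where "\<And>n. u n \<in> ?B" "u \<longlonglongrightarrow> U"
      unfolding closure_sequential by blast
    then have "\<And>n. r *\<^sub>R u n \<in> ?B" "(\<lambda>n. r *\<^sub>R u n) \<longlonglongrightarrow> r *\<^sub>R U"
      using subspace_scale[OF S] by (blast, intro tendsto_scaleR tendsto_const)
    then show "r *\<^sub>R U \<in> closure ?B"
      unfolding closure_sequential by (intro exI[of _ "\<lambda>n. r *\<^sub>R u n"]) blast
  qed
qed

lemma closed_uniform_roe: "closed uniform_roe_set"
  by (simp add: uniform_roe_set_def)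

lemma subspace_cstar_subalgebra:
  assumes "cstar_subalgebra S"
  shows "subspace S"
  unfolding subspace_def
proof (intro conjI ballI allI)
  note S = assms[unfolded cstar_subalgebra_def]
  show "0 \<in> S" using S by (elim conjE)
  show "T + T' \<in> S" if "T \<in> S" "T' \<in> S" for T T'
    using S that by (elim conjE) (drule (1) bspec, drule (1) bspec, assumption)
  fix r T assume T: "T \<in> S"
  have scale: "T' \<in> S" if "T' \<in> bounded_ops" "\<And>u. T' u = cscale c (T u)" for T' c
    using S T that by (elim conjE) blast
  have "S \<subseteq> bounded_ops" using S by (elim conjE)
  then have "r *\<^sub>R T \<in> bounded_ops"
    using T subspace_scale[OF subspace_bounded_ops] by blast
  then show "r *\<^sub>R T \<in> S"
    by (rule scale[where c = "of_real r"]) (simp add: cscale_of_real blinfun.scaleR_left)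
qed

lemma subspace_reduced_cstar: "subspace reduced_cstar_set"
  unfolding reduced_cstar_set_def
  by (rule subspace_Inter) (auto intro: subspace_cstar_subalgebra)

lemma closed_reduced_cstar: "closed reduced_cstar_set"
  unfolding reduced_cstar_set_def by (rule closed_Inter) (auto simp: cstar_subalgebra_def)

text \<open>
  Both algebras as types, so that the bounded operators on them, with norm and strong operator
  topology, are those of the library.  The space \<open>'x \<Rightarrow>\<^sub>L 'x\<close> consists of real-linear maps; the
  complex-linear ones form a subspace closed in the strong operator topology, on which norm and
  strong operator topology are inherited, and all Schur multipliers lie in it.
\<close>

typedef (overloaded) ('a::group_add) uniform_roe = "uniform_roe_set :: ('a ell2 \<Rightarrow>\<^sub>L 'a ell2) set"
  using subspace_0[OF subspace_uniform_roe] by blast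

setup_lifting type_definition_uniform_roe

instantiation uniform_roe :: (group_add) real_normed_vector
begin

lift_definition zero_uniform_roe :: "'a uniform_roe" is 0
  by (rule subspace_0[OF subspace_uniform_roe])
lift_definition plus_uniform_roe :: "'a uniform_roe \<Rightarrow> 'a uniform_roe \<Rightarrow> 'a uniform_roe" is "(+)"
  by (rule subspace_add[OF subspace_uniform_roe])
lift_definition uminus_uniform_roe :: "'a uniform_roe \<Rightarrow> 'a uniform_roe" is uminus
  by (rule subspace_neg[OF subspace_uniform_roe])
lift_definition minus_uniform_roe :: "'a uniform_roe \<Rightarrow> 'a uniform_roe \<Rightarrow> 'a uniform_roe" is "(-)"
  by (rule subspace_diff[OF subspace_uniform_roe])
lift_definition scaleR_uniform_roe :: "real \<Rightarrow> 'a uniform_roe \<Rightarrow> 'a uniform_roe" is scaleR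
  by (rule subspace_scale[OF subspace_uniform_roe])
lift_definition norm_uniform_roe :: "'a uniform_roe \<Rightarrow> real" is norm .
definition "dist T S = norm (T - S)" for T S :: "'a uniform_roe"
definition "sgn T = inverse (norm T) *\<^sub>R T" for T :: "'a uniform_roe"
definition "uniformity = (INF e\<in>{0<..}. principal {(T, S :: 'a uniform_roe). dist T S < e})"
definition "open U = (\<forall>T\<in>U. \<forall>\<^sub>F (T', S) in uniformity. T' = T \<longrightarrow> S \<in> U)"
  for U :: "'a uniform_roe set"

instance
  by (standard; (simp add: dist_uniform_roe_def sgn_uniform_roe_def uniformity_uniform_roe_def
        open_uniform_roe_def; fail)?; transfer)
     (auto simp: algebra_simps intro: norm_triangle_ineq)

end

instance uniform_roe :: (group_add) banach
proof
  fix X :: "nat \<Rightarrow> 'a uniform_roe"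
  assume C: "Cauchy X"
  have eq: "norm (X m - X n) = norm (Rep_uniform_roe (X m) - Rep_uniform_roe (X n))" for m n
    by (simp add: norm_uniform_roe.rep_eq minus_uniform_roe.rep_eq)
  have "Cauchy (\<lambda>n. Rep_uniform_roe (X n))"
    using C unfolding Cauchy_iff eq .
  then obtain L where L: "(\<lambda>n. Rep_uniform_roe (X n)) \<longlonglongrightarrow> L"
    by (auto simp: Cauchy_convergent_iff convergent_def)
  have "L \<in> uniform_roe_set"
    by (rule closed_sequentially[OF closed_uniform_roe _ L]) (rule Rep_uniform_roe)
  then have "X \<longlonglongrightarrow> Abs_uniform_roe L"
    using L unfolding LIMSEQ_iff
    by (simp add: norm_uniform_roe.rep_eq minus_uniform_roe.rep_eq Abs_uniform_roe_inverse)
  then show "convergent X" by (auto simp: convergent_def)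
qed

typedef (overloaded) ('a::group_add) reduced_cstar = "reduced_cstar_set :: ('a ell2 \<Rightarrow>\<^sub>L 'a ell2) set"
  using subspace_0[OF subspace_reduced_cstar] by blast

setup_lifting type_definition_reduced_cstar

instantiation reduced_cstar :: (group_add) real_normed_vector
begin

lift_definition zero_reduced_cstar :: "'a reduced_cstar" is 0
  by (rule subspace_0[OF subspace_reduced_cstar])
lift_definition plus_reduced_cstar :: "'a reduced_cstar \<Rightarrow> 'a reduced_cstar \<Rightarrow> 'a reduced_cstar" is "(+)"
  by (rule subspace_add[OF subspace_reduced_cstar])
lift_definition uminus_reduced_cstar :: "'a reduced_cstar \<Rightarrow> 'a reduced_cstar" is uminus
  by (rule subspace_neg[OF subspace_reduced_cstar])
lift_definition minus_reduced_cstar :: "'a reduced_cstar \<Rightarrow> 'a reduced_cstar \<Rightarrow> 'a reduced_cstar" is "(-)"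
  by (rule subspace_diff[OF subspace_reduced_cstar])
lift_definition scaleR_reduced_cstar :: "real \<Rightarrow> 'a reduced_cstar \<Rightarrow> 'a reduced_cstar" is scaleR
  by (rule subspace_scale[OF subspace_reduced_cstar])
lift_definition norm_reduced_cstar :: "'a reduced_cstar \<Rightarrow> real" is norm .
definition "dist T S = norm (T - S)" for T S :: "'a reduced_cstar"
definition "sgn T = inverse (norm T) *\<^sub>R T" for T :: "'a reduced_cstar"
definition "uniformity = (INF e\<in>{0<..}. principal {(T, S :: 'a reduced_cstar). dist T S < e})"
definition "open U = (\<forall>T\<in>U. \<forall>\<^sub>F (T', S) in uniformity. T' = T \<longrightarrow> S \<in> U)"
  for U :: "'a reduced_cstar set"

instance
  by (standard; (simp add: dist_reduced_cstar_def sgn_reduced_cstar_def uniformity_reduced_cstar_def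
        open_reduced_cstar_def; fail)?; transfer)
     (auto simp: algebra_simps intro: norm_triangle_ineq)

end

instance reduced_cstar :: (group_add) banach
proof
  fix X :: "nat \<Rightarrow> 'a reduced_cstar"
  assume C: "Cauchy X"
  have eq: "norm (X m - X n) = norm (Rep_reduced_cstar (X m) - Rep_reduced_cstar (X n))" for m n
    by (simp add: norm_reduced_cstar.rep_eq minus_reduced_cstar.rep_eq)
  have "Cauchy (\<lambda>n. Rep_reduced_cstar (X n))"
    using C unfolding Cauchy_iff eq .
  then obtain L where L: "(\<lambda>n. Rep_reduced_cstar (X n)) \<longlonglongrightarrow> L"
    by (auto simp: Cauchy_convergent_iff convergent_def)
  have "L \<in> reduced_cstar_set"
    by (rule closed_sequentially[OF closed_reduced_cstar _ L]) (rule Rep_reduced_cstar)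
  then have "X \<longlonglongrightarrow> Abs_reduced_cstar L"
    using L unfolding LIMSEQ_iff
    by (simp add: norm_reduced_cstar.rep_eq minus_reduced_cstar.rep_eq Abs_reduced_cstar_inverse)
  then show "convergent X" by (auto simp: convergent_def)
qed


section \<open>Schur multipliers\<close>

text \<open>
  Here \<open>\<iota>\<close> is the inclusion of an operator algebra into \<open>B(\<ell>\<^sup>2)\<close>, in this development
  \<^const>\<open>Rep_uniform_roe\<close> or \<^const>\<open>Rep_reduced_cstar\<close>.  The multiplier is determined uniquely by its
  effect on matrix coefficients; it is unspecified if \<open>\<phi>\<close> does not define a bounded operator.
\<close>

definition schur_multiplier ::
    "('x::banach \<Rightarrow> ('a::group_add ell2 \<Rightarrow>\<^sub>L 'a ell2)) \<Rightarrow> ('a \<Rightarrow> complex) \<Rightarrow> 'x \<Rightarrow>\<^sub>L 'x" where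
  "schur_multiplier \<iota> \<phi> = (THE M :: 'x \<Rightarrow>\<^sub>L 'x. \<forall>T x y. matrix_coeff (\<iota> (M T)) x y = \<phi> (x - y) * matrix_coeff (\<iota> T) x y)"

definition Phi :: "('a::group_add \<Rightarrow> complex) \<Rightarrow> 'a \<Rightarrow> complex" where
  "Phi f s = (\<Sum>\<^sub>\<infinity>t. f t * cnj (f (t + s)))"

definition M_Phi ::
    "('x::banach \<Rightarrow> ('a::group_add ell2 \<Rightarrow>\<^sub>L 'a ell2)) \<Rightarrow> ('a \<Rightarrow> real) \<Rightarrow> 'x \<Rightarrow>\<^sub>L 'x" where
  "M_Phi \<iota> f = schur_multiplier \<iota> (Phi (\<lambda>x. complex_of_real (f x)))"


section \<open>Functions, orbits and collections of orbits\<close>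

definition lp_norm :: "real \<Rightarrow> ('a \<Rightarrow> real) \<Rightarrow> real" where
  "lp_norm p f = (\<Sum>\<^sub>\<infinity>x. \<bar>f x\<bar> powr p) powr (1 / p)"

definition Mp :: "real \<Rightarrow> ('a \<Rightarrow> real) set" where
  "Mp p = {f. range f \<subseteq> {0..1} \<and> (\<lambda>x. \<bar>f x\<bar> powr p) summable_on UNIV \<and> lp_norm p f = 1}"

definition Mp_le1 :: "real \<Rightarrow> ('a \<Rightarrow> real) set" where
  "Mp_le1 p = {f. range f \<subseteq> {0..1} \<and> (\<lambda>x. \<bar>f x\<bar> powr p) summable_on UNIV \<and> lp_norm p f \<le> 1}"

definition orbit :: "('a::group_add \<Rightarrow> real) \<Rightarrow> ('a \<Rightarrow> real) set" where
  "orbit f = {\<lambda>x. f (- s + x) | s. True}"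

text \<open>
  An unordered collection of orbits, counted with multiplicity, is given by its multiplicity
  function.  The multiplicity of the zero orbit is set to \<open>0\<close>, as this orbit is disregarded.
\<close>

type_synonym 'a collection = "('a \<Rightarrow> real) set \<Rightarrow> nat"

definition collection_of :: "nat set \<Rightarrow> (nat \<Rightarrow> 'a::group_add \<Rightarrow> real) \<Rightarrow> 'a collection" where
  "collection_of I \<alpha> = (\<lambda>c. if c = orbit (\<lambda>_. 0) then 0 else card {i \<in> I. orbit (\<alpha> i) = c})"

definition X_space :: "real \<Rightarrow> 'a::group_add collection set" where
  "X_space p = {collection_of I \<alpha> | I \<alpha>.
     (\<forall>i\<in>I. \<alpha> i \<in> Mp_le1 p) \<and>
     (\<lambda>i. lp_norm p (\<alpha> i) powr p) summable_on I \<and> (\<Sum>\<^sub>\<infinity>i\<in>I. lp_norm p (\<alpha> i) powr p) \<le> 1}"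

definition single :: "('a::group_add \<Rightarrow> real) \<Rightarrow> 'a collection" where
  "single f = collection_of {0} (\<lambda>_. f)"

text \<open>
  The members of a collection with repetition: an orbit of multiplicity \<open>m\<close> occurs as
  \<open>(c, 0), \<dots>, (c, m - 1)\<close>.  In sums over a collection, every orbit is evaluated at an arbitrary
  representative.
\<close>

definition members :: "'a collection \<Rightarrow> (('a \<Rightarrow> real) set \<times> nat) set" where
  "members \<xi> = {(c, j). j < \<xi> c}"

definition rep :: "('a \<Rightarrow> real) set \<Rightarrow> 'a \<Rightarrow> real" where
  "rep c = (SOME \<alpha>. \<alpha> \<in> c)"

definition M_coll ::
    "('x::banach \<Rightarrow> ('a::group_add ell2 \<Rightarrow>\<^sub>L 'a ell2)) \<Rightarrow> 'a collection \<Rightarrow> 'x \<Rightarrow>\<^sub>L 'x" where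
  "M_coll \<iota> \<xi> = (\<Sum>\<^sub>\<infinity>(c, j)\<in>members \<xi>. M_Phi \<iota> (rep c))"

definition M_coll_convergent ::
    "('x::banach \<Rightarrow> ('a::group_add ell2 \<Rightarrow>\<^sub>L 'a ell2)) \<Rightarrow> 'a collection \<Rightarrow> bool" where
  "M_coll_convergent \<iota> \<xi> \<longleftrightarrow> (\<lambda>(c, j). M_Phi \<iota> (rep c)) summable_on members \<xi>"


section \<open>The metric on collections\<close>

definition proper_left_invariant_metric :: "('a::group_add \<Rightarrow> 'a \<Rightarrow> real) \<Rightarrow> bool" where
  "proper_left_invariant_metric d \<longleftrightarrow>
     Metric_space UNIV d \<and> (\<forall>s x y. d (s + x) (s + y) = d x y) \<and> (\<forall>x R. finite {y. d x y \<le> R})"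

text \<open>Points of the \<open>k\<close>-fold power of the group are lists of length \<open>k\<close>.\<close>

definition tuples :: "nat \<Rightarrow> 'a list set" where
  "tuples k = {xs. length xs = k}"

definition max_dist :: "('a \<Rightarrow> 'a \<Rightarrow> real) \<Rightarrow> 'a list \<Rightarrow> real" where
  "max_dist d xs = Max {d (xs ! i) (xs ! j) | i j. i < length xs \<and> j < length xs \<and> i \<noteq> j}"

definition test_functions :: "('a::group_add \<Rightarrow> 'a \<Rightarrow> real) \<Rightarrow> nat \<Rightarrow> ('a list \<Rightarrow> real) set" where
  "test_functions d k = {g.
     (\<forall>s. \<forall>xs\<in>tuples k. g (map (\<lambda>x. s + x) xs) = g xs) \<and>
     (\<forall>\<epsilon>>0. \<exists>R. \<forall>xs\<in>tuples k. max_dist d xs > R \<longrightarrow> \<bar>g xs\<bar> < \<epsilon>)}"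

text \<open>Sequences are indexed from \<open>0\<close>, so the weight of \<open>g r\<close> in the metric is \<open>2\<close> to the power \<open>- (r + 1)\<close>.\<close>

definition dense_test_sequence ::
    "('a::group_add \<Rightarrow> 'a \<Rightarrow> real) \<Rightarrow> (nat \<Rightarrow> nat) \<Rightarrow> (nat \<Rightarrow> 'a list \<Rightarrow> real) \<Rightarrow> bool" where
  "dense_test_sequence d k g \<longleftrightarrow>
     (\<forall>r. k r \<ge> 2 \<and> g r \<in> test_functions d (k r)) \<and>
     (\<forall>m\<ge>2. \<exists>\<sigma> :: nat \<Rightarrow> nat. strict_mono \<sigma> \<and> (\<forall>j. k (\<sigma> j) = m) \<and>
        (\<forall>h\<in>test_functions d m. \<forall>\<epsilon>>0. \<exists>j. \<forall>xs\<in>tuples m. \<bar>g (\<sigma> j) xs - h xs\<bar> < \<epsilon>))"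

definition functional :: "real \<Rightarrow> nat \<Rightarrow> ('a list \<Rightarrow> real) \<Rightarrow> 'a collection \<Rightarrow> real" where
  "functional p k g \<xi> =
     (\<Sum>\<^sub>\<infinity>(c, j)\<in>members \<xi>. \<Sum>\<^sub>\<infinity>xs\<in>tuples k. g xs * (\<Prod>i<k. rep c (xs ! i) powr p))"

definition D_metric ::
    "real \<Rightarrow> (nat \<Rightarrow> nat) \<Rightarrow> (nat \<Rightarrow> 'a list \<Rightarrow> real) \<Rightarrow> 'a collection \<Rightarrow> 'a collection \<Rightarrow> real" where
  "D_metric p k g \<xi> \<xi>' =
     (\<Sum>r. (1 / 2) ^ Suc r / (1 + (SUP xs\<in>tuples (k r). \<bar>g r xs\<bar>)) *
        \<bar>functional p (k r) (g r) \<xi> - functional p (k r) (g r) \<xi>'\<bar>)"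

text \<open>Limit points in the metric space \<open>X_space p\<close> of a sequence in it.\<close>

definition X_limit_points ::
    "real \<Rightarrow> (nat \<Rightarrow> nat) \<Rightarrow> (nat \<Rightarrow> 'a::group_add list \<Rightarrow> real) \<Rightarrow> (nat \<Rightarrow> 'a collection)
      \<Rightarrow> 'a collection set" where
  "X_limit_points p k g \<xi>s = {\<xi> \<in> X_space p. \<forall>\<epsilon>>0. \<exists>\<^sub>\<infinity>n. D_metric p k g (\<xi>s n) \<xi> < \<epsilon>}"


section \<open>Asymptotically orthogonal decompositions\<close>

text \<open>Limit points in the sense of cluster points; the topology need not be metrizable.\<close>

definition sot_limit_points :: "(nat \<Rightarrow> 'x::banach \<Rightarrow>\<^sub>L 'x) \<Rightarrow> ('x \<Rightarrow>\<^sub>L 'x) set" where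
  "sot_limit_points T =
     {M. \<forall>U. openin strong_operator_topology U \<and> M \<in> U \<longrightarrow> (\<exists>\<^sub>\<infinity>n. T n \<in> U)}"

text \<open>
  The elements of this set are the values of the decompositions.  Summability of the norms is
  implicit in the convergence of \<open>norm (T n)\<close> to their sum, as \<open>T\<close> is norm-bounded along a
  strongly convergent subsequence.
\<close>

definition asymp_orth_decompositions ::
    "(nat \<Rightarrow> 'x::banach \<Rightarrow>\<^sub>L 'x) \<Rightarrow> ('x \<Rightarrow>\<^sub>L 'x) set \<Rightarrow> ('x \<Rightarrow>\<^sub>L 'x) set" where
  "asymp_orth_decompositions T \<S> = {M. \<exists>(I :: nat set) S \<sigma>.
     (\<forall>i\<in>I. S i \<in> \<S>) \<and> (S has_sum M) I \<and> strict_mono \<sigma> \<and>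
     limitin strong_operator_topology (\<lambda>n. T (\<sigma> n)) M sequentially \<and>
     (\<lambda>i. norm (S i)) summable_on I \<and> (\<lambda>n. norm (T (\<sigma> n))) \<longlonglongrightarrow> (\<Sum>\<^sub>\<infinity>i\<in>I. norm (S i))}"

end

theory Submission
  imports Defs "HOL-Complex_Analysis.Great_Picard"
begin

text \<open>The proof rests on two descriptions, one of the multipliers and one of the metric on collections,
  both in terms of the autocorrelation \<open>s \<mapsto> \<Sum>t. f t * f (t + s)\<close> of a real function \<open>f\<close>, which is
  \<^const>\<open>Phi\<close> of \<open>f\<close>.

  Multipliers.  As \<open>Phi f (x - y) = \<Sum>r. f (r - x) * f (r - y)\<close>, the multiplier of \<open>f\<close> is
  \<open>T \<mapsto> \<Sum>r. D r T D r\<close>, where \<open>D r\<close> multiplies by the function \<open>x \<mapsto> f (r - x)\<close>.  By the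
  Cauchy-Schwarz inequality its norm is at most the square of the \<open>\<ell>\<^sup>2\<close>-norm of \<open>f\<close>, and this
  value, which is \<open>Phi f 0\<close>, is attained at the identity operator (\<open>norm_M_Phi\<close>).  Operators of finite propagation are
  dense, and on such an operator a multiplier involves only finitely many values of its symbol.  For
  bounded sequences of multipliers strong convergence is therefore pointwise convergence of the
  symbols, and every strong limit point again has a symbol
  (\<open>strong_convergence_if_symbols_converge\<close>, \<open>sot_limit_point_has_symbol\<close>).  The theorem becomes a
  statement on the convergence of autocorrelations; evaluation at \<open>0\<close> accounts for the norms.

  The metric.  Put \<open>\<mu> x = f x powr p\<close>.  Up to a uniformly small error a test function has only finitely
  many values that matter, one for each pattern \<open>ys\<close> of \<open>k \<ge> 2\<close> group elements, and so convergence
  in the metric is convergence of all the pattern sums \<open>\<Sum>t. \<mu> (t + y\<^sub>1) * \<dots> * \<mu> (t + y\<^sub>k)\<close>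
  (\<open>D_metric_limit_pattern_sums\<close>, \<open>D_metric_limit_if_pattern_sums_converge\<close>).  The autocorrelation
  is the sum of \<open>w powr (1 / p)\<close> with \<open>w = \<mu> t * \<mu> (t + s)\<close>, whereas pattern sums give the sums of \<open>w ^ m\<close>
  for \<open>m \<ge> 1\<close>.  Here \<open>p < 2\<close> enters: then \<open>w powr (1 / p)\<close> is of smaller order than \<open>sqrt w\<close> at \<open>0\<close>, and it
  is approximated within \<open>\<epsilon> * sqrt w\<close> by polynomials without constant term, while the sum of
  \<open>sqrt w\<close> over \<open>t\<close> is at most the mass of \<open>\<mu>\<close>, by the inequality of the arithmetic and the geometric
  mean.  Thus convergence of the orbits to \<open>\<xi>\<close> implies
  strong convergence of the multipliers to \<open>M_\<xi>\<close>, and convergence of the norms (\<open>Mn_converges\<close>).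

  Compactness.  The points where \<open>\<mu>\<close> is large can be listed with a uniform bound on their number.
  Along a diagonal subsequence any two points of these lists are either eventually at a fixed offset or
  eventually not at any given offset, so that they fall into clusters, and the distributions seen
  from the clusters converge.  Mass outside the lists is spread thinly and does not contribute
  to pattern sums, as patterns have at least two points.  Hence every subsequence of the orbits
  has a further subsequence that converges to some collection (\<open>pattern_sums_compactness\<close>).

  The theorem follows: a strong limit along a subsequence is \<open>M_\<xi>\<close> for a collection \<open>\<xi>\<close> to which a
  further subsequence of the orbits converges, and a strong limit point is a limit along a
  subsequence because a symbol is a function on a countable set.\<close>

section \<open>The Hilbert space and its operators\<close>

lemma ell2_eqI: "(\<And>x. ell2_apply u x = ell2_apply v x) \<Longrightarrow> u = v"
  by (simp add: ell2_apply_inject[symmetric] fun_eq_iff)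

lemma ell2_summable: "(\<lambda>x. (cmod (ell2_apply u x))\<^sup>2) summable_on A"
  using ell2_apply[of u] by (auto intro: summable_on_subset_banach)

lemma norm_ell2_apply_le: "cmod (ell2_apply u x) \<le> norm u"
  by (rule power2_le_imp_le) (use ell2_sum_le_norm_sq[of "{x}" u] in auto)

lemma bounded_linear_ell2_apply: "bounded_linear (\<lambda>u. ell2_apply u x)"
  by (rule bounded_linear_intro[where K = 1])
    (auto simp: plus_ell2.rep_eq scaleR_ell2.rep_eq norm_ell2_apply_le)

lemma ell2_apply_sum: "ell2_apply (sum u F) x = (\<Sum>i\<in>F. ell2_apply (u i) x)"
  using linear_sum[OF bounded_linear.linear[OF bounded_linear_ell2_apply[of x]]] .

lemma cinner_ket: "cinner (ket x) u = ell2_apply u x"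
proof -
  have "cinner (ket x) u = (\<Sum>\<^sub>\<infinity>z\<in>{x}. ell2_apply u z)"
    unfolding cinner.rep_eq ket.rep_eq
    by (rule infsum_cong_neutral) auto
  then show ?thesis by simp
qed

lemma matrix_coeff_eq: "matrix_coeff T x y = ell2_apply (T (ket y)) x"
  by (simp add: matrix_coeff_def cinner_ket)

lemma norm_ket [simp]: "norm (ket x) = 1"
proof -
  have "(norm (ket x))\<^sup>2 = (\<Sum>\<^sub>\<infinity>z\<in>{x}. (1::real))"
    unfolding ell2_norm_sq ket.rep_eq by (rule infsum_cong_neutral) auto
  then show ?thesis by (simp add: power2_eq_1_iff) (metis norm_ge_zero not_one_le_zero neg_0_le_iff_le zero_le_one order_trans)
qed

lemma norm_cscale: "norm (cscale c u) = cmod c * norm u"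
proof -
  have "(norm (cscale c u))\<^sup>2 = (cmod c * norm u)\<^sup>2"
    unfolding ell2_norm_sq power_mult_distrib cscale.rep_eq norm_mult
    by (rule infsum_cmult_right) (use ell2_summable in auto)
  then show ?thesis by (simp add: power2_eq_iff_nonneg)
qed

lemma bounded_linear_cscale: "bounded_linear (cscale c)"
  by (rule bounded_linear_intro[where K = "cmod c"])
    (auto simp: cscale_add cscale_scaleR norm_cscale mult.commute)

lemma norm_matrix_coeff_le: "cmod (matrix_coeff T x y) \<le> norm T"
  unfolding matrix_coeff_eq
  using order_trans[OF norm_ell2_apply_le norm_blinfun[of T "ket y"]] by simp

lemma bounded_linear_matrix_coeff: "bounded_linear (\<lambda>T. matrix_coeff T x y)"
  by (rule bounded_linear_intro[where K = 1])
    (auto simp: matrix_coeff_add matrix_coeff_scaleR norm_matrix_coeff_le)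

lemma ell2_has_sum_kets: "((\<lambda>x. cscale (ell2_apply u x) (ket x)) has_sum u) UNIV"
proof -
  let ?p = "\<lambda>F. \<Sum>x\<in>F. cscale (ell2_apply u x) (ket x)"
  have p: "ell2_apply (?p F) x = (if x \<in> F then ell2_apply u x else 0)" if "finite F" for F x
    using that by (simp add: ell2_apply_sum cscale.rep_eq ket.rep_eq if_distrib cong: if_cong)
  have n: "(norm (?p F - u))\<^sup>2 = (norm u)\<^sup>2 - (\<Sum>x\<in>F. (cmod (ell2_apply u x))\<^sup>2)" if "finite F" for F
  proof -
    have "(norm (?p F - u))\<^sup>2 = (\<Sum>\<^sub>\<infinity>x\<in>UNIV - F. (cmod (ell2_apply u x))\<^sup>2)"
      unfolding ell2_norm_sq ell2_apply_diff p[OF that]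
      by (rule infsum_cong_neutral) auto
    also have "\<dots> = (norm u)\<^sup>2 - infsum (\<lambda>x. (cmod (ell2_apply u x))\<^sup>2) F"
      unfolding ell2_norm_sq by (rule infsum_Diff) (use ell2_summable in auto)
    finally show ?thesis using that by simp
  qed
  have "((\<lambda>F. (norm u)\<^sup>2 - (\<Sum>x\<in>F. (cmod (ell2_apply u x))\<^sup>2)) \<longlongrightarrow> (norm u)\<^sup>2 - (norm u)\<^sup>2)
      (finite_subsets_at_top UNIV)"
    using has_sum_infsum[OF ell2_summable[of u UNIV]]
    unfolding ell2_norm_sq[symmetric] has_sum_def by (intro tendsto_intros)
  moreover have "\<forall>\<^sub>F F in finite_subsets_at_top UNIV.
      (norm u)\<^sup>2 - (\<Sum>x\<in>F. (cmod (ell2_apply u x))\<^sup>2) = (norm (?p F - u))\<^sup>2"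
    by (rule eventually_finite_subsets_at_top_weakI) (simp add: n)
  ultimately have "((\<lambda>F. (norm (?p F - u))\<^sup>2) \<longlongrightarrow> (norm u)\<^sup>2 - (norm u)\<^sup>2) (finite_subsets_at_top UNIV)"
    by (rule Lim_transform_eventually)
  then have "((\<lambda>F. sqrt ((norm (?p F - u))\<^sup>2)) \<longlongrightarrow> sqrt ((norm u)\<^sup>2 - (norm u)\<^sup>2)) (finite_subsets_at_top UNIV)"
    by (rule tendsto_real_sqrt)
  then have "((\<lambda>F. norm (?p F - u)) \<longlongrightarrow> 0) (finite_subsets_at_top UNIV)"
    by simp
  then show ?thesis
    unfolding has_sum_def by (rule LIM_zero_cancel[OF tendsto_norm_zero_cancel])
qed

lemma bounded_ops_has_sum:
  assumes "T \<in> bounded_ops"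
  shows "((\<lambda>y. cscale (ell2_apply u y) (blinfun_apply T (ket y))) has_sum blinfun_apply T u) UNIV"
proof -
  have "((\<lambda>y. blinfun_apply T (cscale (ell2_apply u y) (ket y))) has_sum blinfun_apply T u) UNIV"
    by (rule has_sum_bounded_linear[OF blinfun.bounded_linear_right ell2_has_sum_kets, unfolded o_def])
  then show ?thesis using assms by (simp add: bounded_ops_def)
qed

text \<open>The finite linear combinations of basis vectors are dense.\<close>

lemma bounded_ops_eqI:
  assumes "S \<in> bounded_ops" "T \<in> bounded_ops"
    and "\<And>x y. matrix_coeff S x y = matrix_coeff T x y"
  shows "S = T"
proof (rule blinfun_eqI)
  fix u
  have "blinfun_apply S (ket y) = blinfun_apply T (ket y)" for y
    by (rule ell2_eqI) (use assms(3) in \<open>simp add: matrix_coeff_eq\<close>)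
  then show "blinfun_apply S u = blinfun_apply T u"
    using bounded_ops_has_sum[OF assms(1), of u] bounded_ops_has_sum[OF assms(2), of u]
    by (auto intro: has_sum_unique)
qed

lemma closed_bounded_ops: "closed bounded_ops"
proof -
  have eq: "bounded_ops = (\<Inter>c u. {T :: 'a ell2 \<Rightarrow>\<^sub>L 'a ell2. T (cscale c u) = cscale c (T u)})"
    by (auto simp: bounded_ops_def)
  have "closed {T :: 'a ell2 \<Rightarrow>\<^sub>L 'a ell2. T (cscale c u) = cscale c (T u)}" for c u
    by (intro closed_Collect_eq continuous_intros bounded_linear.continuous_on[OF bounded_linear_cscale])
  then show ?thesis unfolding eq by (intro closed_INT ballI)
qed

text \<open>Multiplication by a bounded function.  Unbounded functions act as \<open>0\<close>, so that the operation is
  total.\<close>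

lift_definition diag_fun :: "('a \<Rightarrow> complex) \<Rightarrow> 'a ell2 \<Rightarrow> 'a ell2" is
  "\<lambda>a u x. if bounded (range a) then a x * u x else 0"
proof -
  fix a u :: "'a \<Rightarrow> complex"
  assume u: "(\<lambda>x. (cmod (u x))\<^sup>2) summable_on UNIV"
  show "(\<lambda>x. (cmod (if bounded (range a) then a x * u x else 0))\<^sup>2) summable_on UNIV"
  proof (cases "bounded (range a)")
    case True
    then obtain B where B: "\<And>x. cmod (a x) \<le> B" by (auto simp: bounded_iff)
    have "(\<lambda>x. (cmod (a x * u x))\<^sup>2) summable_on UNIV"
      by (rule summable_on_comparison_test[where f = "\<lambda>x. B\<^sup>2 * (cmod (u x))\<^sup>2"])
        (auto simp: norm_mult power_mult_distrib intro!: mult_right_mono power_mono B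
          summable_on_cmult_right u)
    then show ?thesis using True by simp
  qed simp
qed

lemma norm_diag_fun_le:
  assumes "\<And>x. cmod (a x) \<le> B"
  shows "norm (diag_fun a u) \<le> B * norm u"
proof -
  have b: "bounded (range a)" using assms by (auto simp: bounded_iff)
  have "(norm (diag_fun a u))\<^sup>2 \<le> (B * norm u)\<^sup>2"
    unfolding ell2_norm_sq power_mult_distrib infsum_cmult_right'[symmetric]
  proof (rule infsum_mono)
    show "(\<lambda>x. (cmod (ell2_apply (diag_fun a u) x))\<^sup>2) summable_on UNIV"
      by (rule ell2_summable)
    show "(\<lambda>x. B\<^sup>2 * (cmod (ell2_apply u x))\<^sup>2) summable_on UNIV"
      by (intro summable_on_cmult_right ell2_summable)
    show "(cmod (ell2_apply (diag_fun a u) x))\<^sup>2 \<le> B\<^sup>2 * (cmod (ell2_apply u x))\<^sup>2" for x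
      using b by (auto simp: diag_fun.rep_eq norm_mult power_mult_distrib
          intro!: mult_right_mono power_mono assms)
  qed
  moreover have "0 \<le> B" using assms norm_ge_zero order_trans by blast
  ultimately show ?thesis by (simp add: abs_le_square_iff[symmetric] abs_mult)
qed

lift_definition diag_op :: "('a \<Rightarrow> complex) \<Rightarrow> 'a ell2 \<Rightarrow>\<^sub>L 'a ell2" is diag_fun
proof -
  fix a :: "'a \<Rightarrow> complex"
  show "bounded_linear (diag_fun a)"
  proof (cases "bounded (range a)")
    case True
    then obtain B where B: "\<And>x. cmod (a x) \<le> B" by (auto simp: bounded_iff)
    show ?thesis
    proof (rule bounded_linear_intro[where K = B])
      show "diag_fun a (u + v) = diag_fun a u + diag_fun a v" for u v
        by transfer (auto simp: algebra_simps)
      show "diag_fun a (r *\<^sub>R u) = r *\<^sub>R diag_fun a u" for r u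
        by transfer (auto simp: algebra_simps)
      show "norm (diag_fun a u) \<le> norm u * B" for u
        using norm_diag_fun_le[of a, OF B] by (simp add: mult.commute)
    qed
  next
    case False
    then have "diag_fun a u = 0" for u by transfer simp
    then have "diag_fun a = (\<lambda>_. 0)" by auto
    then show ?thesis by simp
  qed
qed

lemma ell2_apply_diag_op:
  "bounded (range a) \<Longrightarrow> ell2_apply (blinfun_apply (diag_op a) u) x = a x * ell2_apply u x"
  by (simp add: diag_op.rep_eq diag_fun.rep_eq)

lemma norm_diag_op_le:
  assumes "\<And>x. cmod (a x) \<le> B"
  shows "norm (diag_op a) \<le> B"
  using assms norm_ge_zero[of "a undefined"] norm_diag_fun_le[of a, OF assms]
  by (intro norm_blinfun_bound) (auto simp: diag_op.rep_eq intro: order_trans[OF norm_ge_zero assms])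

lemma diag_op_bounded_ops: "diag_op a \<in> bounded_ops"
  unfolding bounded_ops_def mem_Collect_eq diag_op.rep_eq by (intro allI, transfer) (auto simp: algebra_simps)

lemma ell2_apply_left_regular: "ell2_apply (blinfun_apply (left_regular s) u) x = ell2_apply u (- s + x)"
  by (simp add: left_regular.rep_eq translate_ell2.rep_eq)

lemma left_regular_bounded_ops: "left_regular s \<in> bounded_ops"
  unfolding bounded_ops_def mem_Collect_eq left_regular.rep_eq by (intro allI, transfer) auto

lemma left_regular_ket: "blinfun_apply (left_regular s) (ket y) = ket (s + y)"
proof (rule ell2_eqI)
  fix x
  have "- s + x = y \<longleftrightarrow> x = s + y" by (metis add.assoc add_0 left_minus right_minus)
  then show "ell2_apply (blinfun_apply (left_regular s) (ket y)) x = ell2_apply (ket (s + y)) x"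
    by (simp add: ell2_apply_left_regular ket.rep_eq)
qed

lemma matrix_coeff_left_regular: "matrix_coeff (left_regular s) x y = (if x - y = s then 1 else 0)"
  by (auto simp: matrix_coeff_eq left_regular_ket ket.rep_eq)

lemma norm_left_regular [simp]: "norm (left_regular s :: 'a::group_add ell2 \<Rightarrow>\<^sub>L 'a ell2) \<le> 1"
proof (rule norm_blinfun_bound)
  fix u :: "'a ell2"
  have "(norm (blinfun_apply (left_regular s) u))\<^sup>2 = (norm u)\<^sup>2"
    unfolding ell2_norm_sq ell2_apply_left_regular
    by (rule infsum_reindex_bij_betw[where g = "\<lambda>x. - s + x" and B = UNIV])
      (auto intro!: bij_betwI[where g = "\<lambda>x. s + x"] simp: add.assoc[symmetric])
  then show "norm (blinfun_apply (left_regular s) u) \<le> 1 * norm u"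
    by (simp add: power2_eq_iff_nonneg)
qed simp

section \<open>Schur multiplication by autocorrelations\<close>

text \<open>Tonelli's theorem, in the form in which the inner sums are known and joint summability follows.\<close>

lemma has_sum_swap_nonneg:
  fixes F :: "'i \<Rightarrow> 'j \<Rightarrow> real"
  assumes "\<And>r x. F r x \<ge> 0"
    and "\<And>x. x \<in> B \<Longrightarrow> ((\<lambda>r. F r x) has_sum g x) A"
    and "(g has_sum S) B"
  shows "((\<lambda>r. \<Sum>\<^sub>\<infinity>x\<in>B. F r x) has_sum S) A"
    and "r \<in> A \<Longrightarrow> F r summable_on B"
proof -
  have "(\<lambda>(x, r). F r x) summable_on (B \<times> A)"
    by (rule summable_on_SigmaI[where g = g]) (use assms in \<open>auto simp: summable_on_def\<close>)
  then have "((\<lambda>(x, r). F r x) has_sum S) (B \<times> A)"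
    by (intro has_sum_SigmaI[where g = g]) (use assms in auto)
  then have *: "((\<lambda>(r, x). F r x) has_sum S) (A \<times> B)"
    by (subst has_sum_swap) (simp add: case_prod_unfold)
  have s: "F r summable_on B" if "r \<in> A" for r
    by (rule summable_on_SigmaD1[where f = F, OF _ that]) (use * in \<open>auto simp: summable_on_def\<close>)
  then show "r \<in> A \<Longrightarrow> F r summable_on B" .
  show "((\<lambda>r. \<Sum>\<^sub>\<infinity>x\<in>B. F r x) has_sum S) A"
    by (rule has_sum_Sigma'[OF *]) (use s in auto)
qed

text \<open>Cauchy's criterion for series that need not converge absolutely.  The square on the left
  fits sums of vectors whose squared norms are summable.\<close>

lemma summable_on_if_norm_sum_sq_le:
  fixes Z :: "'i \<Rightarrow> 'b::banach" and h :: "'i \<Rightarrow> real"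
  assumes h: "h summable_on A" "\<And>i. i \<in> A \<Longrightarrow> h i \<ge> 0" and "C \<ge> 0"
    and le: "\<And>R. finite R \<Longrightarrow> R \<subseteq> A \<Longrightarrow> (norm (sum Z R))\<^sup>2 \<le> C * sum h R"
  shows "Z summable_on A"
proof -
  have "\<exists>P. eventually P (finite_subsets_at_top A) \<and>
              (\<forall>F F'. P F \<and> P F' \<longrightarrow> dist (sum Z F) (sum Z F') < e)" if "e > 0" for e
  proof -
    \<comment> \<open>Tails of \<open>h\<close> below \<open>\<delta>\<close> keep tail sums of \<open>Z\<close> below \<open>e / 4\<close>; the summand \<open>1\<close> covers \<open>C = 0\<close>.\<close>
    define \<delta> where "\<delta> = (e / 4)\<^sup>2 / (C + 1)"
    have "\<delta> > 0" using \<open>e > 0\<close> \<open>C \<ge> 0\<close> by (simp add: \<delta>_def)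
    obtain F0 where F0: "finite F0" "F0 \<subseteq> A" "dist (sum h F0) (infsum h A) \<le> \<delta>"
      using infsum_finite_approximation[OF h(1) \<open>\<delta> > 0\<close>] by auto
    have small: "norm (sum Z R) \<le> e / 4" if R: "finite R" "R \<subseteq> A - F0" for R
    proof -
      have "sum h (R \<union> F0) \<le> infsum h A"
        by (rule finite_sum_le_infsum) (use h F0 R in auto)
      moreover have "sum h (R \<union> F0) = sum h R + sum h F0"
        by (rule sum.union_disjoint) (use F0 R in auto)
      ultimately have "sum h R \<le> \<delta>" using F0(3) by (simp add: dist_real_def)
      then have "C * sum h R \<le> C * \<delta>" using \<open>C \<ge> 0\<close> by (rule mult_left_mono)
      also have "\<dots> \<le> (C + 1) * \<delta>" using \<open>\<delta> > 0\<close> by (simp add: algebra_simps)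
      also have "\<dots> = (e / 4)\<^sup>2" using \<open>C \<ge> 0\<close> by (simp add: \<delta>_def)
      finally have "(norm (sum Z R))\<^sup>2 \<le> (e / 4)\<^sup>2" using le[of R] R by force
      then show ?thesis by (rule power2_le_imp_le) (use \<open>e > 0\<close> in auto)
    qed
    have "dist (sum Z F) (sum Z F') < e"
      if F: "finite F \<and> F0 \<subseteq> F \<and> F \<subseteq> A" and F': "finite F' \<and> F0 \<subseteq> F' \<and> F' \<subseteq> A" for F F'
    proof -
      have "sum Z F - sum Z F' = sum Z (F - F') - sum Z (F' - F)"
        using sum.Int_Diff[of F Z F'] sum.Int_Diff[of F' Z F] F F' by (simp add: Int_commute)
      then have "dist (sum Z F) (sum Z F') \<le> norm (sum Z (F - F')) + norm (sum Z (F' - F))"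
        by (simp add: dist_norm norm_triangle_ineq4)
      also have "\<dots> \<le> e / 4 + e / 4"
        by (intro add_mono small) (use F F' in auto)
      finally show ?thesis using \<open>e > 0\<close> by simp
    qed
    moreover have "eventually (\<lambda>F. finite F \<and> F0 \<subseteq> F \<and> F \<subseteq> A) (finite_subsets_at_top A)"
      using F0 by (auto simp: eventually_finite_subsets_at_top)
    ultimately show ?thesis
      by (intro exI[of _ "\<lambda>F. finite F \<and> F0 \<subseteq> F \<and> F \<subseteq> A"] conjI allI impI) auto
  qed
  then have "cauchy_filter (filtermap (sum Z) (finite_subsets_at_top A))"
    by (simp add: cauchy_filter_metric_filtermap)
  moreover have "complete (UNIV::'b set)"
    by (meson Cauchy_convergent UNIV_I complete_def convergent_def)
  ultimately obtain L' where "(sum Z \<longlongrightarrow> L') (finite_subsets_at_top A)"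
    using complete_uniform[where S=UNIV] by (force simp add: filterlim_def)
  then show ?thesis
    using summable_on_def has_sum_def by blast
qed

lemma infsum_bounded_linear_summable:
  assumes "bounded_linear h" "u summable_on A"
  shows "(\<Sum>\<^sub>\<infinity>i\<in>A. h (u i)) = h (infsum u A)"
  using has_sum_bounded_linear[OF assms(1) has_sum_infsum[OF assms(2)]] by (rule infsumI)

lemma bij_minus_left: "bij (\<lambda>r. r - x)" for x :: "'a::group_add"
  by (rule bij_betwI[where g = "\<lambda>r. r + x"]) auto

lemma bij_add_right: "bij (\<lambda>r. r + x)" for x :: "'a::group_add"
  by (rule bij_betwI[where g = "\<lambda>r. r - x"]) auto

lemma bij_add_left: "bij (\<lambda>r. s + r)" for s :: "'a::group_add"
  by (rule bij_betwI[where g = "\<lambda>r. - s + r"]) (auto simp: add.assoc[symmetric])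

definition trans_diag :: "('a::group_add \<Rightarrow> real) \<Rightarrow> 'a \<Rightarrow> 'a ell2 \<Rightarrow>\<^sub>L 'a ell2" where
  "trans_diag f r = diag_op (\<lambda>x. complex_of_real (f (r - x)))"

lemma sq_summable_bounded:
  assumes "(\<lambda>x. (f x)\<^sup>2) summable_on UNIV"
  shows "\<bar>f x :: real\<bar> \<le> sqrt (\<Sum>\<^sub>\<infinity>x. (f x)\<^sup>2)"
  using finite_sum_le_infsum[OF assms, of "{x}"] by (intro real_le_rsqrt) simp

context
  fixes f :: "'a::group_add \<Rightarrow> real"
  assumes f: "(\<lambda>x. (f x)\<^sup>2) summable_on UNIV"
begin

lemma ell2_apply_trans_diag:
  "ell2_apply (blinfun_apply (trans_diag f r) v) x = of_real (f (r - x)) * ell2_apply v x"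
  unfolding trans_diag_def
  by (rule ell2_apply_diag_op) (use sq_summable_bounded[OF f] in \<open>auto simp: bounded_iff\<close>)

lemma trans_diag_selfadjoint:
  "inner (blinfun_apply (trans_diag f r) u) v = inner u (blinfun_apply (trans_diag f r) v)"
  by (simp add: inner_ell2_def cinner.rep_eq ell2_apply_trans_diag mult_ac)

lemma trans_diag_norm_has_sum:
  "((\<lambda>r. (norm (blinfun_apply (trans_diag f r) v))\<^sup>2) has_sum (\<Sum>\<^sub>\<infinity>x. (f x)\<^sup>2) * (norm v)\<^sup>2) UNIV"
proof -
  have "((\<lambda>r. (f (r - x))\<^sup>2 * (cmod (ell2_apply v x))\<^sup>2) has_sum
      (\<Sum>\<^sub>\<infinity>x. (f x)\<^sup>2) * (cmod (ell2_apply v x))\<^sup>2) UNIV" for x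
    by (intro has_sum_cmult_left, subst has_sum_reindex_bij_betw[OF bij_minus_left]) (use f in auto)
  moreover have "((\<lambda>x. (\<Sum>\<^sub>\<infinity>x. (f x)\<^sup>2) * (cmod (ell2_apply v x))\<^sup>2) has_sum
     (\<Sum>\<^sub>\<infinity>x. (f x)\<^sup>2) * (norm v)\<^sup>2) UNIV"
    unfolding ell2_norm_sq by (intro has_sum_cmult_right has_sum_infsum ell2_summable)
  ultimately have "((\<lambda>r. \<Sum>\<^sub>\<infinity>x. (f (r - x))\<^sup>2 * (cmod (ell2_apply v x))\<^sup>2) has_sum
      (\<Sum>\<^sub>\<infinity>x. (f x)\<^sup>2) * (norm v)\<^sup>2) UNIV"
    by (intro has_sum_swap_nonneg(1)) auto
  then show ?thesis
    by (simp add: ell2_norm_sq ell2_apply_trans_diag norm_mult power_mult_distrib)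
qed

text \<open>The vector \<open>w\<close> on the left is tested against itself.  The diagonal operators are
  self-adjoint, so \<open>(norm w)\<^sup>2\<close> is a sum of the inner products of \<open>D r w\<close> with \<open>T (D r v)\<close>, to which the
  Cauchy-Schwarz inequality applies; by \<open>trans_diag_norm_has_sum\<close> the factor belonging to \<open>w\<close> is
  at most a multiple of \<open>norm w\<close>, which cancels.\<close>

lemma norm_sum_trans_diag_le:
  fixes T :: "'a ell2 \<Rightarrow>\<^sub>L 'a ell2"
  assumes "finite R"
  shows "(norm (\<Sum>r\<in>R. trans_diag f r (T (trans_diag f r v))))\<^sup>2
    \<le> ((norm T)\<^sup>2 * (\<Sum>\<^sub>\<infinity>x. (f x)\<^sup>2)) * (\<Sum>r\<in>R. (norm (trans_diag f r v))\<^sup>2)"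
proof -
  let ?D = "trans_diag f" and ?E = "\<Sum>\<^sub>\<infinity>x. (f x)\<^sup>2"
  define w where "w = (\<Sum>r\<in>R. ?D r (T (?D r v)))"
  have "(norm w)\<^sup>2 = (\<Sum>r\<in>R. inner (?D r w) (T (?D r v)))"
    unfolding trans_diag_selfadjoint inner_sum_right[symmetric] w_def[symmetric] by (rule power2_norm_eq_inner)
  also have "\<dots> \<le> (\<Sum>r\<in>R. norm (?D r w) * (norm T * norm (?D r v)))"
  proof (intro sum_mono order_trans[OF norm_cauchy_schwarz] mult_left_mono)
    show "norm (T (?D r v)) \<le> norm T * norm (?D r v)" for r by (rule norm_blinfun)
  qed simp
  also have "\<dots> = norm T * (\<Sum>r\<in>R. norm (?D r w) * norm (?D r v))"
    unfolding sum_distrib_left by (simp only: mult.left_commute)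
  finally have "((norm w)\<^sup>2)\<^sup>2 \<le> (norm T * (\<Sum>r\<in>R. norm (?D r w) * norm (?D r v)))\<^sup>2"
    by (intro power_mono) auto
  also have "\<dots> = (norm T)\<^sup>2 * (\<Sum>r\<in>R. norm (?D r w) * norm (?D r v))\<^sup>2"
    by (rule power_mult_distrib)
  also have "\<dots> \<le> (norm T)\<^sup>2 * ((\<Sum>r\<in>R. (norm (?D r w))\<^sup>2) * (\<Sum>r\<in>R. (norm (?D r v))\<^sup>2))"
    by (intro mult_left_mono Cauchy_Schwarz_ineq_sum) auto
  also have "\<dots> \<le> (norm T)\<^sup>2 * ((?E * (norm w)\<^sup>2) * (\<Sum>r\<in>R. (norm (?D r v))\<^sup>2))"
  proof (intro mult_left_mono mult_right_mono)
    show "(\<Sum>r\<in>R. (norm (?D r w))\<^sup>2) \<le> ?E * (norm w)\<^sup>2"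
      using finite_sum_le_has_sum[OF trans_diag_norm_has_sum[of w] assms] by simp
  qed (auto intro: sum_nonneg)
  finally have *: "(norm w)\<^sup>2 * (norm w)\<^sup>2 \<le> (norm w)\<^sup>2 * ((norm T)\<^sup>2 * ?E * (\<Sum>r\<in>R. (norm (?D r v))\<^sup>2))"
    unfolding power2_eq_square[of "(norm w)\<^sup>2"] by (simp only: mult_ac)
  have "(norm w)\<^sup>2 \<le> (norm T)\<^sup>2 * ?E * (\<Sum>r\<in>R. (norm (?D r v))\<^sup>2)"
  proof (cases "w = 0")
    case False
    then have "(norm w)\<^sup>2 > 0" by simp
    then show ?thesis using * by (simp only: mult_le_cancel_left_pos)
  next
    case True
    then show ?thesis using infsum_nonneg[of UNIV "\<lambda>x. (f x)\<^sup>2"]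
      by (simp add: sum_nonneg)
  qed
  then show ?thesis by (simp add: w_def)
qed

lemma schur_summable:
  fixes T :: "'a ell2 \<Rightarrow>\<^sub>L 'a ell2"
  shows "(\<lambda>r. trans_diag f r (T (trans_diag f r v))) summable_on UNIV"
proof (rule summable_on_if_norm_sum_sq_le)
  show "(\<lambda>r. (norm (trans_diag f r v))\<^sup>2) summable_on UNIV"
    using trans_diag_norm_has_sum[of v] by (auto simp only: summable_on_def)
  show "0 \<le> (norm T)\<^sup>2 * (\<Sum>\<^sub>\<infinity>x. (f x)\<^sup>2)"
    by (intro mult_nonneg_nonneg infsum_nonneg) auto
  fix R :: "'a set"
  assume "finite R"
  then show "(norm (\<Sum>r\<in>R. trans_diag f r (T (trans_diag f r v))))\<^sup>2
    \<le> ((norm T)\<^sup>2 * (\<Sum>\<^sub>\<infinity>x. (f x)\<^sup>2)) * (\<Sum>r\<in>R. (norm (trans_diag f r v))\<^sup>2)"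
    by (rule norm_sum_trans_diag_le)
qed simp

lemma norm_schur_le:
  fixes T :: "'a ell2 \<Rightarrow>\<^sub>L 'a ell2"
  shows "norm (\<Sum>\<^sub>\<infinity>r. trans_diag f r (T (trans_diag f r v))) \<le> norm T * (\<Sum>\<^sub>\<infinity>x. (f x)\<^sup>2) * norm v"
proof -
  let ?Z = "\<lambda>r. trans_diag f r (T (trans_diag f r v))" and ?E = "\<Sum>\<^sub>\<infinity>x. (f x)\<^sup>2"
  have E: "?E \<ge> 0" by (intro infsum_nonneg) simp
  have le: "norm (sum ?Z R) \<le> norm T * ?E * norm v" if "finite R" for R
  proof (rule power2_le_imp_le)
    have "(norm (sum ?Z R))\<^sup>2 \<le> ((norm T)\<^sup>2 * ?E) * (\<Sum>r\<in>R. (norm (trans_diag f r v))\<^sup>2)"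
      by (rule norm_sum_trans_diag_le[OF that])
    also have "\<dots> \<le> ((norm T)\<^sup>2 * ?E) * (?E * (norm v)\<^sup>2)"
      using finite_sum_le_has_sum[OF trans_diag_norm_has_sum[of v] that] E by (intro mult_left_mono) auto
    finally show "(norm (sum ?Z R))\<^sup>2 \<le> (norm T * ?E * norm v)\<^sup>2"
      by (simp add: power_mult_distrib power2_eq_square[of ?E] mult_ac)
    show "0 \<le> norm T * ?E * norm v" using E by (intro mult_nonneg_nonneg) simp_all
  qed
  have "((\<lambda>R. norm (sum ?Z R)) \<longlongrightarrow> norm (infsum ?Z UNIV)) (finite_subsets_at_top UNIV)"
    using has_sum_infsum[OF schur_summable] unfolding has_sum_def by (rule tendsto_norm)
  then show ?thesis
    by (rule tendsto_upperbound) (intro eventually_finite_subsets_at_top_weakI le, assumption, simp)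
qed

end

text \<open>Schur multiplication of the matrix of \<open>T\<close> by \<open>Phi f (x - y)\<close> (see \<open>matrix_coeff_schur_op\<close>), written as a
  strongly convergent sum, from which the norm can be estimated.\<close>

definition schur_op :: "('a::group_add \<Rightarrow> real) \<Rightarrow> ('a ell2 \<Rightarrow>\<^sub>L 'a ell2) \<Rightarrow> 'a ell2 \<Rightarrow>\<^sub>L 'a ell2" where
  "schur_op f T = Blinfun (\<lambda>v. \<Sum>\<^sub>\<infinity>r. trans_diag f r (T (trans_diag f r v)))"

context
  fixes f :: "'a::group_add \<Rightarrow> real"
  assumes f: "(\<lambda>x. (f x)\<^sup>2) summable_on UNIV"
begin

lemma schur_op_apply:
  "blinfun_apply (schur_op f T) v = (\<Sum>\<^sub>\<infinity>r. trans_diag f r (T (trans_diag f r v)))"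
proof -
  have "bounded_linear (\<lambda>v. \<Sum>\<^sub>\<infinity>r. trans_diag f r (T (trans_diag f r v)))"
  proof (rule bounded_linear_intro[where K = "norm T * (\<Sum>\<^sub>\<infinity>x. (f x)\<^sup>2)"])
    show "(\<Sum>\<^sub>\<infinity>r. trans_diag f r (T (trans_diag f r (u + v)))) =
        (\<Sum>\<^sub>\<infinity>r. trans_diag f r (T (trans_diag f r u))) +
        (\<Sum>\<^sub>\<infinity>r. trans_diag f r (T (trans_diag f r v)))" for u v
      unfolding blinfun.add_right by (intro infsum_add schur_summable[OF f])
    show "(\<Sum>\<^sub>\<infinity>r. trans_diag f r (T (trans_diag f r (c *\<^sub>R v)))) =
        c *\<^sub>R (\<Sum>\<^sub>\<infinity>r. trans_diag f r (T (trans_diag f r v)))" for c v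
      unfolding blinfun.scaleR_right by (rule infsum_scaleR_right)
    show "norm (\<Sum>\<^sub>\<infinity>r. trans_diag f r (T (trans_diag f r v))) \<le>
        norm v * (norm T * (\<Sum>\<^sub>\<infinity>x. (f x)\<^sup>2))" for v
      using norm_schur_le[OF f, of T v] by (simp only: mult.commute)
  qed
  then show ?thesis by (simp add: schur_op_def bounded_linear_Blinfun_apply)
qed

lemma schur_op_add: "schur_op f (S + T) = schur_op f S + schur_op f T"
  by (rule blinfun_eqI) (simp add: schur_op_apply blinfun.add_left blinfun.add_right infsum_add
      schur_summable[OF f])

lemma schur_op_scaleR: "schur_op f (c *\<^sub>R T) = c *\<^sub>R schur_op f T"
  by (rule blinfun_eqI) (simp add: schur_op_apply blinfun.scaleR_left blinfun.scaleR_right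
      infsum_scaleR_right)

lemma norm_schur_op_le: "norm (schur_op f T) \<le> norm T * (\<Sum>\<^sub>\<infinity>x. (f x)\<^sup>2)"
  unfolding schur_op_apply
  by (rule norm_blinfun_bound) (intro mult_nonneg_nonneg infsum_nonneg norm_ge_zero zero_le_power2,
      unfold schur_op_apply, rule norm_schur_le[OF f])

lemma bounded_linear_schur_op: "bounded_linear (schur_op f)"
  by (rule bounded_linear_intro[where K = "\<Sum>\<^sub>\<infinity>x. (f x)\<^sup>2"])
    (auto simp: schur_op_add schur_op_scaleR norm_schur_op_le)

lemma schur_op_bounded_ops:
  assumes "T \<in> bounded_ops"
  shows "schur_op f T \<in> bounded_ops"
proof -
  have d: "trans_diag f r (cscale c v) = cscale c (trans_diag f r v)" for r c v
    using diag_op_bounded_ops by (auto simp: bounded_ops_def trans_diag_def)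
  have "trans_diag f r (T (trans_diag f r (cscale c v))) = cscale c (trans_diag f r (T (trans_diag f r v)))" for r c v
    using assms by (simp add: d bounded_ops_def)
  then show ?thesis
    using infsum_bounded_linear_summable[OF bounded_linear_cscale schur_summable[OF f, of T]]
    by (simp add: bounded_ops_def schur_op_apply)
qed

lemma autocorrelation_summable: "(\<lambda>t. f t * f (t + s)) summable_on UNIV"
proof (rule abs_summable_summable, rule summable_on_comparison_test)
  have "(\<lambda>t. (f (t + s))\<^sup>2) summable_on UNIV"
    using summable_on_reindex_bij_betw[OF bij_add_right, of "\<lambda>t. (f t)\<^sup>2" s] f by simp
  then show "(\<lambda>t. (f t)\<^sup>2 + (f (t + s))\<^sup>2) summable_on UNIV"
    by (intro summable_on_add f)
  show "norm (f t * f (t + s)) \<le> (f t)\<^sup>2 + (f (t + s))\<^sup>2" for t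
    using sum_squares_bound[of "\<bar>f t\<bar>" "\<bar>f (t + s)\<bar>"]
      mult_nonneg_nonneg[OF abs_ge_zero[of "f t"] abs_ge_zero[of "f (t + s)"]]
    unfolding real_norm_def abs_mult power2_abs mult.assoc by linarith
qed simp

lemma Phi_of_real: "Phi (\<lambda>x. complex_of_real (f x)) s = of_real (\<Sum>\<^sub>\<infinity>t. f t * f (t + s))"
  unfolding Phi_def complex_cnj_complex_of_real of_real_mult[symmetric]
  by (rule infsum_bounded_linear_summable[OF bounded_linear_of_real autocorrelation_summable])

lemma matrix_coeff_schur_op:
  assumes "T \<in> bounded_ops"
  shows "matrix_coeff (schur_op f T) x y = Phi (\<lambda>x. complex_of_real (f x)) (x - y) * matrix_coeff T x y"
proof -
  have k: "trans_diag f r (ket y) = cscale (of_real (f (r - y))) (ket y)" for r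
    by (rule ell2_eqI, unfold ell2_apply_trans_diag[OF f] cscale.rep_eq ket.rep_eq, simp)
  have "matrix_coeff (schur_op f T) x y
     = (\<Sum>\<^sub>\<infinity>r. ell2_apply (trans_diag f r (T (trans_diag f r (ket y)))) x)"
    unfolding matrix_coeff_eq schur_op_apply
    by (rule infsum_bounded_linear_summable[OF bounded_linear_ell2_apply schur_summable[OF f], symmetric])
  also have "\<dots> = (\<Sum>\<^sub>\<infinity>r. of_real (f (r - x) * f (r - y)) * matrix_coeff T x y)"
  proof (rule infsum_cong)
    fix r
    have "T (trans_diag f r (ket y)) = cscale (of_real (f (r - y))) (T (ket y))"
      using assms by (simp only: k bounded_ops_def mem_Collect_eq)
    then show "ell2_apply (trans_diag f r (T (trans_diag f r (ket y)))) x =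
        of_real (f (r - x) * f (r - y)) * matrix_coeff T x y"
      by (simp add: ell2_apply_trans_diag[OF f] cscale.rep_eq matrix_coeff_eq)
  qed
  also have "\<dots> = (\<Sum>\<^sub>\<infinity>r. of_real (f (r - x) * f (r - y))) * matrix_coeff T x y"
    by (rule infsum_cmult_left')
  also have "(\<Sum>\<^sub>\<infinity>r. complex_of_real (f (r - x) * f (r - y))) = Phi (\<lambda>x. complex_of_real (f x)) (x - y)"
  proof -
    have "r - x + (x - y) = r - y" for r by (simp add: add_diff_eq)
    then show ?thesis
      unfolding Phi_def infsum_reindex_bij_betw[OF bij_minus_left[of x], symmetric,
          of "\<lambda>t. complex_of_real (f t) * cnj (complex_of_real (f (t + (x - y))))"]
      by simp
  qed
  finally show ?thesis .
qed

end

section \<open>The two operator algebras\<close>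

lemma cinner_summable: "(\<lambda>x. cnj (ell2_apply u x) * ell2_apply v x) summable_on UNIV"
  by (rule abs_summable_summable[OF ell2_abs_summable_prod]) (rule ell2_summable)+

lemma cinner_add_left: "cinner (u + u') v = cinner u v + cinner u' v"
  by (simp add: cinner.rep_eq plus_ell2.rep_eq distrib_right infsum_add cinner_summable)

lemma cinner_add_right: "cinner u (v + v') = cinner u v + cinner u v'"
  by (simp add: cinner.rep_eq plus_ell2.rep_eq distrib_left infsum_add cinner_summable)

lemma cinner_cscale_left: "cinner (cscale c u) v = cnj c * cinner u v"
  by (simp add: cinner.rep_eq cscale.rep_eq mult.assoc infsum_cmult_right')

lemma cinner_cscale_right: "cinner u (cscale c v) = c * cinner u v"
  by (simp add: cinner.rep_eq cscale.rep_eq mult.left_commute[of _ c] infsum_cmult_right')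

lemma cinner_uminus_left: "cinner (- u) v = - cinner u v"
  by (simp add: cinner.rep_eq uminus_ell2.rep_eq infsum_uminus)

lemma cinner_uminus_right: "cinner u (- v) = - cinner u v"
  by (simp add: cinner.rep_eq uminus_ell2.rep_eq infsum_uminus)

lemma cinner_zero [simp]: "cinner 0 v = 0" "cinner v 0 = 0"
  by (simp_all add: cinner.rep_eq zero_ell2.rep_eq)

lemma is_adjoint_zero: "is_adjoint 0 0"
  by (simp add: is_adjoint_def blinfun.zero_left)

lemma is_adjoint_add: "is_adjoint S S' \<Longrightarrow> is_adjoint T T' \<Longrightarrow> is_adjoint (S + T) (S' + T')"
  by (simp add: is_adjoint_def blinfun.add_left cinner_add_left cinner_add_right)

lemma is_adjoint_diff: "is_adjoint S S' \<Longrightarrow> is_adjoint T T' \<Longrightarrow> is_adjoint (S - T) (S' - T')"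
  by (simp add: is_adjoint_def diff_conv_add_uminus blinfun.add_left blinfun.minus_left cinner_add_left
      cinner_add_right cinner_uminus_left cinner_uminus_right del: add_uminus_conv_diff)

lemma is_adjoint_sum:
  "(\<And>i. i \<in> F \<Longrightarrow> is_adjoint (S i) (T i)) \<Longrightarrow> is_adjoint (sum S F) (sum T F)"
  by (induction F rule: infinite_finite_induct) (auto intro: is_adjoint_add is_adjoint_zero)

text \<open>Used to carry convergent sequences over to the adjoints.\<close>

lemma norm_adjoint_le:
  assumes "is_adjoint S T"
  shows "norm S \<le> norm T"
proof (rule norm_blinfun_bound)
  fix u
  have "norm (S u) * norm (S u) = inner u (T (S u))"
    using assms unfolding dot_square_norm[symmetric, unfolded power2_eq_square] by (simp add: is_adjoint_def inner_ell2_def)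
  also have "\<dots> \<le> norm u * (norm T * norm (S u))"
    by (rule order_trans[OF norm_cauchy_schwarz]) (intro mult_left_mono norm_blinfun norm_ge_zero)
  finally have "norm (S u) * norm (S u) \<le> (norm T * norm u) * norm (S u)"
    by (simp add: mult_ac)
  then show "norm (S u) \<le> norm T * norm u"
    by (cases "norm (S u) = 0") (auto simp: mult_le_cancel_right)
qed simp

definition group_polynomial :: "'a::group_add set \<Rightarrow> ('a \<Rightarrow> complex) \<Rightarrow> 'a ell2 \<Rightarrow>\<^sub>L 'a ell2" where
  "group_polynomial F c = (\<Sum>s\<in>F. diag_op (\<lambda>_. c s) o\<^sub>L left_regular s)"

text \<open>The image of the complex group ring under the left regular representation.\<close>

definition group_polynomials :: "('a::group_add ell2 \<Rightarrow>\<^sub>L 'a ell2) set" where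
  "group_polynomials = {group_polynomial F c | F c. finite F}"

lemma diag_op_const: "diag_op (\<lambda>_. c) u = cscale c u"
  by (rule ell2_eqI) (simp add: ell2_apply_diag_op cscale.rep_eq)

lemma group_polynomial_apply: "group_polynomial F c u = (\<Sum>s\<in>F. cscale (c s) (left_regular s u))"
  by (simp add: group_polynomial_def blinfun.sum_left diag_op_const)

lemma bounded_ops_compose: "S \<in> bounded_ops \<Longrightarrow> T \<in> bounded_ops \<Longrightarrow> S o\<^sub>L T \<in> bounded_ops"
  by (simp add: bounded_ops_def)

lemma group_polynomial_bounded_ops: "group_polynomial F c \<in> bounded_ops"
  unfolding group_polynomial_def
  by (intro subspace_sum[OF subspace_bounded_ops] bounded_ops_compose diag_op_bounded_ops
      left_regular_bounded_ops)

lemma matrix_coeff_group_polynomial: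
  assumes "finite F"
  shows "matrix_coeff (group_polynomial F c) x y = (if x - y \<in> F then c (x - y) else 0)"
proof -
  have "matrix_coeff (group_polynomial F c) x y = (\<Sum>s\<in>F. if x - y = s then c s else 0)"
    unfolding matrix_coeff_eq group_polynomial_apply ell2_apply_sum cscale.rep_eq
      matrix_coeff_left_regular[unfolded matrix_coeff_eq] by (rule sum.cong) auto
  then show ?thesis using assms by simp
qed

text \<open>Membership in the group ring can be read off from the matrix, which spares manipulations of sums
  of translation operators.\<close>

lemma group_polynomialsI:
  assumes "T \<in> bounded_ops" "finite {s. a s \<noteq> 0}" "\<And>x y. matrix_coeff T x y = a (x - y)"
  shows "T \<in> group_polynomials"
proof -
  have "T = group_polynomial {s. a s \<noteq> 0} a"
    by (rule bounded_ops_eqI)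
      (use assms in \<open>auto simp: group_polynomial_bounded_ops matrix_coeff_group_polynomial\<close>)
  then show ?thesis using assms(2) by (auto simp: group_polynomials_def)
qed

lemma group_polynomialsE:
  assumes "T \<in> group_polynomials"
  obtains a where "T \<in> bounded_ops" "finite {s. a s \<noteq> 0}" "\<And>x y. matrix_coeff T x y = a (x - y)"
proof -
  obtain F c where T: "finite F" "T = group_polynomial F c"
    using assms by (auto simp: group_polynomials_def)
  show ?thesis
    by (rule that[of "\<lambda>s. if s \<in> F then c s else 0"])
      (use T in \<open>auto simp: group_polynomial_bounded_ops matrix_coeff_group_polynomial\<close>)
qed

lemma group_polynomials_add:
  assumes "S \<in> group_polynomials" "T \<in> group_polynomials"
  shows "S + T \<in> group_polynomials"
proof -
  obtain a b where a: "S \<in> bounded_ops" "finite {s. a s \<noteq> 0}" "\<And>x y. matrix_coeff S x y = a (x - y)"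
    and b: "T \<in> bounded_ops" "finite {s. b s \<noteq> 0}" "\<And>x y. matrix_coeff T x y = b (x - y)"
    using assms by (metis group_polynomialsE)
  show ?thesis
  proof (rule group_polynomialsI[where a = "\<lambda>s. a s + b s"])
    show "S + T \<in> bounded_ops" using a b by (intro subspace_add[OF subspace_bounded_ops])
    show "finite {s. a s + b s \<noteq> 0}"
      by (rule finite_subset[of _ "{s. a s \<noteq> 0} \<union> {s. b s \<noteq> 0}"]) (use a b in auto)
  qed (use a b in \<open>simp add: matrix_coeff_add\<close>)
qed

lemma group_polynomials_scale:
  assumes "T \<in> group_polynomials" "T' \<in> bounded_ops" "\<And>u. T' u = cscale c (T u)"
  shows "T' \<in> group_polynomials"
proof -
  obtain a where a: "finite {s. a s \<noteq> 0}" "\<And>x y. matrix_coeff T x y = a (x - y)"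
    using assms by (metis group_polynomialsE)
  show ?thesis
    by (rule group_polynomialsI[where a = "\<lambda>s. c * a s"])
      (use a assms(2,3) in \<open>auto simp: matrix_coeff_eq cscale.rep_eq intro: rev_finite_subset\<close>)
qed

text \<open>The coefficients of the product are given by the convolution.\<close>

lemma group_polynomials_compose:
  assumes "S \<in> group_polynomials" "T \<in> group_polynomials"
  shows "S o\<^sub>L T \<in> group_polynomials"
proof -
  obtain a where a: "S \<in> bounded_ops" "finite {s. a s \<noteq> 0}" "\<And>x y. matrix_coeff S x y = a (x - y)"
    using assms by (metis group_polynomialsE)
  obtain F b where F: "finite F" and T: "T = group_polynomial F b"
    using assms(2) by (auto simp: group_polynomials_def)
  let ?c = "\<lambda>r. \<Sum>t\<in>F. b t * a (r - t)"
  show ?thesis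
  proof (rule group_polynomialsI[where a = ?c])
    show "S o\<^sub>L T \<in> bounded_ops"
      unfolding T by (rule bounded_ops_compose[OF a(1) group_polynomial_bounded_ops])
    show "finite {r. ?c r \<noteq> 0}"
    proof (rule finite_subset)
      show "{r. ?c r \<noteq> 0} \<subseteq> (\<lambda>(s, t). s + t) ` ({s. a s \<noteq> 0} \<times> F)"
      proof
        fix r assume "r \<in> {r. ?c r \<noteq> 0}"
        then obtain t where "t \<in> F" "b t * a (r - t) \<noteq> 0"
          by (auto elim: sum.not_neutral_contains_not_neutral)
        then show "r \<in> (\<lambda>(s, t). s + t) ` ({s. a s \<noteq> 0} \<times> F)"
          by (auto intro!: image_eqI[of _ _ "(r - t, t)"])
      qed
    qed (use F a in auto)
    fix x y
    have "S (T (ket y)) = (\<Sum>t\<in>F. cscale (b t) (S (ket (t + y))))"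
      using a(1) by (simp add: T group_polynomial_apply left_regular_ket blinfun.sum_right bounded_ops_def)
    then have "matrix_coeff (S o\<^sub>L T) x y = (\<Sum>t\<in>F. b t * matrix_coeff S x (t + y))"
      by (simp add: matrix_coeff_eq ell2_apply_sum cscale.rep_eq)
    then show "matrix_coeff (S o\<^sub>L T) x y = ?c (x - y)"
      by (simp only: a(3) diff_add_eq_diff_diff_swap)
  qed
qed

lemma left_regular_adjoint: "cinner (left_regular (- s) u) v = cinner u (left_regular s v)"
  unfolding cinner.rep_eq ell2_apply_left_regular
  using infsum_reindex_bij_betw[OF bij_add_left[of "- s"], of "\<lambda>x. cnj (ell2_apply u (s + x)) * ell2_apply v x"]
  by (simp add: add.assoc[symmetric])

lemma group_polynomials_adjoint:
  assumes "T \<in> group_polynomials"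
  obtains T' where "T' \<in> group_polynomials" "is_adjoint T' T"
proof -
  obtain F c where F: "finite F" and T: "T = group_polynomial F c"
    using assms by (auto simp: group_polynomials_def)
  have inj: "inj_on uminus F" by auto
  have eq: "group_polynomial (uminus ` F) (\<lambda>s. cnj (c (- s)))
     = (\<Sum>s\<in>F. diag_op (\<lambda>_. cnj (c s)) o\<^sub>L left_regular (- s))"
    unfolding group_polynomial_def by (subst sum.reindex[OF inj]) simp
  show ?thesis
  proof (rule that)
    show "group_polynomial (uminus ` F) (\<lambda>s. cnj (c (- s))) \<in> group_polynomials"
      using F by (auto simp: group_polynomials_def)
    show "is_adjoint (group_polynomial (uminus ` F) (\<lambda>s. cnj (c (- s)))) T"
      unfolding eq T unfolding group_polynomial_def
      by (rule is_adjoint_sum)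
        (simp add: is_adjoint_def diag_op_const cinner_cscale_left cinner_cscale_right left_regular_adjoint)
  qed
qed

text \<open>The algebraic operations are continuous, so they pass from the group ring to its closure.  For
  adjoints this uses \<open>norm_adjoint_le\<close>: the adjoints of an approximating sequence approximate the
  adjoint.\<close>

lemma cstar_subalgebra_closure_group_polynomials:
  "cstar_subalgebra (closure group_polynomials :: ('a::group_add ell2 \<Rightarrow>\<^sub>L 'a ell2) set)"
  unfolding cstar_subalgebra_def
proof (intro conjI ballI allI impI)
  have sub: "group_polynomials \<subseteq> (bounded_ops :: ('a ell2 \<Rightarrow>\<^sub>L 'a ell2) set)"
    by (auto simp: group_polynomials_def group_polynomial_bounded_ops)
  show "closure group_polynomials \<subseteq> (bounded_ops :: ('a ell2 \<Rightarrow>\<^sub>L 'a ell2) set)"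
    by (rule closure_minimal[OF sub closed_bounded_ops])
  show "closed (closure group_polynomials :: ('a ell2 \<Rightarrow>\<^sub>L 'a ell2) set)" by simp
  have "(0 :: 'a ell2 \<Rightarrow>\<^sub>L 'a ell2) = group_polynomial {} (\<lambda>_. 0)" by (simp add: group_polynomial_def)
  then have "(0 :: 'a ell2 \<Rightarrow>\<^sub>L 'a ell2) \<in> group_polynomials"
    unfolding group_polynomials_def by blast
  then show "(0 :: 'a ell2 \<Rightarrow>\<^sub>L 'a ell2) \<in> closure group_polynomials"
    by (rule subsetD[OF closure_subset])
  note seq = closure_sequential
  have lim: "X \<in> closure group_polynomials" if "x \<longlonglongrightarrow> X" "\<And>n. x n \<in> group_polynomials"
    for x and X :: "'a ell2 \<Rightarrow>\<^sub>L 'a ell2"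
    unfolding seq using that by blast
  fix T :: "'a ell2 \<Rightarrow>\<^sub>L 'a ell2" assume "T \<in> closure group_polynomials"
  then obtain t where t: "\<And>n. t n \<in> group_polynomials" "t \<longlonglongrightarrow> T" by (auto simp: seq)
  {
    fix T' :: "'a ell2 \<Rightarrow>\<^sub>L 'a ell2" assume "T' \<in> closure group_polynomials"
    then obtain t' where t': "\<And>n. t' n \<in> group_polynomials" "t' \<longlonglongrightarrow> T'" by (auto simp: seq)
    have "(\<lambda>n. t n + t' n) \<longlonglongrightarrow> T + T'" by (intro tendsto_intros t t')
    then show "T + T' \<in> closure group_polynomials"
      by (rule lim) (rule group_polynomials_add[OF t(1) t'(1)])
    have "(\<lambda>n. t n o\<^sub>L t' n) \<longlonglongrightarrow> (T o\<^sub>L T')" by (intro tendsto_intros t t')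
    then show "T o\<^sub>L T' \<in> closure group_polynomials"
      by (rule lim) (rule group_polynomials_compose[OF t(1) t'(1)])
  next
    fix T' :: "'a ell2 \<Rightarrow>\<^sub>L 'a ell2" and c assume T': "T' \<in> bounded_ops" "\<forall>u. blinfun_apply T' u = cscale c (blinfun_apply T u)"
    have "(\<lambda>n. diag_op (\<lambda>_. c) o\<^sub>L t n) \<longlonglongrightarrow> (diag_op (\<lambda>_. c) o\<^sub>L T)" by (intro tendsto_intros t)
    also have "(diag_op (\<lambda>_. c) o\<^sub>L T) = T'"
      by (rule blinfun_eqI) (use T' in \<open>simp add: diag_op_const\<close>)
    finally show "T' \<in> closure group_polynomials"
    proof (rule lim)
      fix n
      show "diag_op (\<lambda>_. c) o\<^sub>L t n \<in> group_polynomials"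
      by (rule group_polynomials_scale[OF t(1)[of n], where c = c])
        (use sub t(1) diag_op_bounded_ops in \<open>auto simp: diag_op_const intro: bounded_ops_compose\<close>)
    qed
  next
    fix T' :: "'a ell2 \<Rightarrow>\<^sub>L 'a ell2" assume T': "T' \<in> bounded_ops" "is_adjoint T' T"
    have "\<exists>t'. \<forall>n. t' n \<in> group_polynomials \<and> is_adjoint (t' n) (t n)"
      by (rule choice) (metis t(1) group_polynomials_adjoint)
    then obtain t' where t': "\<And>n. t' n \<in> group_polynomials" "\<And>n. is_adjoint (t' n) (t n)" by blast
    have "(\<lambda>n. norm (t n - T)) \<longlonglongrightarrow> 0"
      using t(2) by (simp add: LIM_zero_iff tendsto_norm_zero)
    then have "(\<lambda>n. t' n - T') \<longlonglongrightarrow> 0"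
      by (rule Lim_null_comparison[rotated])
        (auto intro!: always_eventually norm_adjoint_le is_adjoint_diff t' T')
    then have "t' \<longlonglongrightarrow> T'" by (simp add: LIM_zero_iff)
    then show "T' \<in> closure group_polynomials"
      by (rule lim) (rule t'(1))
  }
qed

lemma left_regular_group_polynomials: "left_regular s \<in> group_polynomials"
  by (rule group_polynomialsI[where a = "\<lambda>r. if r = s then 1 else 0"])
    (auto simp: left_regular_bounded_ops matrix_coeff_left_regular)

text \<open>One inclusion holds because the closure of the group ring is a C*-algebra containing the
  translations, the other one because every such algebra contains the group ring and is closed.\<close>

lemma reduced_cstar_set_eq: "reduced_cstar_set = closure group_polynomials"
proof
  show "reduced_cstar_set \<subseteq> closure (group_polynomials :: ('a ell2 \<Rightarrow>\<^sub>L 'a ell2) set)"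
    unfolding reduced_cstar_set_def
    using cstar_subalgebra_closure_group_polynomials left_regular_group_polynomials closure_subset by blast
  have "group_polynomial F c \<in> S" if "finite F" "cstar_subalgebra S" "range left_regular \<subseteq> S"
    for F :: "'a set" and c S
    unfolding group_polynomial_def
  proof (rule subspace_sum[OF subspace_cstar_subalgebra[OF that(2)]])
    fix s assume "s \<in> F"
    have "left_regular s \<in> S" using that(3) by auto
    moreover have "diag_op (\<lambda>_. c s) o\<^sub>L left_regular s \<in> bounded_ops"
      by (intro bounded_ops_compose diag_op_bounded_ops left_regular_bounded_ops)
    moreover have "(diag_op (\<lambda>_. c s) o\<^sub>L left_regular s) u = cscale (c s) (left_regular s u)" for u
      by (simp add: diag_op_const)
    ultimately show "diag_op (\<lambda>_. c s) o\<^sub>L left_regular s \<in> S"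
      using that(2) unfolding cstar_subalgebra_def by metis
  qed
  then have "group_polynomials \<subseteq> (reduced_cstar_set :: ('a ell2 \<Rightarrow>\<^sub>L 'a ell2) set)"
    by (auto simp: group_polynomials_def reduced_cstar_set_def)
  then show "closure group_polynomials \<subseteq> (reduced_cstar_set :: ('a ell2 \<Rightarrow>\<^sub>L 'a ell2) set)"
    by (rule closure_minimal) (rule closed_reduced_cstar)
qed

text \<open>What the two operator algebras have in common, as far as it is relevant for multipliers.\<close>

locale multiplier_algebra =
  fixes \<iota> :: "'x::banach \<Rightarrow> ('a::group_add ell2 \<Rightarrow>\<^sub>L 'a ell2)"
  assumes iota_add: "\<iota> (S + T) = \<iota> S + \<iota> T"
    and iota_scaleR: "\<iota> (c *\<^sub>R T) = c *\<^sub>R \<iota> T"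
    and norm_iota: "norm (\<iota> T) = norm T"
    and iota_bounded_ops: "\<iota> T \<in> bounded_ops"
    and schur_op_closed: "(\<lambda>x. (f x)\<^sup>2) summable_on UNIV \<Longrightarrow> schur_op f (\<iota> T) \<in> range \<iota>"
    and finite_propagation_dense: "e > 0 \<Longrightarrow> \<exists>T'. finite_propagation (\<iota> T') \<and> norm (T - T') < e"
    and left_regular_in_range: "left_regular s \<in> range \<iota>"

lemma finite_propagation_schur_op:
  assumes "(\<lambda>x. (f x)\<^sup>2) summable_on UNIV" "T \<in> bounded_ops" "finite_propagation T"
  shows "finite_propagation (schur_op f T)"
  using assms(3) unfolding finite_propagation_def matrix_coeff_schur_op[OF assms(1,2)]
  by (elim exE conjE) (intro exI conjI, assumption, simp)


text \<open>It suffices to check the algebraic conditions on a dense subset, since \<open>schur_op f\<close> is continuous.\<close>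

lemma multiplier_algebraI:
  fixes \<iota> :: "'x::banach \<Rightarrow> ('a::group_add ell2 \<Rightarrow>\<^sub>L 'a ell2)"
  assumes add: "\<And>S T. \<iota> (S + T) = \<iota> S + \<iota> T" and scaleR: "\<And>c T. \<iota> (c *\<^sub>R T) = c *\<^sub>R \<iota> T"
    and norm: "\<And>T. norm (\<iota> T) = norm T" and range: "range \<iota> = closure B"
    and B: "B \<subseteq> bounded_ops" "\<And>T. T \<in> B \<Longrightarrow> finite_propagation T" "\<And>s. left_regular s \<in> B"
    and schur: "\<And>f T. (\<lambda>x. (f x)\<^sup>2) summable_on UNIV \<Longrightarrow> T \<in> B \<Longrightarrow> schur_op f T \<in> B"
  shows "multiplier_algebra \<iota>"
proof
  show "\<iota> (S + T) = \<iota> S + \<iota> T" "\<iota> (c *\<^sub>R T) = c *\<^sub>R \<iota> T" "norm (\<iota> T) = norm T" for S T c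
    by (rule add scaleR norm)+
  have "closure B \<subseteq> bounded_ops" by (rule closure_minimal[OF B(1) closed_bounded_ops])
  then show "\<iota> T \<in> bounded_ops" for T unfolding range[symmetric] by blast
  show "schur_op f (\<iota> T) \<in> range \<iota>" if f: "(\<lambda>x. (f x)\<^sup>2) summable_on UNIV" for f T
  proof -
    have "schur_op f ` closure B \<subseteq> closure B"
    proof (rule image_closure_subset)
      show "continuous_on (closure B) (schur_op f)"
        by (rule linear_continuous_on[OF bounded_linear_schur_op[OF f]])
      show "schur_op f ` B \<subseteq> closure B"
        by (intro image_subsetI subsetD[OF closure_subset] schur[OF f])
    qed simp
    moreover have "\<iota> T \<in> closure B" unfolding range[symmetric] by (rule rangeI)
    ultimately show ?thesis unfolding range by (rule image_subset_iff[THEN iffD1, THEN bspec])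
  qed
  show "\<exists>T'. finite_propagation (\<iota> T') \<and> norm (T - T') < e" if "e > 0" for T e
  proof -
    have "\<iota> T \<in> closure B" unfolding range[symmetric] by (rule rangeI)
    from this[unfolded closure_approachable, rule_format, OF that]
    obtain U where U: "U \<in> B" "dist U (\<iota> T) < e" by (elim bexE)
    have "U \<in> range \<iota>" unfolding range by (rule subsetD[OF closure_subset U(1)])
    then obtain T' where T': "U = \<iota> T'" by (rule rangeE)
    have "\<iota> (T - T') = \<iota> T - \<iota> T'" using add[of "T - T'" T'] by simp
    then have "norm (T - T') < e"
      using U(2) norm[of "T - T'"] by (simp add: T' dist_norm norm_minus_commute)
    then show ?thesis using B(2)[OF U(1)] by (auto simp: T')
  qed
  show "left_regular s \<in> range \<iota>" for s
    unfolding range by (rule subsetD[OF closure_subset B(3)])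
qed

lemma multiplier_algebra_uniform_roe:
  "multiplier_algebra (Rep_uniform_roe :: 'a::group_add uniform_roe \<Rightarrow> _)"
proof (rule multiplier_algebraI)
  let ?B = "{T :: 'a ell2 \<Rightarrow>\<^sub>L 'a ell2. T \<in> bounded_ops \<and> finite_propagation T}"
  show "range Rep_uniform_roe = closure ?B"
    using type_definition.Rep_range[OF type_definition_uniform_roe] by (simp add: uniform_roe_set_def)
  have "finite_propagation (left_regular s)" for s :: 'a
    unfolding finite_propagation_def
    by (rule exI[of _ "{s}"]) (simp add: matrix_coeff_left_regular)
  then show "left_regular s \<in> ?B" for s by (simp add: left_regular_bounded_ops)
qed (auto simp: plus_uniform_roe.rep_eq scaleR_uniform_roe.rep_eq norm_uniform_roe.rep_eq
    schur_op_bounded_ops finite_propagation_schur_op)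

lemma multiplier_algebra_reduced_cstar:
  "multiplier_algebra (Rep_reduced_cstar :: 'a::group_add reduced_cstar \<Rightarrow> _)"
proof (rule multiplier_algebraI)
  let ?B = "group_polynomials :: ('a ell2 \<Rightarrow>\<^sub>L 'a ell2) set"
  show "range Rep_reduced_cstar = closure ?B"
    using type_definition.Rep_range[OF type_definition_reduced_cstar] by (simp add: reduced_cstar_set_eq)
  show "?B \<subseteq> bounded_ops"
    by (auto simp: group_polynomials_def group_polynomial_bounded_ops)
  show "left_regular s \<in> ?B" for s by (rule left_regular_group_polynomials)
  fix T assume T: "T \<in> ?B"
  obtain a where a: "T \<in> bounded_ops" "finite {s. a s \<noteq> 0}" "\<And>x y. matrix_coeff T x y = a (x - y)"
    by (rule group_polynomialsE[OF T], rule that)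
  show "finite_propagation T"
    unfolding finite_propagation_def a(3) by (rule exI[of _ "{s. a s \<noteq> 0}"]) (simp add: a(2))
  show "schur_op f T \<in> ?B" if f: "(\<lambda>x. (f x)\<^sup>2) summable_on UNIV" for f
    by (rule group_polynomialsI[where a = "\<lambda>s. Phi (\<lambda>x. complex_of_real (f x)) s * a s"])
      (use a(2) in \<open>auto simp: schur_op_bounded_ops f a(1,3) matrix_coeff_schur_op intro: rev_finite_subset\<close>)
qed (simp_all add: plus_reduced_cstar.rep_eq scaleR_reduced_cstar.rep_eq norm_reduced_cstar.rep_eq)

section \<open>Strong convergence of multipliers and their symbols\<close>

lemma limitin_strong_operator_topology:
  "limitin strong_operator_topology T M F \<longleftrightarrow> (\<forall>x. ((\<lambda>n. blinfun_apply (T n) x) \<longlongrightarrow> blinfun_apply M x) F)"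
proof
  assume L: "limitin strong_operator_topology T M F"
  show "\<forall>x. ((\<lambda>n. blinfun_apply (T n) x) \<longlongrightarrow> blinfun_apply M x) F"
  proof
    fix x
    have "limitin euclidean ((\<lambda>f. blinfun_apply f x) \<circ> T) (blinfun_apply M x) F"
      by (rule continuous_map_limit[OF strong_operator_topology_continuous_evaluation L])
    then show "((\<lambda>n. blinfun_apply (T n) x) \<longlongrightarrow> blinfun_apply M x) F"
      by (simp add: o_def)
  qed
next
  assume L: "\<forall>x. ((\<lambda>n. blinfun_apply (T n) x) \<longlongrightarrow> blinfun_apply M x) F"
  have "((\<lambda>n. blinfun_apply (T n)) \<longlongrightarrow> blinfun_apply M) F"
    using L by (simp add: limitin_componentwise flip: limitin_canonical_iff euclidean_product_topology)
  then have "\<forall>\<^sub>F n in F. T n \<in> U" if "openin strong_operator_topology U" "M \<in> U" for U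
    using that unfolding strong_operator_topology_def openin_pullback_topology tendsto_def by fastforce
  then show "limitin strong_operator_topology T M F"
    by (simp add: limitin_def strong_operator_topology_topspace)
qed

lemma sot_limit_points_frequently:
  assumes "M \<in> sot_limit_points T" "finite X" "e > 0"
  shows "\<exists>\<^sub>\<infinity>n. \<forall>x\<in>X. norm (blinfun_apply (T n) x - blinfun_apply M x) < e"
proof -
  let ?U = "{S. \<forall>x\<in>X. blinfun_apply S x \<in> ball (blinfun_apply M x) e}"
  have "openin strong_operator_topology ?U"
    by (rule strong_operator_topology_basis) (use assms(2) in auto)
  moreover have "M \<in> ?U" using assms(3) by simp
  ultimately have "\<exists>\<^sub>\<infinity>n. T n \<in> ?U" using assms(1) unfolding sot_limit_points_def by blast
  then show ?thesis by (simp add: dist_norm norm_minus_commute)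
qed

text \<open>Lets results on limit points apply to limits.\<close>

lemma limitin_imp_sot_limit_point:
  assumes "limitin strong_operator_topology T M sequentially"
  shows "M \<in> sot_limit_points T"
  using assms
  by (auto simp: sot_limit_points_def limitin_def cofinite_eq_sequentially
      intro!: eventually_frequently)

lemma sot_limit_unique:
  fixes \<sigma> :: "nat \<Rightarrow> nat"
  assumes "limitin strong_operator_topology T M sequentially" "strict_mono \<sigma>"
    and "limitin strong_operator_topology (\<lambda>n. T (\<sigma> n)) M' sequentially"
  shows "M = M'"
proof (rule blinfun_eqI)
  fix x
  have "((\<lambda>n. T n x) \<circ> \<sigma>) \<longlonglongrightarrow> M x"
    using assms(1,2) by (intro LIMSEQ_subseq_LIMSEQ) (auto simp: limitin_strong_operator_topology)
  moreover have "(\<lambda>n. T (\<sigma> n) x) \<longlonglongrightarrow> M' x" using assms(3) by (simp add: limitin_strong_operator_topology)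
  ultimately show "M x = M' x" by (auto simp: o_def intro: LIMSEQ_unique)
qed

lemma strict_mono_subsequence_frequently:
  assumes "\<And>n. \<exists>\<^sub>\<infinity>m. P n m"
  obtains \<sigma> :: "nat \<Rightarrow> nat" where "strict_mono \<sigma>" "\<And>n. P n (\<sigma> n)"
proof -
  have "\<exists>\<sigma>. \<forall>n. P n (\<sigma> n) \<and> \<sigma> n < \<sigma> (Suc n)"
  proof (rule dependent_nat_choice)
    show "\<exists>m. P 0 m" using assms[of 0] by (auto dest: INFM_EX)
    show "\<exists>m'. P (Suc n) m' \<and> m < m'" for m n
      using assms[of "Suc n"] unfolding INFM_nat by blast
  qed
  then show ?thesis using that by (auto simp: strict_mono_Suc_iff)
qed

context multiplier_algebra
begin

definition has_symbol :: "('x \<Rightarrow>\<^sub>L 'x) \<Rightarrow> ('a \<Rightarrow> complex) \<Rightarrow> bool" where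
  "has_symbol M \<phi> \<longleftrightarrow>
    (\<forall>T x y. matrix_coeff (\<iota> (M T)) x y = \<phi> (x - y) * matrix_coeff (\<iota> T) x y)"

lemma bounded_linear_iota: "bounded_linear \<iota>"
  by (rule bounded_linear_intro[where K = 1]) (auto simp: iota_add iota_scaleR norm_iota)

lemma iota_inject: "\<iota> S = \<iota> T \<longleftrightarrow> S = T"
proof
  assume "\<iota> S = \<iota> T"
  then have "norm (S - T) = 0"
    using norm_iota[of "S - T"] linear_diff[OF bounded_linear.linear[OF bounded_linear_iota]] by simp
  then show "S = T" by simp
qed simp

lemma has_symbol_unique:
  assumes "has_symbol M \<phi>" "has_symbol M' \<phi>"
  shows "M = M'"
proof (rule blinfun_eqI)
  fix T
  have "\<iota> (M T) = \<iota> (M' T)"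
    by (rule bounded_ops_eqI) (use assms in \<open>auto simp: has_symbol_def iota_bounded_ops\<close>)
  then show "M T = M' T" by (simp add: iota_inject)
qed

definition translation :: "'a \<Rightarrow> 'x" where "translation s = (SOME T. \<iota> T = left_regular s)"

lemma iota_translation: "\<iota> (translation s) = left_regular s"
  using left_regular_in_range[of s] unfolding translation_def by (metis (mono_tags) imageE someI_ex)

lemma norm_translation_le: "norm (translation s) \<le> 1"
  using norm_left_regular[of s] by (simp add: iota_translation flip: norm_iota)

lemma bounded_linear_iota_coeff: "bounded_linear (\<lambda>T. matrix_coeff (\<iota> T) x y)"
  using bounded_linear_compose[OF bounded_linear_matrix_coeff bounded_linear_iota] by simp

lemma iota_coeff_diff: "matrix_coeff (\<iota> (S - T)) x y = matrix_coeff (\<iota> S) x y - matrix_coeff (\<iota> T) x y"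
  using linear_diff[OF bounded_linear.linear[OF bounded_linear_iota_coeff]] .

lemma norm_iota_coeff_le: "cmod (matrix_coeff (\<iota> T) x y) \<le> norm T"
  using norm_matrix_coeff_le[of "\<iota> T"] by (simp add: norm_iota)

lemma symbol_eq_coeff_translation:
  assumes "has_symbol M \<phi>"
  shows "matrix_coeff (\<iota> (M (translation s))) s 0 = \<phi> s"
  using assms by (simp add: has_symbol_def iota_translation matrix_coeff_left_regular)

lemma norm_symbol_le:
  assumes "has_symbol M \<phi>"
  shows "cmod (\<phi> s) \<le> norm M"
proof -
  have "cmod (\<phi> s) \<le> norm (M (translation s))"
    using norm_iota_coeff_le[of "M (translation s)" s 0] symbol_eq_coeff_translation[OF assms] by simp
  also have "\<dots> \<le> norm M * 1"
    by (rule order_trans[OF norm_blinfun]) (intro mult_left_mono norm_translation_le norm_ge_zero)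
  finally show ?thesis by simp
qed

lemma has_symbol_diff:
  "has_symbol M \<phi> \<Longrightarrow> has_symbol M' \<psi> \<Longrightarrow> has_symbol (M - M') (\<lambda>s. \<phi> s - \<psi> s)"
  by (simp add: has_symbol_def blinfun.diff_left iota_coeff_diff left_diff_distrib)

lemma has_symbol_has_sum:
  assumes "(S has_sum M) I" "\<And>i. i \<in> I \<Longrightarrow> has_symbol (S i) (\<phi> i)"
    and "\<And>s. ((\<lambda>i. \<phi> i s) has_sum \<psi> s) I"
  shows "has_symbol M \<psi>"
  unfolding has_symbol_def
proof (intro allI)
  fix T x y
  have "((\<lambda>i. matrix_coeff (\<iota> (S i T)) x y) has_sum matrix_coeff (\<iota> (M T)) x y) I"
    by (rule has_sum_bounded_linear[OF bounded_linear_compose[OF bounded_linear_iota_coeff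
            blinfun.bounded_linear_left] assms(1)])
  moreover have "((\<lambda>i. \<phi> i (x - y) * matrix_coeff (\<iota> T) x y) has_sum \<psi> (x - y) * matrix_coeff (\<iota> T) x y) I"
    by (rule has_sum_cmult_left[OF assms(3)])
  then have "((\<lambda>i. matrix_coeff (\<iota> (S i T)) x y) has_sum \<psi> (x - y) * matrix_coeff (\<iota> T) x y) I"
    by (rule has_sum_cong[THEN iffD1, rotated]) (use assms(2) in \<open>simp add: has_symbol_def\<close>)
  ultimately show "matrix_coeff (\<iota> (M T)) x y = \<psi> (x - y) * matrix_coeff (\<iota> T) x y"
    by (rule has_sum_unique)
qed

text \<open>\<open>M T\<close> is the sum over \<open>s \<in> F\<close> of \<open>\<phi> s\<close> times the part of \<open>T\<close> supported where \<open>x - y = s\<close>.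
  This part is a translation followed by a diagonal operator, whose entries are
  matrix coefficients of \<open>T\<close>, hence bounded by \<open>norm T\<close>.\<close>

lemma norm_has_symbol_finite_propagation:
  assumes M: "has_symbol M \<phi>" and F: "finite F"
    and T: "\<And>x y. matrix_coeff (\<iota> T) x y \<noteq> 0 \<Longrightarrow> x - y \<in> F"
  shows "norm (M T) \<le> (\<Sum>s\<in>F. cmod (\<phi> s)) * norm T"
proof -
  let ?c = "\<lambda>s x. matrix_coeff (\<iota> T) x (- s + x)"
  let ?D = "\<lambda>s. diag_op (\<lambda>x. \<phi> s * ?c s x)"
  have le: "cmod (\<phi> s * ?c s x) \<le> cmod (\<phi> s) * norm T" for s x
    unfolding norm_mult by (intro mult_left_mono norm_iota_coeff_le norm_ge_zero)
  have bdd: "bounded (range (\<lambda>x. \<phi> s * ?c s x))" for s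
    using le[of s] by (auto simp: bounded_iff)
  have "\<iota> (M T) = (\<Sum>s\<in>F. ?D s o\<^sub>L left_regular s)"
  proof (rule bounded_ops_eqI)
    show "(\<Sum>s\<in>F. ?D s o\<^sub>L left_regular s) \<in> bounded_ops"
      by (intro subspace_sum[OF subspace_bounded_ops] bounded_ops_compose diag_op_bounded_ops
          left_regular_bounded_ops)
    fix x y
    have "matrix_coeff (\<Sum>s\<in>F. ?D s o\<^sub>L left_regular s) x y
        = (\<Sum>s\<in>F. \<phi> s * ?c s x * matrix_coeff (left_regular s) x y)"
      by (simp add: matrix_coeff_eq blinfun.sum_left ell2_apply_sum ell2_apply_diag_op[OF bdd[unfolded matrix_coeff_eq]])
    also have "\<dots> = (\<Sum>s\<in>F. if x - y = s then \<phi> s * ?c s x else 0)"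
      by (rule sum.cong) (auto simp: matrix_coeff_left_regular)
    also have "\<dots> = (if x - y \<in> F then \<phi> (x - y) * ?c (x - y) x else 0)"
      using F by simp
    also have "\<dots> = \<phi> (x - y) * matrix_coeff (\<iota> T) x y"
      using T[of x y] by (auto simp: minus_diff_eq)
    finally show "matrix_coeff (\<iota> (M T)) x y = matrix_coeff (\<Sum>s\<in>F. ?D s o\<^sub>L left_regular s) x y"
      using M by (simp add: has_symbol_def)
  qed (rule iota_bounded_ops)
  then have "norm (M T) = norm (\<Sum>s\<in>F. ?D s o\<^sub>L left_regular s)" by (metis norm_iota)
  also have "\<dots> \<le> (\<Sum>s\<in>F. cmod (\<phi> s) * norm T)"
  proof (rule sum_norm_le)
    fix s
    have "norm (?D s o\<^sub>L left_regular s) \<le> norm (?D s) * norm (left_regular s :: 'a ell2 \<Rightarrow>\<^sub>L 'a ell2)"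
      by (rule norm_blinfun_compose)
    also have "\<dots> \<le> (cmod (\<phi> s) * norm T) * 1"
      by (intro mult_mono norm_diag_op_le le norm_left_regular) auto
    finally show "norm (?D s o\<^sub>L left_regular s) \<le> cmod (\<phi> s) * norm T" by simp
  qed
  finally show ?thesis by (simp add: sum_distrib_right)
qed

text \<open>On operators of finite propagation this is \<open>norm_has_symbol_finite_propagation\<close>, applied to the
  differences; density and the bound on the norms give the rest.\<close>

lemma strong_convergence_if_symbols_converge:
  assumes Mn: "\<And>n. has_symbol (M n) (\<phi> n)" and M: "has_symbol M' \<psi>"
    and bdd: "\<And>n. norm (M n) \<le> B" and conv: "\<And>s. (\<lambda>n. \<phi> n s) \<longlonglongrightarrow> \<psi> s"
  shows "limitin strong_operator_topology M M' sequentially"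
  unfolding limitin_strong_operator_topology
proof (intro allI LIMSEQ_I)
  fix T and e :: real assume "e > 0"
  \<comment> \<open>A positive bound for the norms of \<open>M n - M'\<close>.\<close>
  define C where "C = B + norm M' + 1"
  have "B \<ge> 0" using order_trans[OF norm_ge_zero bdd] .
  then have "C > 0" unfolding C_def using norm_ge_zero[of M'] by linarith
  obtain T' where T': "finite_propagation (\<iota> T')" "norm (T - T') < e / (2 * C)"
    using finite_propagation_dense[of "e / (2 * C)" T] \<open>e > 0\<close> \<open>C > 0\<close> by auto
  then obtain F where F: "finite F" "\<And>x y. matrix_coeff (\<iota> T') x y \<noteq> 0 \<Longrightarrow> x - y \<in> F"
    unfolding finite_propagation_def by blast
  have "(\<lambda>n. (\<Sum>s\<in>F. cmod (\<phi> n s - \<psi> s)) * norm T') \<longlonglongrightarrow> (\<Sum>s\<in>F. cmod (\<psi> s - \<psi> s)) * norm T'"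
    by (intro tendsto_intros conv)
  then have "(\<lambda>n. (\<Sum>s\<in>F. cmod (\<phi> n s - \<psi> s)) * norm T') \<longlonglongrightarrow> 0" by simp
  then obtain N where N: "\<And>n. n \<ge> N \<Longrightarrow> norm ((\<Sum>s\<in>F. cmod (\<phi> n s - \<psi> s)) * norm T') < e / 2"
    using \<open>e > 0\<close> LIMSEQ_D[of _ 0 "e / 2"] by force
  have "norm (M n T - M' T) < e" if "n \<ge> N" for n
  proof -
    have "norm (M n T - M' T) = norm ((M n - M') (T - T') + (M n - M') T')"
      by (simp add: blinfun.diff_left blinfun.diff_right)
    also have "\<dots> \<le> norm ((M n - M') (T - T')) + norm ((M n - M') T')"
      by (rule norm_triangle_ineq)
    also have "\<dots> \<le> C * norm (T - T') + (\<Sum>s\<in>F. cmod (\<phi> n s - \<psi> s)) * norm T'"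
    proof (intro add_mono)
      have "norm (M n - M') \<le> C"
        unfolding C_def using norm_triangle_ineq4[of "M n" M'] bdd[of n] by linarith
      then show "norm ((M n - M') (T - T')) \<le> C * norm (T - T')"
        by (intro order_trans[OF norm_blinfun] mult_right_mono) auto
      show "norm ((M n - M') T') \<le> (\<Sum>s\<in>F. cmod (\<phi> n s - \<psi> s)) * norm T'"
        by (rule norm_has_symbol_finite_propagation[OF has_symbol_diff[OF Mn M] F])
    qed
    also have "\<dots> < e / 2 + e / 2"
    proof (intro add_strict_mono)
      show "C * norm (T - T') < e / 2" using T'(2) \<open>C > 0\<close> by (simp add: field_simps)
      show "(\<Sum>s\<in>F. cmod (\<phi> n s - \<psi> s)) * norm T' < e / 2" using N[OF that] by simp
    qed
    finally show ?thesis by simp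
  qed
  then show "\<exists>N. \<forall>n\<ge>N. norm (M n T - M' T) < e" by blast
qed

text \<open>The value of the symbol at \<open>s\<close> is read off from the image of the translation by \<open>s\<close>.  For a
  given operator \<open>T\<close> and a given matrix entry there is one index \<open>n\<close> at which \<open>M n\<close> is close to \<open>M'\<close> both at \<open>T\<close> and
  at the translation by \<open>x - y\<close>, and this carries the multiplier identity over from \<open>M n\<close> to \<open>M'\<close>.\<close>

lemma sot_limit_point_has_symbol:
  assumes Mn: "\<And>n. has_symbol (M n) (\<phi> n)" and M': "M' \<in> sot_limit_points M"
  obtains \<psi> where "has_symbol M' \<psi>"
    "\<And>F e. finite F \<Longrightarrow> e > 0 \<Longrightarrow> \<exists>\<^sub>\<infinity>n. \<forall>s\<in>F. cmod (\<phi> n s - \<psi> s) < e"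
proof -
  define \<psi> where "\<psi> s = matrix_coeff (\<iota> (M' (translation s))) s 0" for s
  have close: "cmod (\<phi> n s - \<psi> s) \<le> norm (M n (translation s) - M' (translation s))" for n s
    using norm_iota_coeff_le[of "M n (translation s) - M' (translation s)" s 0]
    by (simp add: iota_coeff_diff symbol_eq_coeff_translation[OF Mn] \<psi>_def)
  have freq: "\<exists>\<^sub>\<infinity>n. \<forall>s\<in>F. cmod (\<phi> n s - \<psi> s) < e" if "finite F" "e > 0" for F e
  proof (rule INFM_mono)
    show "\<exists>\<^sub>\<infinity>n. \<forall>x\<in>translation ` F. norm (M n x - M' x) < e"
      by (rule sot_limit_points_frequently[OF M']) (use that in auto)
  qed (auto intro: le_less_trans[OF close])
  have "has_symbol M' \<psi>"
    unfolding has_symbol_def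
  proof (intro allI)
    fix T x y
    let ?A = "matrix_coeff (\<iota> (M' T)) x y" and ?c = "matrix_coeff (\<iota> T) x y"
    have "cmod (?A - \<psi> (x - y) * ?c) \<le> 0 + e" if "e > 0" for e
    proof -
      \<comment> \<open>The two errors made below, \<open>\<delta>\<close> and \<open>\<delta> * cmod ?c\<close>, add up to \<open>e\<close>.\<close>
      define \<delta> where "\<delta> = e / (1 + cmod ?c)"
      have "1 + cmod ?c > 0" by (simp add: add_pos_nonneg)
      then have "\<delta> > 0" using \<open>e > 0\<close> by (simp add: \<delta>_def)
      then obtain n where n: "\<forall>z\<in>{T, translation (x - y)}. norm (M n z - M' z) < \<delta>"
        using INFM_EX[OF sot_limit_points_frequently[OF M', of "{T, translation (x - y)}" \<delta>]] by blast
      have "?A - \<psi> (x - y) * ?c = (?A - \<phi> n (x - y) * ?c) + (\<phi> n (x - y) - \<psi> (x - y)) * ?c"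
        by (simp add: algebra_simps)
      then have "cmod (?A - \<psi> (x - y) * ?c) \<le> cmod (?A - \<phi> n (x - y) * ?c) + cmod (\<phi> n (x - y) - \<psi> (x - y)) * cmod ?c"
        by (metis norm_mult norm_triangle_ineq)
      also have "\<dots> \<le> \<delta> + \<delta> * cmod ?c"
      proof (intro add_mono mult_right_mono)
        have "\<phi> n (x - y) * ?c = matrix_coeff (\<iota> (M n T)) x y"
          using Mn[of n] by (simp add: has_symbol_def)
        then have "cmod (?A - \<phi> n (x - y) * ?c) \<le> norm (M' T - M n T)"
          using norm_iota_coeff_le[of "M' T - M n T" x y] by (simp add: iota_coeff_diff)
        then show "cmod (?A - \<phi> n (x - y) * ?c) \<le> \<delta>"
          using n by (simp add: norm_minus_commute)
        show "cmod (\<phi> n (x - y) - \<psi> (x - y)) \<le> \<delta>"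
          using close[of n "x - y"] n by simp
      qed simp
      also have "\<dots> = \<delta> * (1 + cmod ?c)" by (simp add: algebra_simps)
      also have "\<dots> = e" using \<open>1 + cmod ?c > 0\<close> by (simp add: \<delta>_def)
      finally show ?thesis by simp
    qed
    then have "cmod (?A - \<psi> (x - y) * ?c) \<le> 0" by (rule field_le_epsilon)
    then show "?A = \<psi> (x - y) * ?c" by simp
  qed
  then show ?thesis using that freq by blast
qed

lemma strong_limit_has_symbol:
  assumes Mn: "\<And>n. has_symbol (M n) (\<phi> n)"
    and lim: "limitin strong_operator_topology M M' sequentially"
    and conv: "\<And>s. (\<lambda>n. \<phi> n s) \<longlonglongrightarrow> \<psi> s"
  shows "has_symbol M' \<psi>"
proof -
  obtain \<psi>' where "has_symbol M' \<psi>'"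
    using sot_limit_point_has_symbol[OF Mn limitin_imp_sot_limit_point[OF lim]] by blast
  moreover have "\<psi>' s = \<psi> s" for s
  proof (rule LIMSEQ_unique[OF _ conv])
    have "(\<lambda>n. matrix_coeff (\<iota> (M n (translation s))) s 0) \<longlonglongrightarrow> matrix_coeff (\<iota> (M' (translation s))) s 0"
      using lim unfolding limitin_strong_operator_topology
      by (intro bounded_linear.tendsto[OF bounded_linear_iota_coeff]) auto
    then show "(\<lambda>n. \<phi> n s) \<longlonglongrightarrow> \<psi>' s"
      by (simp add: symbol_eq_coeff_translation[OF Mn] symbol_eq_coeff_translation[OF \<open>has_symbol M' \<psi>'\<close>])
  qed
  then have "\<psi>' = \<psi>" by auto
  ultimately show ?thesis by simp
qed

text \<open>The symbol \<open>Phi f\<close> is positive definite, so the norm of the multiplier is the value of the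
  symbol at \<open>0\<close>: no operator in this algebra is stretched more than the identity.\<close>

lemma
  fixes f :: "'a \<Rightarrow> real"
  assumes f: "(\<lambda>x. (f x)\<^sup>2) summable_on UNIV"
  shows has_symbol_M_Phi: "has_symbol (M_Phi \<iota> f) (Phi (\<lambda>x. complex_of_real (f x)))"
    and norm_M_Phi: "norm (M_Phi \<iota> f) = (\<Sum>\<^sub>\<infinity>x. (f x)\<^sup>2)"
proof -
  define m where "m T = inv_into UNIV \<iota> (schur_op f (\<iota> T))" for T
  have m: "\<iota> (m T) = schur_op f (\<iota> T)" for T
    unfolding m_def by (rule f_inv_into_f[OF schur_op_closed[OF f]])
  have bl: "bounded_linear m"
  proof (rule bounded_linear_intro[where K = "\<Sum>\<^sub>\<infinity>x. (f x)\<^sup>2"])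
    show "m (S + T) = m S + m T" for S T
      unfolding iota_inject[symmetric] by (simp add: m iota_add schur_op_add[OF f])
    show "m (c *\<^sub>R T) = c *\<^sub>R m T" for c T
      unfolding iota_inject[symmetric] by (simp add: m iota_scaleR schur_op_scaleR[OF f])
    show "norm (m T) \<le> norm T * (\<Sum>\<^sub>\<infinity>x. (f x)\<^sup>2)" for T
      using norm_schur_op_le[OF f, of "\<iota> T"] unfolding m[symmetric] norm_iota .
  qed
  have symb: "has_symbol (Blinfun m) (Phi (\<lambda>x. complex_of_real (f x)))"
    by (simp add: has_symbol_def bounded_linear_Blinfun_apply[OF bl] m
        matrix_coeff_schur_op[OF f iota_bounded_ops])
  have eq: "M_Phi \<iota> f = Blinfun m"
    unfolding M_Phi_def schur_multiplier_def has_symbol_def[symmetric]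
    by (rule the_equality[where P = "\<lambda>M. has_symbol M (Phi (\<lambda>x. complex_of_real (f x)))"])
      (use symb has_symbol_unique in auto)
  show S: "has_symbol (M_Phi \<iota> f) (Phi (\<lambda>x. complex_of_real (f x)))"
    unfolding eq by (rule symb)
  show "norm (M_Phi \<iota> f) = (\<Sum>\<^sub>\<infinity>x. (f x)\<^sup>2)"
  proof (rule antisym)
    show "norm (M_Phi \<iota> f) \<le> (\<Sum>\<^sub>\<infinity>x. (f x)\<^sup>2)"
      unfolding eq
    proof (rule norm_blinfun_bound)
      show "norm (Blinfun m T) \<le> (\<Sum>\<^sub>\<infinity>x. (f x)\<^sup>2) * norm T" for T
        unfolding bounded_linear_Blinfun_apply[OF bl]
        using norm_schur_op_le[OF f, of "\<iota> T"] unfolding m[symmetric] norm_iota by (simp add: mult.commute)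
    qed (intro infsum_nonneg zero_le_power2)
    have "cmod (Phi (\<lambda>x. complex_of_real (f x)) 0) = \<bar>\<Sum>\<^sub>\<infinity>x. (f x)\<^sup>2\<bar>"
      by (simp add: Phi_of_real[OF f] power2_eq_square)
    also have "\<dots> = (\<Sum>\<^sub>\<infinity>x. (f x)\<^sup>2)"
      by (intro abs_of_nonneg infsum_nonneg zero_le_power2)
    finally show "(\<Sum>\<^sub>\<infinity>x. (f x)\<^sup>2) \<le> norm (M_Phi \<iota> f)"
      using norm_symbol_le[OF S, of 0] by simp
  qed
qed

end

section \<open>Polynomial approximation of powers\<close>

text \<open>The form in which limits of infinite sums are obtained below: the sequence, from some index on, and its
  limit are approximated by quantities whose convergence is known.\<close>

lemma LIMSEQ_if_approximated:
  fixes G :: "nat \<Rightarrow> real"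
  assumes "\<And>e. e > 0 \<Longrightarrow> \<exists>A a. (\<forall>\<^sub>F n in sequentially. \<bar>G n - A n\<bar> \<le> e) \<and> \<bar>l - a\<bar> \<le> e \<and> A \<longlonglongrightarrow> a"
  shows "G \<longlonglongrightarrow> l"
proof (rule LIMSEQ_I)
  fix e :: real assume "e > 0"
  then obtain A a where A: "\<forall>\<^sub>F n in sequentially. \<bar>G n - A n\<bar> \<le> e / 4" "\<bar>l - a\<bar> \<le> e / 4" "A \<longlonglongrightarrow> a"
    using assms[of "e / 4"] by auto
  have "\<forall>\<^sub>F n in sequentially. \<bar>A n - a\<bar> < e / 4"
    using tendstoD[OF A(3), of "e / 4"] \<open>e > 0\<close> by (simp add: dist_real_def)
  with A(1) obtain N where N: "\<And>n. n \<ge> N \<Longrightarrow> \<bar>G n - A n\<bar> \<le> e / 4 \<and> \<bar>A n - a\<bar> < e / 4"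
    unfolding eventually_sequentially by (metis le_trans nat_le_linear)
  have "norm (G n - l) < e" if "n \<ge> N" for n
    using N[OF that] A(2) \<open>e > 0\<close> unfolding real_norm_def by arith
  then show "\<exists>N. \<forall>n\<ge>N. norm (G n - l) < e" by blast
qed

text \<open>Dividing by \<open>sqrt w\<close> and putting \<open>y = sqrt w\<close>, one has to approximate \<open>y powr (2 / p - 1)\<close>
  uniformly by polynomials in \<open>y\<close> with odd exponents only.  The exponent is positive, so the odd extension of
  this function to \<open>[-1, 1]\<close> is continuous, and the odd part of a Weierstrass approximation of it
  will do.\<close>

lemma powr_polynomial_approximation:
  fixes p e :: real
  assumes "0 < p" "p < 2" "e > 0"
  obtains J :: "nat set" and b m where "finite J" "\<And>i. i \<in> J \<Longrightarrow> m i \<ge> (1 :: nat)"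
    "\<And>w. 0 \<le> w \<Longrightarrow> w \<le> 1 \<Longrightarrow> \<bar>w powr (1 / p) - (\<Sum>i\<in>J. b i * w ^ m i)\<bar> \<le> e * sqrt w"
proof -
  \<comment> \<open>\<open>y * q y = w powr (1 / p)\<close> for \<open>y = sqrt w\<close>, and \<open>q\<close> is odd.\<close>
  define c where "c = 2 / p - 1"
  have "c > 0" using assms by (simp add: c_def field_simps)
  define q :: "real \<Rightarrow> real" where "q y = (if 0 \<le> y then y powr c else - ((- y) powr c))" for y
  have "continuous_on ({0..1} \<union> {-1..0}) q"
    unfolding q_def
  proof (rule continuous_on_If)
    show "continuous_on {0..1} (\<lambda>y::real. y powr c)"
      using \<open>c > 0\<close> by (intro continuous_on_powr' continuous_intros) auto
    show "continuous_on {-1..0} (\<lambda>y::real. - ((- y) powr c))"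
      using \<open>c > 0\<close> by (intro continuous_on_minus continuous_on_powr' continuous_intros) auto
  qed (use \<open>c > 0\<close> in auto)
  then have "continuous_on {-1..1} q"
    by (rule continuous_on_subset) auto
  then obtain Q where "real_polynomial_function Q" and Q: "\<And>y. y \<in> {-1..1} \<Longrightarrow> \<bar>q y - Q y\<bar> < e"
    using Stone_Weierstrass_real_polynomial_function[of "{-1..1}" q e] \<open>e > 0\<close> by auto
  then obtain b n where b: "Q = (\<lambda>y. \<Sum>i\<le>n. b i * y ^ i)"
    by (auto simp: real_polynomial_function_iff_sum)
  define J where "J = {i. i \<le> n \<and> odd i}"
  show ?thesis
  proof (rule that[of J "\<lambda>i. (i + 1) div 2" b])
    show "finite J" by (simp add: J_def)
    show "(i + 1) div 2 \<ge> 1" if "i \<in> J" for i using that by (auto simp: J_def elim: oddE)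
    fix w :: real assume w: "0 \<le> w" "w \<le> 1"
    define y where "y = sqrt w"
    have y: "0 \<le> y" "y \<le> 1" "y\<^sup>2 = w" using w by (auto simp: y_def)
    have odd_part: "(Q y - Q (- y)) / 2 = (\<Sum>i\<in>J. b i * y ^ i)"
    proof -
      have "(Q y - Q (- y)) / 2 = (\<Sum>i\<le>n. if odd i then b i * y ^ i else 0)"
        unfolding b sum_subtractf[symmetric] sum_divide_distrib by (rule sum.cong) auto
      also have "\<dots> = (\<Sum>i\<in>J. b i * y ^ i)"
        unfolding J_def by (rule sum.mono_neutral_cong_right) auto
      finally show ?thesis .
    qed
    have "\<bar>q y - Q y\<bar> < e" "\<bar>q (- y) - Q (- y)\<bar> < e" using y by (auto intro!: Q)
    moreover have "q (- y) = - q y" using y \<open>c > 0\<close> by (auto simp: q_def)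
    ultimately have "\<bar>q y - (Q y - Q (- y)) / 2\<bar> \<le> e" by (simp add: field_simps)
    then have "y * \<bar>q y - (\<Sum>i\<in>J. b i * y ^ i)\<bar> \<le> y * e"
      unfolding odd_part using y(1) by (rule mult_left_mono)
    then have "\<bar>y * q y - y * (\<Sum>i\<in>J. b i * y ^ i)\<bar> \<le> e * y"
      using y(1) by (simp add: abs_mult mult.commute flip: right_diff_distrib)
    moreover have "y * q y = w powr (1 / p)"
    proof (cases "w = 0")
      case False
      then have "y > 0" using w by (simp add: y_def)
      then have "y * q y = y powr (2 / p)" by (simp add: q_def powr_mult_base c_def)
      also have "\<dots> = (y powr 2) powr (1 / p)" by (simp add: powr_powr)
      finally show ?thesis using \<open>y > 0\<close> y by simp
    qed (use y in auto)
    moreover have "y * (\<Sum>i\<in>J. b i * y ^ i) = (\<Sum>i\<in>J. b i * w ^ ((i + 1) div 2))"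
      unfolding sum_distrib_left
    proof (rule sum.cong)
      fix i assume "i \<in> J"
      then obtain j where "i = 2 * j + 1" by (auto simp: J_def elim: oddE)
      then have "w ^ ((i + 1) div 2) = y ^ (i + 1)"
        unfolding y(3)[symmetric] power_mult[symmetric] by simp
      then show "y * (b i * y ^ i) = b i * w ^ ((i + 1) div 2)" by simp
    qed simp
    ultimately show "\<bar>w powr (1 / p) - (\<Sum>i\<in>J. b i * w ^ ((i + 1) div 2))\<bar> \<le> e * sqrt w"
      by (simp add: y_def)
  qed
qed

section \<open>Tuples and patterns\<close>

definition tuple_sum :: "nat \<Rightarrow> ('a list \<Rightarrow> real) \<Rightarrow> ('a \<Rightarrow> real) \<Rightarrow> real" where
  "tuple_sum k g \<mu> = (\<Sum>\<^sub>\<infinity>xs\<in>tuples k. g xs * prod_list (map \<mu> xs))"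

text \<open>The product measure of all tuples that arise from \<open>ys\<close> by translation.\<close>

definition pattern_sum :: "'a::group_add list \<Rightarrow> ('a \<Rightarrow> real) \<Rightarrow> real" where
  "pattern_sum ys \<mu> = (\<Sum>\<^sub>\<infinity>t. prod_list (map (\<lambda>y. \<mu> (t + y)) ys))"

text \<open>The representative of the translation class of a tuple that begins with \<open>0\<close>.\<close>

definition pattern_of :: "'a::group_add list \<Rightarrow> 'a list" where
  "pattern_of xs = map (\<lambda>x. - hd xs + x) xs"

lemma has_sum_finite_sum:
  fixes f :: "'i \<Rightarrow> 'b \<Rightarrow> 'c::topological_comm_monoid_add"
  assumes "finite P" "\<And>i. i \<in> P \<Longrightarrow> (f i has_sum s i) A"
  shows "((\<lambda>x. \<Sum>i\<in>P. f i x) has_sum (\<Sum>i\<in>P. s i)) A"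
  using assms by (induction P rule: finite_induct) (auto intro: has_sum_add)

lemma tuples_Suc_bij: "bij_betw (\<lambda>(x, xs). x # xs) (UNIV \<times> tuples k) (tuples (Suc k))"
  by (rule bij_betwI[where g = "\<lambda>xs. (hd xs, tl xs)"]) (auto simp: tuples_def length_Suc_conv)

lemma prod_list_map_nonneg: "(\<And>x. 0 \<le> \<mu> x) \<Longrightarrow> 0 \<le> prod_list (map \<mu> xs)" for \<mu> :: "'a \<Rightarrow> real"
  by (induction xs) auto

lemma tuple_weights_has_sum:
  fixes \<mu> :: "'a \<Rightarrow> real"
  assumes nonneg: "\<And>x. 0 \<le> \<mu> x" and \<mu>: "(\<mu> has_sum m) UNIV"
  shows "((\<lambda>xs. prod_list (map \<mu> xs)) has_sum m ^ k) (tuples k)"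
proof (induction k)
  case 0
  have "tuples 0 = {[] :: 'a list}" by (auto simp: tuples_def)
  then show ?case using has_sum_finite[of "{[]}" "\<lambda>xs. prod_list (map \<mu> xs)"] by simp
next
  case (Suc k)
  let ?P = "\<lambda>xs. prod_list (map \<mu> xs)"
  have 1: "((\<lambda>xs. \<mu> x * ?P xs) has_sum \<mu> x * m ^ k) (tuples k)" for x
    by (rule has_sum_cmult_right[OF Suc])
  have 2: "((\<lambda>x. \<mu> x * m ^ k) has_sum m * m ^ k) UNIV"
    by (rule has_sum_cmult_left[OF \<mu>])
  have "(\<lambda>(x, xs). \<mu> x * ?P xs) summable_on (UNIV \<times> tuples k)"
    by (rule summable_on_SigmaI[where g = "\<lambda>x. \<mu> x * m ^ k"])
      (use 1 2 nonneg prod_list_map_nonneg[of \<mu>] in \<open>auto simp: summable_on_def\<close>)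
  then have "((\<lambda>(x, xs). \<mu> x * ?P xs) has_sum m * m ^ k) (UNIV \<times> tuples k)"
    by (intro has_sum_SigmaI[where g = "\<lambda>x. \<mu> x * m ^ k"]) (use 1 2 in auto)
  then show ?case
    unfolding has_sum_reindex_bij_betw[OF tuples_Suc_bij, symmetric]
    by (simp add: case_prod_unfold)
qed

lemma tuple_sum_summable:
  fixes \<mu> :: "'a \<Rightarrow> real" and g :: "'a list \<Rightarrow> real"
  assumes nonneg: "\<And>x. 0 \<le> \<mu> x" and \<mu>: "(\<mu> has_sum m) UNIV"
    and g: "\<And>xs. xs \<in> tuples k \<Longrightarrow> \<bar>g xs\<bar> \<le> C"
  shows "(\<lambda>xs. norm (g xs * prod_list (map \<mu> xs))) summable_on tuples k"
proof (rule summable_on_comparison_test)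
  show "(\<lambda>xs. C * prod_list (map \<mu> xs)) summable_on tuples k"
    using tuple_weights_has_sum[OF nonneg \<mu>] by (intro summable_on_cmult_right) (auto simp: summable_on_def)
  show "norm (g xs * prod_list (map \<mu> xs)) \<le> C * prod_list (map \<mu> xs)" if "xs \<in> tuples k" for xs
    using g[OF that] prod_list_map_nonneg[of \<mu> xs, OF nonneg] by (auto simp: abs_mult intro: mult_right_mono)
qed simp

text \<open>The total mass of the product measure is \<open>m ^ k\<close>; the weaker bound by \<open>m\<close> itself is
  linear in the mass, so that it can be added up over a collection.\<close>

lemma abs_tuple_sum_le:
  fixes \<mu> :: "'a \<Rightarrow> real" and g :: "'a list \<Rightarrow> real"
  assumes nonneg: "\<And>x. 0 \<le> \<mu> x" and \<mu>: "(\<mu> has_sum m) UNIV" "m \<le> 1"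
    and g: "\<And>xs. xs \<in> tuples k \<Longrightarrow> \<bar>g xs\<bar> \<le> C" and k: "k \<ge> 1"
  shows "\<bar>tuple_sum k g \<mu>\<bar> \<le> C * m"
proof -
  note s = tuple_sum_summable[OF nonneg \<mu>(1) g]
  note w = tuple_weights_has_sum[OF nonneg \<mu>(1), of k]
  have "m \<ge> 0" using \<mu>(1) nonneg by (rule has_sum_nonneg)
  obtain xs :: "'a list" where "xs \<in> tuples k" by (auto simp: tuples_def intro: that[of "replicate k undefined"])
  then have "C \<ge> 0" using g[of xs] abs_ge_zero order_trans by blast
  have "\<bar>tuple_sum k g \<mu>\<bar> \<le> (\<Sum>\<^sub>\<infinity>xs\<in>tuples k. \<bar>g xs * prod_list (map \<mu> xs)\<bar>)"
    unfolding tuple_sum_def using norm_infsum_bound[OF s] by simp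
  also have "\<dots> \<le> (\<Sum>\<^sub>\<infinity>xs\<in>tuples k. C * prod_list (map \<mu> xs))"
  proof (rule infsum_mono)
    show "(\<lambda>xs. \<bar>g xs * prod_list (map \<mu> xs)\<bar>) summable_on tuples k" using s by simp
    show "(\<lambda>xs. C * prod_list (map \<mu> xs)) summable_on tuples k"
      using w by (intro summable_on_cmult_right) (auto simp: summable_on_def)
    show "\<bar>g xs * prod_list (map \<mu> xs)\<bar> \<le> C * prod_list (map \<mu> xs)" if "xs \<in> tuples k" for xs
      using g[OF that] prod_list_map_nonneg[of \<mu> xs, OF nonneg] by (auto simp: abs_mult intro: mult_right_mono)
  qed
  also have "\<dots> = C * m ^ k" by (rule infsumI[OF has_sum_cmult_right[OF w]])
  also have "\<dots> \<le> C * m ^ 1"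
    using \<open>C \<ge> 0\<close> \<open>m \<ge> 0\<close> \<mu>(2) k by (intro mult_left_mono power_decreasing)
  finally show ?thesis by simp
qed

lemma tuple_sum_diff:
  fixes \<mu> :: "'a \<Rightarrow> real" and g :: "'a list \<Rightarrow> real"
  assumes nonneg: "\<And>x. 0 \<le> \<mu> x" and \<mu>: "(\<mu> has_sum m) UNIV"
    and g: "\<And>xs. xs \<in> tuples k \<Longrightarrow> \<bar>g xs\<bar> \<le> C" and h: "\<And>xs. xs \<in> tuples k \<Longrightarrow> \<bar>h xs\<bar> \<le> B"
  shows "tuple_sum k (\<lambda>xs. g xs - h xs) \<mu> = tuple_sum k g \<mu> - tuple_sum k h \<mu>"
proof -
  note s = abs_summable_summable[OF tuple_sum_summable[OF nonneg \<mu> g]]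
    abs_summable_summable[OF tuple_sum_summable[OF nonneg \<mu> h]]
  have "((\<lambda>xs. g xs * prod_list (map \<mu> xs) + - (h xs * prod_list (map \<mu> xs))) has_sum
      tuple_sum k g \<mu> + - tuple_sum k h \<mu>) (tuples k)"
    unfolding tuple_sum_def by (intro has_sum_add has_sum_infsum s has_sum_uminusI)
  then show ?thesis
    by (simp add: tuple_sum_def left_diff_distrib infsumI)
qed

lemma pattern_of_shift: "pattern_of (map (\<lambda>x. s + x) xs) = pattern_of xs"
proof (cases xs)
  case (Cons x xs')
  have "- (s + x) + (s + y) = - x + y" for y
    by (simp add: minus_add add.assoc[symmetric] del: add_uminus_conv_diff) (simp add: add.assoc)
  then show ?thesis by (simp add: pattern_of_def Cons o_def)
qed (simp add: pattern_of_def)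

lemma shift_pattern_of: "map (\<lambda>x. hd xs + x) (pattern_of xs) = xs"
  by (simp add: pattern_of_def o_def add.assoc[symmetric])

lemma hd_pattern_of: "xs \<noteq> [] \<Longrightarrow> hd (pattern_of xs) = 0"
  by (simp add: pattern_of_def hd_map)

lemma pattern_of_eq_self: "hd ys = 0 \<Longrightarrow> pattern_of ys = ys"
  by (simp add: pattern_of_def)

lemma pattern_of_tuples [simp]: "pattern_of xs \<in> tuples k \<longleftrightarrow> xs \<in> tuples k"
  by (simp add: tuples_def pattern_of_def)

text \<open>The tuples with a given pattern are its translates, parametrized by the first entry.\<close>

lemma pattern_fibre_bij:
  assumes "ys \<in> tuples k" "hd ys = 0" "k \<ge> 1"
  shows "bij_betw (\<lambda>t. map (\<lambda>y. t + y) ys) UNIV {xs \<in> tuples k. pattern_of xs = ys}"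
proof (rule bij_betwI[where g = hd])
  have ne: "ys \<noteq> []" using assms by (auto simp: tuples_def)
  show "(\<lambda>t. map (\<lambda>y. t + y) ys) \<in> UNIV \<rightarrow> {xs \<in> tuples k. pattern_of xs = ys}"
    using assms by (auto simp: tuples_def pattern_of_shift pattern_of_eq_self)
  show "hd (map (\<lambda>y. t + y) ys) = t" for t using ne assms by (simp add: hd_map)
  show "map (\<lambda>y. hd xs + y) ys = xs" if "xs \<in> {xs \<in> tuples k. pattern_of xs = ys}" for xs
    using that by (auto simp: shift_pattern_of)
qed auto

lemma pattern_sum_summable:
  fixes \<mu> :: "'a::group_add \<Rightarrow> real"
  assumes nonneg: "\<And>x. 0 \<le> \<mu> x" and \<mu>: "(\<mu> has_sum m) UNIV"
    and ys: "ys \<in> tuples k" "hd ys = 0" "k \<ge> 1"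
  shows "(\<lambda>t. prod_list (map (\<lambda>y. \<mu> (t + y)) ys)) summable_on UNIV"
proof -
  have "(\<lambda>xs. prod_list (map \<mu> xs)) summable_on tuples k"
    using tuple_weights_has_sum[OF nonneg \<mu>] by (auto simp: summable_on_def)
  then have "(\<lambda>xs. prod_list (map \<mu> xs)) summable_on {xs \<in> tuples k. pattern_of xs = ys}"
    by (rule summable_on_subset_banach) auto
  then show ?thesis
    by (subst (asm) summable_on_reindex_bij_betw[OF pattern_fibre_bij[OF ys], symmetric]) (simp add: o_def)
qed

lemma tuple_sum_single_pattern:
  fixes \<mu> :: "'a::group_add \<Rightarrow> real"
  assumes nonneg: "\<And>x. 0 \<le> \<mu> x" and \<mu>: "(\<mu> has_sum m) UNIV"
    and ys: "ys \<in> tuples k" "hd ys = 0" "k \<ge> 1"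
  shows "((\<lambda>xs. (if pattern_of xs = ys then c else 0) * prod_list (map \<mu> xs)) has_sum c * pattern_sum ys \<mu>) (tuples k)"
proof -
  have "((\<lambda>t. c * prod_list (map (\<lambda>y. \<mu> (t + y)) ys)) has_sum c * pattern_sum ys \<mu>) UNIV"
    unfolding pattern_sum_def by (intro has_sum_cmult_right has_sum_infsum pattern_sum_summable[OF nonneg \<mu> ys])
  then have "((\<lambda>xs. c * prod_list (map \<mu> xs)) has_sum c * pattern_sum ys \<mu>) {xs \<in> tuples k. pattern_of xs = ys}"
    using has_sum_reindex_bij_betw[OF pattern_fibre_bij[OF ys], of "\<lambda>xs. c * prod_list (map \<mu> xs)"]
    by (simp add: o_def)
  then show ?thesis
    by (rule has_sum_cong_neutral[THEN iffD1, rotated -1]) auto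
qed

lemma tuple_sum_finite_patterns:
  fixes \<mu> :: "'a::group_add \<Rightarrow> real"
  assumes nonneg: "\<And>x. 0 \<le> \<mu> x" and \<mu>: "(\<mu> has_sum m) UNIV"
    and P: "finite P" "\<And>ys. ys \<in> P \<Longrightarrow> ys \<in> tuples k \<and> hd ys = 0" and k: "k \<ge> 1"
  shows "tuple_sum k (\<lambda>xs. if pattern_of xs \<in> P then c (pattern_of xs) else 0) \<mu> = (\<Sum>ys\<in>P. c ys * pattern_sum ys \<mu>)"
proof -
  have "((\<lambda>xs. \<Sum>ys\<in>P. (if pattern_of xs = ys then c ys else 0) * prod_list (map \<mu> xs))
      has_sum (\<Sum>ys\<in>P. c ys * pattern_sum ys \<mu>)) (tuples k)"
    by (intro has_sum_finite_sum tuple_sum_single_pattern[OF nonneg \<mu>]) (use P k in auto)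
  moreover have "(\<Sum>ys\<in>P. (if pattern_of xs = ys then c ys else 0) * prod_list (map \<mu> xs))
      = (if pattern_of xs \<in> P then c (pattern_of xs) else 0) * prod_list (map \<mu> xs)" for xs
    using P(1) by (simp flip: sum_distrib_right)
  ultimately show ?thesis unfolding tuple_sum_def by (simp add: infsumI)
qed

context
  fixes d :: "'a::group_add \<Rightarrow> 'a \<Rightarrow> real"
  assumes d: "proper_left_invariant_metric d"
begin

lemma max_dist_shift: "max_dist d (map (\<lambda>x. s + x) xs) = max_dist d xs"
proof -
  have "d (s + x) (s + y) = d x y" for x y
    using d by (simp add: proper_left_invariant_metric_def)
  then show ?thesis
    unfolding max_dist_def by (intro arg_cong[where f = Max] Collect_cong ex_cong1) auto
qed

lemma max_dist_pattern_of: "max_dist d (pattern_of xs) = max_dist d xs"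
  unfolding pattern_of_def by (rule max_dist_shift)

lemma test_function_pattern_of:
  assumes "g \<in> test_functions d k" "xs \<in> tuples k"
  shows "g (pattern_of xs) = g xs"
proof -
  have "g (map (\<lambda>x. - hd xs + x) xs) = g xs" using assms by (auto simp: test_functions_def)
  then show ?thesis by (simp add: pattern_of_def)
qed

text \<open>All entries lie in a ball around the first entry \<open>0\<close>, and balls are finite.\<close>

lemma finite_patterns_bounded: "finite {ys \<in> tuples k. hd ys = 0 \<and> max_dist d ys \<le> R}"
proof (rule finite_subset)
  let ?B = "insert 0 {y. d 0 y \<le> R}"
  show "{ys \<in> tuples k. hd ys = 0 \<and> max_dist d ys \<le> R} \<subseteq> {ys. set ys \<subseteq> ?B \<and> length ys = k}"
  proof (intro subsetI CollectI conjI)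
    fix ys y assume ys': "ys \<in> {ys \<in> tuples k. hd ys = 0 \<and> max_dist d ys \<le> R}" and "y \<in> set ys"
    then have ys: "ys \<in> tuples k" "hd ys = 0" "max_dist d ys \<le> R" by auto
    from \<open>y \<in> set ys\<close>
    obtain j where j: "j < length ys" "ys ! j = y" by (auto simp: in_set_conv_nth)
    have 0: "ys ! 0 = 0" using j ys(2) by (metis gr_implies_not0 hd_conv_nth list.size(3))
    show "y \<in> ?B"
    proof (cases "j = 0")
      case False
      let ?D = "{d (ys ! i) (ys ! j) | i j. i < length ys \<and> j < length ys \<and> i \<noteq> j}"
      have "?D \<subseteq> (\<lambda>(i, j). d (ys ! i) (ys ! j)) ` ({..<length ys} \<times> {..<length ys})" by auto
      then have "finite ?D" by (rule finite_subset) auto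
      moreover have "d 0 y \<in> ?D"
        unfolding mem_Collect_eq by (rule exI[of _ 0], rule exI[of _ j]) (use j 0 False in auto)
      ultimately have "d 0 y \<le> max_dist d ys" unfolding max_dist_def by (rule Max_ge)
      then show ?thesis using ys by simp
    qed (use 0 j in simp)
  qed (auto simp: tuples_def)
  show "finite {ys. set ys \<subseteq> ?B \<and> length ys = k}"
    using d by (intro finite_lists_length_eq) (auto simp: proper_left_invariant_metric_def)
qed

text \<open>Up to a uniform error, an invariant function vanishing at infinity is supported on finitely many
  patterns.\<close>

lemma test_function_truncation:
  fixes g :: "'a list \<Rightarrow> real"
  assumes g: "g \<in> test_functions d k" and "k \<ge> 1" "e > 0"
  obtains P where "finite P" "\<And>ys. ys \<in> P \<Longrightarrow> ys \<in> tuples k \<and> hd ys = 0"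
    "\<And>xs. xs \<in> tuples k \<Longrightarrow> pattern_of xs \<notin> P \<Longrightarrow> \<bar>g xs\<bar> < e"
proof -
  obtain R where R: "\<And>xs. xs \<in> tuples k \<Longrightarrow> max_dist d xs > R \<Longrightarrow> \<bar>g xs\<bar> < e"
    using g \<open>e > 0\<close> unfolding test_functions_def by blast
  let ?P = "{ys \<in> tuples k. hd ys = 0 \<and> max_dist d ys \<le> R}"
  show ?thesis
  proof (rule that[of ?P])
    show "finite ?P" by (rule finite_patterns_bounded)
    fix xs assume xs: "xs \<in> tuples k" "pattern_of xs \<notin> ?P"
    then have "xs \<noteq> []" using \<open>k \<ge> 1\<close> by (auto simp: tuples_def)
    then have "max_dist d xs > R" using xs hd_pattern_of[of xs] by (auto simp: max_dist_pattern_of)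
    then show "\<bar>g xs\<bar> < e" using R xs by blast
  qed auto
qed

lemma test_function_bounded:
  fixes g :: "'a list \<Rightarrow> real"
  assumes g: "g \<in> test_functions d k" and "k \<ge> 1"
  obtains C where "C \<ge> 0" "\<And>xs. xs \<in> tuples k \<Longrightarrow> \<bar>g xs\<bar> \<le> C"
proof -
  obtain P where P: "finite P" "\<And>xs. xs \<in> tuples k \<Longrightarrow> pattern_of xs \<notin> P \<Longrightarrow> \<bar>g xs\<bar> < 1"
    using test_function_truncation[OF assms, of 1] by (metis zero_less_one)
  show ?thesis
  proof (rule that[of "1 + (\<Sum>ys\<in>P. \<bar>g ys\<bar>)"])
    show "0 \<le> 1 + (\<Sum>ys\<in>P. \<bar>g ys\<bar>)" by (simp add: sum_nonneg add_nonneg_nonneg)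
    fix xs :: "'a list" assume xs: "xs \<in> tuples k"
    show "\<bar>g xs\<bar> \<le> 1 + (\<Sum>ys\<in>P. \<bar>g ys\<bar>)"
    proof (cases "pattern_of xs \<in> P")
      case True
      have "\<bar>g (pattern_of xs)\<bar> \<le> (\<Sum>ys\<in>P. \<bar>g ys\<bar>)"
        by (rule member_le_sum[OF True]) (use P(1) in auto)
      then show ?thesis by (simp add: test_function_pattern_of[OF g xs])
    next
      case False
      moreover have "0 \<le> (\<Sum>ys\<in>P. \<bar>g ys\<bar>)" by (simp add: sum_nonneg)
      ultimately show ?thesis using P(2)[OF xs] by linarith
    qed
  qed
qed

text \<open>Thus every pattern sum is one of the functionals from which the metric is built, up to approximation.\<close>

lemma pattern_indicator_test_function:
  "(\<lambda>xs. if pattern_of xs = ys then 1 else 0) \<in> test_functions d k"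
proof -
  have "\<exists>R. \<forall>xs\<in>tuples k. max_dist d xs > R \<longrightarrow> \<bar>if pattern_of xs = ys then 1 else 0 :: real\<bar> < e"
    if "e > 0" for e
    using that max_dist_pattern_of by (intro exI[of _ "max_dist d ys"]) auto
  then show ?thesis unfolding test_functions_def by (auto simp: pattern_of_shift)
qed

end

section \<open>Families of mass distributions\<close>

text \<open>The measures belonging to a collection of orbits; the index set plays the role of the set of
  orbits with multiplicities.\<close>

definition mass_family :: "nat set \<Rightarrow> (nat \<Rightarrow> 'a \<Rightarrow> real) \<Rightarrow> bool" where
  "mass_family I \<mu> \<longleftrightarrow> (\<forall>i\<in>I. (\<forall>x. 0 \<le> \<mu> i x) \<and> \<mu> i summable_on UNIV) \<and>
     (\<lambda>i. infsum (\<mu> i) UNIV) summable_on I \<and> (\<Sum>\<^sub>\<infinity>i\<in>I. infsum (\<mu> i) UNIV) \<le> 1"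

context
  fixes I :: "nat set" and \<mu> :: "nat \<Rightarrow> 'a \<Rightarrow> real"
  assumes fam: "mass_family I \<mu>"
begin

lemma mass_family_nonneg: "i \<in> I \<Longrightarrow> 0 \<le> \<mu> i x"
  using fam by (simp add: mass_family_def)

lemma mass_family_has_sum: "i \<in> I \<Longrightarrow> (\<mu> i has_sum infsum (\<mu> i) UNIV) UNIV"
  using fam by (simp add: mass_family_def)

lemma mass_family_mass_nonneg: "i \<in> I \<Longrightarrow> 0 \<le> infsum (\<mu> i) UNIV"
  by (intro infsum_nonneg mass_family_nonneg)

lemma mass_family_mass_le_1: "i \<in> I \<Longrightarrow> infsum (\<mu> i) UNIV \<le> 1"
  using finite_sum_le_infsum[of "\<lambda>i. infsum (\<mu> i) UNIV" I "{i}"] mass_family_mass_nonneg fam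
  by (auto simp: mass_family_def)

lemma
  fixes h :: "nat \<Rightarrow> real"
  assumes h: "\<And>i. i \<in> I \<Longrightarrow> \<bar>h i\<bar> \<le> C * infsum (\<mu> i) UNIV" and "C \<ge> 0"
  shows mass_family_summable: "h summable_on I"
    and mass_family_abs_infsum_le: "\<bar>infsum h I\<bar> \<le> C"
proof -
  have m: "(\<lambda>i. C * infsum (\<mu> i) UNIV) summable_on I"
    using fam by (intro summable_on_cmult_right) (simp add: mass_family_def)
  have s: "(\<lambda>i. norm (h i)) summable_on I"
    by (rule summable_on_comparison_test[OF m]) (use h in auto)
  then show "h summable_on I" by (rule abs_summable_summable)
  have "\<bar>infsum h I\<bar> \<le> (\<Sum>\<^sub>\<infinity>i\<in>I. \<bar>h i\<bar>)" using norm_infsum_bound[OF s] by simp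
  also have "\<dots> \<le> (\<Sum>\<^sub>\<infinity>i\<in>I. C * infsum (\<mu> i) UNIV)"
    by (rule infsum_mono) (use s m h in auto)
  also have "\<dots> = C * (\<Sum>\<^sub>\<infinity>i\<in>I. infsum (\<mu> i) UNIV)" by (rule infsum_cmult_right')
  also have "\<dots> \<le> C * 1" using fam \<open>C \<ge> 0\<close> by (intro mult_left_mono) (auto simp: mass_family_def)
  finally show "\<bar>infsum h I\<bar> \<le> C" by simp
qed

lemma mass_family_tuple_sum_le:
  assumes "\<And>xs. xs \<in> tuples k \<Longrightarrow> \<bar>g xs\<bar> \<le> C" "k \<ge> 1" "i \<in> I"
  shows "\<bar>tuple_sum k g (\<mu> i)\<bar> \<le> C * infsum (\<mu> i) UNIV"
  by (rule abs_tuple_sum_le[OF mass_family_nonneg mass_family_has_sum mass_family_mass_le_1])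
    (use assms in auto)

lemma mass_family_tuple_sum_close:
  assumes gh: "\<And>xs. xs \<in> tuples k \<Longrightarrow> \<bar>g xs - h xs\<bar> \<le> e" and k: "k \<ge> 1" and "e \<ge> 0"
    and g: "\<And>xs. xs \<in> tuples k \<Longrightarrow> \<bar>g xs\<bar> \<le> C" "C \<ge> 0"
    and h: "\<And>xs. xs \<in> tuples k \<Longrightarrow> \<bar>h xs\<bar> \<le> B" "B \<ge> 0"
  shows "\<bar>(\<Sum>\<^sub>\<infinity>i\<in>I. tuple_sum k g (\<mu> i)) - (\<Sum>\<^sub>\<infinity>i\<in>I. tuple_sum k h (\<mu> i))\<bar> \<le> e"
proof -
  have s: "(\<lambda>i. tuple_sum k g (\<mu> i)) summable_on I" "(\<lambda>i. tuple_sum k h (\<mu> i)) summable_on I"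
    using mass_family_summable[OF mass_family_tuple_sum_le[OF g(1) k] g(2)]
      mass_family_summable[OF mass_family_tuple_sum_le[OF h(1) k] h(2)] by auto
  have "(\<Sum>\<^sub>\<infinity>i\<in>I. tuple_sum k g (\<mu> i)) - (\<Sum>\<^sub>\<infinity>i\<in>I. tuple_sum k h (\<mu> i))
      = (\<Sum>\<^sub>\<infinity>i\<in>I. tuple_sum k g (\<mu> i) + - tuple_sum k h (\<mu> i))"
    by (subst infsum_add) (use s in \<open>auto simp: infsum_uminus summable_on_uminus\<close>)
  also have "\<dots> = (\<Sum>\<^sub>\<infinity>i\<in>I. tuple_sum k (\<lambda>xs. g xs - h xs) (\<mu> i))"
    by (rule infsum_cong)
      (simp add: tuple_sum_diff[OF mass_family_nonneg mass_family_has_sum g(1) h(1)])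
  finally show ?thesis
    using mass_family_abs_infsum_le[OF mass_family_tuple_sum_le[OF gh k] \<open>e \<ge> 0\<close>] by simp
qed

end

lemma mass_family_pattern_sum:
  fixes \<mu> :: "nat \<Rightarrow> 'a::group_add \<Rightarrow> real"
  assumes fam: "mass_family I \<mu>" and ys: "ys \<in> tuples k" "hd ys = 0" "k \<ge> 1"
  shows "i \<in> I \<Longrightarrow> pattern_sum ys (\<mu> i) = tuple_sum k (\<lambda>xs. if pattern_of xs = ys then 1 else 0) (\<mu> i)"
    and "(\<lambda>i. pattern_sum ys (\<mu> i)) summable_on I"
proof -
  show eq: "pattern_sum ys (\<mu> i) = tuple_sum k (\<lambda>xs. if pattern_of xs = ys then 1 else 0) (\<mu> i)"
    if "i \<in> I" for i
    using infsumI[OF tuple_sum_single_pattern[OF mass_family_nonneg[OF fam that] mass_family_has_sum[OF fam that] ys, of 1]]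
    by (simp add: tuple_sum_def)
  show "(\<lambda>i. pattern_sum ys (\<mu> i)) summable_on I"
    by (rule mass_family_summable[OF fam, of _ 1])
      (use ys in \<open>auto simp: eq intro!: order_trans[OF mass_family_tuple_sum_le[OF fam, of _ _ 1]]\<close>)
qed

lemma truncation_close:
  fixes \<mu> :: "nat \<Rightarrow> 'a::group_add \<Rightarrow> real"
  assumes d: "proper_left_invariant_metric d" and g: "g \<in> test_functions d k" and k: "k \<ge> 1"
    and fam: "mass_family I \<mu>" and "e > 0"
    and P: "finite P" "\<And>ys. ys \<in> P \<Longrightarrow> ys \<in> tuples k \<and> hd ys = 0"
    and small: "\<And>xs. xs \<in> tuples k \<Longrightarrow> pattern_of xs \<notin> P \<Longrightarrow> \<bar>g xs\<bar> < e"
  shows "\<bar>(\<Sum>\<^sub>\<infinity>i\<in>I. tuple_sum k g (\<mu> i)) - (\<Sum>ys\<in>P. g ys * (\<Sum>\<^sub>\<infinity>i\<in>I. pattern_sum ys (\<mu> i)))\<bar> \<le> e"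
proof -
  let ?h = "\<lambda>xs. if pattern_of xs \<in> P then g (pattern_of xs) else 0"
  obtain C where C: "C \<ge> 0" "\<And>xs. xs \<in> tuples k \<Longrightarrow> \<bar>g xs\<bar> \<le> C"
    using test_function_bounded[OF d g k] by blast
  have "(\<Sum>\<^sub>\<infinity>i\<in>I. tuple_sum k ?h (\<mu> i)) = (\<Sum>\<^sub>\<infinity>i\<in>I. \<Sum>ys\<in>P. g ys * pattern_sum ys (\<mu> i))"
    by (rule infsum_cong)
      (rule tuple_sum_finite_patterns[OF mass_family_nonneg[OF fam] mass_family_has_sum[OF fam] P k])
  also have "\<dots> = (\<Sum>ys\<in>P. g ys * (\<Sum>\<^sub>\<infinity>i\<in>I. pattern_sum ys (\<mu> i)))"
    by (rule infsumI, rule has_sum_finite_sum[OF P(1)], rule has_sum_cmult_right, rule has_sum_infsum)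
      (use mass_family_pattern_sum(2)[OF fam _ _ k] P in blast)
  finally have eq: "(\<Sum>\<^sub>\<infinity>i\<in>I. tuple_sum k ?h (\<mu> i)) = (\<Sum>ys\<in>P. g ys * (\<Sum>\<^sub>\<infinity>i\<in>I. pattern_sum ys (\<mu> i)))" .
  have h: "\<bar>?h xs\<bar> \<le> C" "\<bar>g xs - ?h xs\<bar> \<le> e" if "xs \<in> tuples k" for xs
    using that C \<open>e > 0\<close> small[OF that] test_function_pattern_of[OF d g that] by auto
  show ?thesis
    unfolding eq[symmetric]
    by (rule mass_family_tuple_sum_close[OF fam h(2) k _ C(2) C(1) h(1) C(1)]) (use \<open>e > 0\<close> in auto)
qed

text \<open>By \<open>truncation_close\<close> the functional of a test function is approximated by a linear combination of
  pattern sums, uniformly over all collections.\<close>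

lemma tuple_sums_converge_if_pattern_sums_converge:
  fixes \<mu> :: "nat \<Rightarrow> 'a::group_add \<Rightarrow> real"
  assumes d: "proper_left_invariant_metric d" and g: "g \<in> test_functions d k" and k: "k \<ge> 1"
    and famn: "\<And>n. mass_family (In n) (\<mu>n n)" and fam: "mass_family I \<mu>"
    and conv: "\<And>ys. ys \<in> tuples k \<Longrightarrow> hd ys = 0 \<Longrightarrow>
      (\<lambda>n. \<Sum>\<^sub>\<infinity>i\<in>In n. pattern_sum ys (\<mu>n n i)) \<longlonglongrightarrow> (\<Sum>\<^sub>\<infinity>i\<in>I. pattern_sum ys (\<mu> i))"
  shows "(\<lambda>n. \<Sum>\<^sub>\<infinity>i\<in>In n. tuple_sum k g (\<mu>n n i)) \<longlonglongrightarrow> (\<Sum>\<^sub>\<infinity>i\<in>I. tuple_sum k g (\<mu> i))"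
proof (rule LIMSEQ_if_approximated)
  fix e :: real assume "e > 0"
  obtain P where P: "finite P" "\<And>ys. ys \<in> P \<Longrightarrow> ys \<in> tuples k \<and> hd ys = 0"
    and small: "\<And>xs. xs \<in> tuples k \<Longrightarrow> pattern_of xs \<notin> P \<Longrightarrow> \<bar>g xs\<bar> < e"
    using test_function_truncation[OF d g k \<open>e > 0\<close>] by blast
  note close = truncation_close[OF d g k _ \<open>e > 0\<close> P small]
  have "(\<lambda>n. \<Sum>ys\<in>P. g ys * (\<Sum>\<^sub>\<infinity>i\<in>In n. pattern_sum ys (\<mu>n n i)))
      \<longlonglongrightarrow> (\<Sum>ys\<in>P. g ys * (\<Sum>\<^sub>\<infinity>i\<in>I. pattern_sum ys (\<mu> i)))"
    by (intro tendsto_intros conv) (use P in auto)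
  then show "\<exists>A a. (\<forall>\<^sub>F n in sequentially. \<bar>(\<Sum>\<^sub>\<infinity>i\<in>In n. tuple_sum k g (\<mu>n n i)) - A n\<bar> \<le> e) \<and>
      \<bar>(\<Sum>\<^sub>\<infinity>i\<in>I. tuple_sum k g (\<mu> i)) - a\<bar> \<le> e \<and> A \<longlonglongrightarrow> a"
    using close[OF famn] close[OF fam] by (intro exI conjI always_eventually allI)
qed

section \<open>Autocorrelations as limits of pattern sums\<close>

definition autocorrelation :: "('a::group_add \<Rightarrow> real) \<Rightarrow> 'a \<Rightarrow> real" where
  "autocorrelation \<alpha> s = (\<Sum>\<^sub>\<infinity>t. \<alpha> t * \<alpha> (t + s))"

text \<open>The pattern consisting of \<open>m\<close> times \<open>0\<close> and \<open>m\<close> times \<open>s\<close> sums the power \<open>w ^ m\<close> of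
  \<open>w = \<mu> t * \<mu> (t + s)\<close>, for \<open>\<mu> = \<alpha> powr p\<close>.  The error \<open>e * sqrt w\<close> of the approximation is at
  most \<open>e / 2 * (\<mu> t + \<mu> (t + s))\<close>.\<close>

lemma autocorrelation_pattern_approximation:
  fixes \<alpha> :: "'a::group_add \<Rightarrow> real"
  assumes p: "0 < p" and \<alpha>: "\<And>x. 0 \<le> \<alpha> x" "\<And>x. \<alpha> x \<le> 1"
    and m: "((\<lambda>x. \<alpha> x powr p) has_sum m) UNIV" and summ: "(\<lambda>t. \<alpha> t * \<alpha> (t + s)) summable_on UNIV"
    and J: "finite J" "\<And>i. i \<in> J \<Longrightarrow> mm i \<ge> (1 :: nat)"
    and approx: "\<And>w. 0 \<le> w \<Longrightarrow> w \<le> 1 \<Longrightarrow> \<bar>w powr (1 / p) - (\<Sum>i\<in>J. b i * w ^ mm i)\<bar> \<le> e * sqrt w"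
    and "e > 0"
  shows "\<bar>(\<Sum>\<^sub>\<infinity>t. \<alpha> t * \<alpha> (t + s))
    - (\<Sum>i\<in>J. b i * pattern_sum (replicate (mm i) 0 @ replicate (mm i) s) (\<lambda>x. \<alpha> x powr p))\<bar> \<le> e * m"
proof -
  let ?\<mu> = "\<lambda>x. \<alpha> x powr p" and ?ys = "\<lambda>i. replicate (mm i) 0 @ replicate (mm i) s"
  let ?w = "\<lambda>t. ?\<mu> t * ?\<mu> (t + s)"
  have w: "?w t powr (1 / p) = \<alpha> t * \<alpha> (t + s)" for t
    using \<alpha> p by (simp add: powr_mult powr_powr)
  have w01: "0 \<le> ?w t" "?w t \<le> 1" for t
    using \<alpha> p by (auto intro!: mult_le_one simp: powr_le1)
  have pr: "prod_list (map (\<lambda>y. ?\<mu> (t + y)) (?ys i)) = ?w t ^ mm i" for t i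
    by (simp add: prod_list_replicate map_replicate_const power_mult_distrib)
  have ps: "(\<lambda>t. ?w t ^ mm i) summable_on UNIV" if "i \<in> J" for i
    unfolding pr[symmetric] using J(2)[OF that]
    by (intro pattern_sum_summable[OF _ m, where k = "2 * mm i"]) (auto simp: tuples_def hd_append)
  have "((\<lambda>t. \<alpha> t * \<alpha> (t + s) + (\<Sum>i\<in>J. - b i * ?w t ^ mm i)) has_sum
      (\<Sum>\<^sub>\<infinity>t. \<alpha> t * \<alpha> (t + s)) + (\<Sum>i\<in>J. - b i * (\<Sum>\<^sub>\<infinity>t. ?w t ^ mm i))) UNIV"
    by (intro has_sum_add has_sum_finite_sum has_sum_cmult_right has_sum_infsum summ ps J)
  then have hs: "((\<lambda>t. \<alpha> t * \<alpha> (t + s) - (\<Sum>i\<in>J. b i * ?w t ^ mm i)) has_sum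
      (\<Sum>\<^sub>\<infinity>t. \<alpha> t * \<alpha> (t + s)) - (\<Sum>i\<in>J. b i * pattern_sum (?ys i) ?\<mu>)) UNIV"
    unfolding pattern_sum_def pr by (simp add: sum_negf)
  have le: "\<bar>\<alpha> t * \<alpha> (t + s) - (\<Sum>i\<in>J. b i * ?w t ^ mm i)\<bar> \<le> e / 2 * (?\<mu> t + ?\<mu> (t + s))" for t
  proof -
    have "\<bar>\<alpha> t * \<alpha> (t + s) - (\<Sum>i\<in>J. b i * ?w t ^ mm i)\<bar> \<le> e * sqrt (?w t)"
      using approx[OF w01] unfolding w .
    also have "sqrt (?w t) \<le> (?\<mu> t + ?\<mu> (t + s)) / 2" by (rule arith_geo_mean_sqrt) auto
    finally show ?thesis using \<open>e > 0\<close> by simp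
  qed
  \<comment> \<open>Both summands have total mass \<open>m\<close>, as the second one is a translate of the first.\<close>
  have bound: "((\<lambda>t. e / 2 * (?\<mu> t + ?\<mu> (t + s))) has_sum e / 2 * (m + m)) UNIV"
    by (intro has_sum_cmult_right has_sum_add m, subst has_sum_reindex_bij_betw[OF bij_add_right]) (rule m)
  have "\<bar>(\<Sum>\<^sub>\<infinity>t. \<alpha> t * \<alpha> (t + s)) - (\<Sum>i\<in>J. b i * pattern_sum (?ys i) ?\<mu>)\<bar> \<le> e / 2 * (m + m)"
  proof (rule abs_leI)
    show "(\<Sum>\<^sub>\<infinity>t. \<alpha> t * \<alpha> (t + s)) - (\<Sum>i\<in>J. b i * pattern_sum (?ys i) ?\<mu>) \<le> e / 2 * (m + m)"
      by (rule has_sum_mono[OF hs bound]) (rule abs_le_D1[OF le])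
    show "- ((\<Sum>\<^sub>\<infinity>t. \<alpha> t * \<alpha> (t + s)) - (\<Sum>i\<in>J. b i * pattern_sum (?ys i) ?\<mu>)) \<le> e / 2 * (m + m)"
      by (rule has_sum_mono[OF has_sum_uminusI[OF hs] bound]) (rule abs_le_D2[OF le])
  qed
  then show ?thesis by (simp add: field_simps)
qed

lemma square_le_powr:
  fixes x p :: real
  assumes "0 < p" "p \<le> 2" "0 \<le> x" "x \<le> 1"
  shows "x\<^sup>2 \<le> x powr p"
proof (cases "x = 0")
  case False
  then have "x\<^sup>2 = x powr 2" using assms by simp
  also have "\<dots> \<le> x powr p" using assms False by (intro powr_mono') auto
  finally show ?thesis .
qed simp

lemma square_summable:
  fixes \<alpha> :: "'a \<Rightarrow> real"
  assumes "0 < p" "p \<le> 2" "\<And>x. 0 \<le> \<alpha> x" "\<And>x. \<alpha> x \<le> 1" "(\<lambda>x. \<alpha> x powr p) summable_on UNIV"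
  shows "(\<lambda>x. (\<alpha> x)\<^sup>2) summable_on UNIV"
  by (rule summable_on_comparison_test[OF assms(5)]) (use assms square_le_powr in auto)

text \<open>\<open>\<alpha> t * \<alpha> (t + s)\<close> is at most the mean of the two squares, and these are dominated by
  \<open>p\<close>-th powers because the values lie between \<open>0\<close> and \<open>1\<close>.\<close>

lemma autocorrelation_bounds:
  fixes \<alpha> :: "'a::group_add \<Rightarrow> real"
  assumes p: "0 < p" "p \<le> 2" and \<alpha>: "\<And>x. 0 \<le> \<alpha> x" "\<And>x. \<alpha> x \<le> 1"
    and m: "((\<lambda>x. \<alpha> x powr p) has_sum m) UNIV"
  shows "0 \<le> autocorrelation \<alpha> s" "autocorrelation \<alpha> s \<le> m"
proof -
  have "(\<lambda>x. \<alpha> x powr p) summable_on UNIV" using m by (auto simp: summable_on_def)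
  note sq = square_summable[OF p \<alpha> this]
  show "0 \<le> autocorrelation \<alpha> s"
    unfolding autocorrelation_def by (intro infsum_nonneg mult_nonneg_nonneg \<alpha>)
  have bound: "((\<lambda>t. 1 / 2 * (\<alpha> t powr p + \<alpha> (t + s) powr p)) has_sum 1 / 2 * (m + m)) UNIV"
    by (intro has_sum_cmult_right has_sum_add m,
        subst has_sum_reindex_bij_betw[OF bij_add_right, of "\<lambda>t. \<alpha> t powr p"]) (rule m)
  have "autocorrelation \<alpha> s \<le> 1 / 2 * (m + m)"
  proof (rule has_sum_mono[OF _ bound])
    show "((\<lambda>t. \<alpha> t * \<alpha> (t + s)) has_sum autocorrelation \<alpha> s) UNIV"
      unfolding autocorrelation_def by (rule has_sum_infsum[OF autocorrelation_summable[OF sq]])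
    show "\<alpha> t * \<alpha> (t + s) \<le> 1 / 2 * (\<alpha> t powr p + \<alpha> (t + s) powr p)" for t
      using sum_squares_bound[of "\<alpha> t" "\<alpha> (t + s)"] square_le_powr[OF p \<alpha>, of t]
        square_le_powr[OF p \<alpha>, of "t + s"]
      by (simp add: mult.assoc)
  qed
  then show "autocorrelation \<alpha> s \<le> m" by simp
qed

definition lp_family :: "real \<Rightarrow> nat set \<Rightarrow> (nat \<Rightarrow> 'a \<Rightarrow> real) \<Rightarrow> bool" where
  "lp_family p I \<alpha> \<longleftrightarrow> (\<forall>i\<in>I. \<forall>x. 0 \<le> \<alpha> i x \<and> \<alpha> i x \<le> 1) \<and> mass_family I (\<lambda>i x. \<alpha> i x powr p)"

lemma lp_familyD:
  assumes "lp_family p I \<alpha>"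
  shows "i \<in> I \<Longrightarrow> 0 \<le> \<alpha> i x" "i \<in> I \<Longrightarrow> \<alpha> i x \<le> 1" "mass_family I (\<lambda>i x. \<alpha> i x powr p)"
    "i \<in> I \<Longrightarrow> ((\<lambda>x. \<alpha> i x powr p) has_sum (\<Sum>\<^sub>\<infinity>x. \<alpha> i x powr p)) UNIV"
  using assms mass_family_has_sum[of I "\<lambda>i x. \<alpha> i x powr p" i] by (auto simp: lp_family_def)

lemma lp_family_square_summable:
  assumes "lp_family p I \<alpha>" "0 < p" "p \<le> 2" "i \<in> I"
  shows "(\<lambda>x. (\<alpha> i x)\<^sup>2) summable_on UNIV"
  by (rule square_summable[OF assms(2,3)])
    (use lp_familyD(1,2)[OF assms(1,4)] lp_familyD(4)[OF assms(1,4)] in \<open>auto intro: has_sum_imp_summable\<close>)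

lemma lp_family_autocorrelation_summable:
  assumes "lp_family p I \<alpha>" "0 < p" "p \<le> 2"
  shows "(\<lambda>i. autocorrelation (\<alpha> i) s) summable_on I"
proof (rule mass_family_summable[OF lp_familyD(3)[OF assms(1)], of _ 1])
  fix i assume i: "i \<in> I"
  note A = lp_familyD[OF assms(1)]
  show "\<bar>autocorrelation (\<alpha> i) s\<bar> \<le> 1 * (\<Sum>\<^sub>\<infinity>x. \<alpha> i x powr p)"
    using autocorrelation_bounds[OF assms(2,3) A(1)[OF i] A(2)[OF i] A(4)[OF i], of s] by simp
qed simp

lemma autocorrelations_close:
  fixes \<alpha> :: "nat \<Rightarrow> 'a::group_add \<Rightarrow> real"
  assumes fam: "lp_family p I \<alpha>" and p: "0 < p" "p \<le> 2"
    and J: "finite J" "\<And>i. i \<in> J \<Longrightarrow> mm i \<ge> (1 :: nat)"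
    and approx: "\<And>w. 0 \<le> w \<Longrightarrow> w \<le> 1 \<Longrightarrow> \<bar>w powr (1 / p) - (\<Sum>i\<in>J. b i * w ^ mm i)\<bar> \<le> e * sqrt w"
    and "e > 0"
  shows "\<bar>(\<Sum>\<^sub>\<infinity>i\<in>I. autocorrelation (\<alpha> i) s) - (\<Sum>j\<in>J. b j * (\<Sum>\<^sub>\<infinity>i\<in>I.
    pattern_sum (replicate (mm j) 0 @ replicate (mm j) s) (\<lambda>x. \<alpha> i x powr p)))\<bar> \<le> e"
proof -
  note A = lp_familyD[OF fam]
  let ?ys = "\<lambda>j. replicate (mm j) 0 @ replicate (mm j) s"
  have ps: "(\<lambda>i. pattern_sum (?ys j) (\<lambda>x. \<alpha> i x powr p)) summable_on I" if "j \<in> J" for j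
    using J(2)[OF that]
    by (intro mass_family_pattern_sum(2)[OF A(3), where k = "2 * mm j"]) (auto simp: tuples_def hd_append)
  have "((\<lambda>i. autocorrelation (\<alpha> i) s + (\<Sum>j\<in>J. - b j * pattern_sum (?ys j) (\<lambda>x. \<alpha> i x powr p))) has_sum
      (\<Sum>\<^sub>\<infinity>i\<in>I. autocorrelation (\<alpha> i) s) + (\<Sum>j\<in>J. - b j * (\<Sum>\<^sub>\<infinity>i\<in>I. pattern_sum (?ys j) (\<lambda>x. \<alpha> i x powr p)))) I"
    by (intro has_sum_add has_sum_finite_sum has_sum_cmult_right has_sum_infsum ps J
        lp_family_autocorrelation_summable[OF fam p])
  then have "(\<Sum>\<^sub>\<infinity>i\<in>I. autocorrelation (\<alpha> i) s) - (\<Sum>j\<in>J. b j * (\<Sum>\<^sub>\<infinity>i\<in>I. pattern_sum (?ys j) (\<lambda>x. \<alpha> i x powr p)))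
      = (\<Sum>\<^sub>\<infinity>i\<in>I. autocorrelation (\<alpha> i) s - (\<Sum>j\<in>J. b j * pattern_sum (?ys j) (\<lambda>x. \<alpha> i x powr p)))"
    by (simp add: sum_negf infsumI)
  moreover have "\<bar>autocorrelation (\<alpha> i) s - (\<Sum>j\<in>J. b j * pattern_sum (?ys j) (\<lambda>x. \<alpha> i x powr p))\<bar>
      \<le> e * (\<Sum>\<^sub>\<infinity>x. \<alpha> i x powr p)" if "i \<in> I" for i
    unfolding autocorrelation_def
    by (rule autocorrelation_pattern_approximation[OF p(1) A(1)[OF that] A(2)[OF that] A(4)[OF that]
          autocorrelation_summable[OF lp_family_square_summable[OF fam p that]] J approx \<open>e > 0\<close>])
  ultimately show ?thesis
    using mass_family_abs_infsum_le[OF A(3), of _ e] \<open>e > 0\<close> by simp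
qed

text \<open>The quality of the polynomial approximation depends neither on \<open>n\<close> nor on the collection.\<close>

lemma autocorrelations_converge_if_pattern_sums_converge:
  fixes \<alpha> :: "nat \<Rightarrow> 'a::group_add \<Rightarrow> real"
  assumes p: "0 < p" "p < 2"
    and famn: "\<And>n. lp_family p (In n) (\<alpha>n n)" and fam: "lp_family p I \<alpha>"
    and conv: "\<And>ys. length ys \<ge> 2 \<Longrightarrow> hd ys = 0 \<Longrightarrow>
      (\<lambda>n. \<Sum>\<^sub>\<infinity>i\<in>In n. pattern_sum ys (\<lambda>x. \<alpha>n n i x powr p)) \<longlonglongrightarrow>
      (\<Sum>\<^sub>\<infinity>i\<in>I. pattern_sum ys (\<lambda>x. \<alpha> i x powr p))"
  shows "(\<lambda>n. \<Sum>\<^sub>\<infinity>i\<in>In n. autocorrelation (\<alpha>n n i) s) \<longlonglongrightarrow> (\<Sum>\<^sub>\<infinity>i\<in>I. autocorrelation (\<alpha> i) s)"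
proof (rule LIMSEQ_if_approximated)
  fix e :: real assume "e > 0"
  obtain J :: "nat set" and b :: "nat \<Rightarrow> real" and mm :: "nat \<Rightarrow> nat" where J: "finite J" "\<And>i. i \<in> J \<Longrightarrow> mm i \<ge> (1 :: nat)"
    and approx: "\<And>w. 0 \<le> w \<Longrightarrow> w \<le> 1 \<Longrightarrow> \<bar>w powr (1 / p) - (\<Sum>i\<in>J. b i * w ^ mm i)\<bar> \<le> e * sqrt w"
    by (rule powr_polynomial_approximation[OF p \<open>e > 0\<close>], rule that)
  let ?ys = "\<lambda>j. replicate (mm j) 0 @ replicate (mm j) s"
  have p_le_2: "p \<le> 2" using p by simp
  note close = autocorrelations_close[OF _ p(1) p_le_2 J approx \<open>e > 0\<close>, of _ _ s]
  have "(\<lambda>n. \<Sum>j\<in>J. b j * (\<Sum>\<^sub>\<infinity>i\<in>In n. pattern_sum (?ys j) (\<lambda>x. \<alpha>n n i x powr p)))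
      \<longlonglongrightarrow> (\<Sum>j\<in>J. b j * (\<Sum>\<^sub>\<infinity>i\<in>I. pattern_sum (?ys j) (\<lambda>x. \<alpha> i x powr p)))"
    by (intro tendsto_intros conv) (use J(2) in \<open>force simp: hd_append\<close>)+
  then show "\<exists>A a. (\<forall>\<^sub>F n in sequentially. \<bar>(\<Sum>\<^sub>\<infinity>i\<in>In n. autocorrelation (\<alpha>n n i) s) - A n\<bar> \<le> e) \<and>
      \<bar>(\<Sum>\<^sub>\<infinity>i\<in>I. autocorrelation (\<alpha> i) s) - a\<bar> \<le> e \<and> A \<longlonglongrightarrow> a"
    using close[OF famn] close[OF fam] by (intro exI conjI always_eventually allI)
qed

section \<open>Collections of orbits\<close>

lemma orbit_self: "f \<in> orbit f"
  unfolding orbit_def by (rule CollectI, rule exI[of _ 0]) simp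

lemma orbit_zero: "orbit (\<lambda>_. 0) = {\<lambda>_. 0}"
  by (auto simp: orbit_def)

lemma orbit_eq_zero_iff: "orbit f = orbit (\<lambda>_. 0) \<longleftrightarrow> f = (\<lambda>_. 0)"
  using orbit_self[of f] by (auto simp: orbit_zero)

lemma rep_orbit: obtains s where "rep (orbit f) = (\<lambda>x. f (- s + x))"
proof -
  have "rep (orbit f) \<in> orbit f" unfolding rep_def by (rule someI[of "\<lambda>\<alpha>. \<alpha> \<in> orbit f", OF orbit_self])
  then show ?thesis using that by (auto simp: orbit_def)
qed

text \<open>Within the class of an orbit the indices are numbered, and the number becomes the second
  component of the member.  This needs the class to be finite, since otherwise the multiplicity,
  being a \<^const>\<open>card\<close>, would be \<open>0\<close>.\<close>

lemma members_bij:
  assumes fin: "\<And>c. c \<noteq> orbit (\<lambda>_. 0) \<Longrightarrow> finite {i \<in> I. orbit (\<alpha> i) = c}"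
  obtains b where "bij_betw b {i \<in> I. orbit (\<alpha> i) \<noteq> orbit (\<lambda>_. 0)} (members (collection_of I \<alpha>))"
    "\<And>i. fst (b i) = orbit (\<alpha> i)"
proof -
  let ?N = "{i \<in> I. orbit (\<alpha> i) \<noteq> orbit (\<lambda>_. 0)}" and ?F = "\<lambda>c. {i \<in> I. orbit (\<alpha> i) = c}"
  have "\<forall>c. \<exists>h. c \<noteq> orbit (\<lambda>_. 0) \<longrightarrow> bij_betw h (?F c) {..<card (?F c)}"
    using ex_bij_betw_finite_nat[OF fin] by (simp add: lessThan_atLeast0)
  then have "\<exists>h. \<forall>c. c \<noteq> orbit (\<lambda>_. 0) \<longrightarrow> bij_betw (h c) (?F c) {..<card (?F c)}"
    by (rule choice)
  then obtain h where h: "\<And>c. c \<noteq> orbit (\<lambda>_. 0) \<Longrightarrow> bij_betw (h c) (?F c) {..<card (?F c)}"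
    by blast
  define b where "b i = (orbit (\<alpha> i), h (orbit (\<alpha> i)) i)" for i
  have "bij_betw b ?N (members (collection_of I \<alpha>))"
  proof (rule bij_betw_imageI)
    show "inj_on b ?N"
    proof (rule inj_onI)
      fix i j assume ij: "i \<in> ?N" "j \<in> ?N" "b i = b j"
      from ij(3) have eq: "h (orbit (\<alpha> i)) i = h (orbit (\<alpha> i)) j" "orbit (\<alpha> j) = orbit (\<alpha> i)"
        unfolding b_def prod.inject by (metis, metis)
      show "i = j"
        by (rule inj_onD[OF bij_betw_imp_inj_on[OF h] eq(1)]) (use ij eq(2) in simp_all)
    qed
    show "b ` ?N = members (collection_of I \<alpha>)"
    proof (intro equalityI subsetI)
      fix z assume "z \<in> b ` ?N"
      then obtain i where i: "i \<in> ?N" "z = b i" by blast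
      then have "h (orbit (\<alpha> i)) i \<in> {..<card (?F (orbit (\<alpha> i)))}"
        by (intro bij_betw_apply[OF h]) auto
      then show "z \<in> members (collection_of I \<alpha>)"
        using i by (auto simp: members_def collection_of_def b_def)
    next
      fix z assume "z \<in> members (collection_of I \<alpha>)"
      then obtain c j where z: "z = (c, j)" "c \<noteq> orbit (\<lambda>_. 0)" "j < card (?F c)"
        by (auto simp: members_def collection_of_def split: if_splits)
      then have "j \<in> h c ` ?F c" using bij_betw_imp_surj_on[OF h[OF z(2)]] by auto
      then obtain i where "i \<in> I" "orbit (\<alpha> i) = c" "j = h c i" by auto
      then show "z \<in> b ` ?N" using z by (auto simp: b_def intro!: image_eqI[of _ _ i])
    qed
  qed
  then show ?thesis using that by (auto simp: b_def)
qed

text \<open>Sums over a collection may be computed with any indexing family: the choice of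
  representatives does not matter for translation invariant terms, and the disregarded zero orbits
  contribute \<open>0\<close>.\<close>

lemma has_sum_members:
  fixes G :: "('a::group_add \<Rightarrow> real) \<Rightarrow> 'b::{topological_comm_monoid_add}"
  assumes fin: "\<And>c. c \<noteq> orbit (\<lambda>_. 0) \<Longrightarrow> finite {i \<in> I. orbit (\<alpha> i) = c}"
    and inv: "\<And>f s. G (\<lambda>x. f (- s + x)) = G f" and zero: "G (\<lambda>_. 0) = 0"
  shows "((\<lambda>(c, j). G (rep c)) has_sum S) (members (collection_of I \<alpha>)) \<longleftrightarrow> ((\<lambda>i. G (\<alpha> i)) has_sum S) I"
proof -
  let ?N = "{i \<in> I. orbit (\<alpha> i) \<noteq> orbit (\<lambda>_. 0)}"
  obtain b where b: "bij_betw b ?N (members (collection_of I \<alpha>))" "\<And>i. fst (b i) = orbit (\<alpha> i)"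
    by (rule members_bij[OF fin], assumption, rule that)
  have G: "G (rep (orbit f)) = G f" for f
    by (rule rep_orbit[of f]) (simp add: inv)
  have "((\<lambda>(c, j). G (rep c)) has_sum S) (members (collection_of I \<alpha>))
      \<longleftrightarrow> ((\<lambda>i. G (rep (fst (b i)))) has_sum S) ?N"
    using has_sum_reindex_bij_betw[OF b(1), of "\<lambda>(c, j). G (rep c)"] by (simp add: case_prod_unfold)
  also have "\<dots> \<longleftrightarrow> ((\<lambda>i. G (\<alpha> i)) has_sum S) I"
    by (rule has_sum_cong_neutral) (auto simp: b(2) G orbit_eq_zero_iff zero)
  finally show ?thesis .
qed

lemma lp_family_of_X_space:
  assumes "\<xi> \<in> X_space p" "0 < p"
  obtains I \<alpha> where "\<xi> = collection_of I \<alpha>" "lp_family p I \<alpha>" "\<And>i. i \<in> I \<Longrightarrow> \<alpha> i \<in> Mp_le1 p"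
proof -
  obtain I \<alpha> where I: "\<xi> = collection_of I \<alpha>" "\<And>i. i \<in> I \<Longrightarrow> \<alpha> i \<in> Mp_le1 p"
    "(\<lambda>i. lp_norm p (\<alpha> i) powr p) summable_on I" "(\<Sum>\<^sub>\<infinity>i\<in>I. lp_norm p (\<alpha> i) powr p) \<le> 1"
    using assms(1) by (auto simp: X_space_def)
  have range: "0 \<le> \<alpha> i x \<and> \<alpha> i x \<le> 1" if "i \<in> I" for i x
    using I(2)[OF that] by (auto simp: Mp_le1_def image_subset_iff)
  have lp: "lp_norm p (\<alpha> i) powr p = (\<Sum>\<^sub>\<infinity>x. \<alpha> i x powr p)" if "i \<in> I" for i
    using range[OF that] \<open>0 < p\<close> by (simp add: lp_norm_def powr_powr infsum_nonneg)
  have "mass_family I (\<lambda>i x. \<alpha> i x powr p)"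
    unfolding mass_family_def
  proof (intro conjI ballI allI)
    show "(\<lambda>x. \<alpha> i x powr p) summable_on UNIV" if "i \<in> I" for i
      using I(2)[OF that] range[OF that] by (simp add: Mp_le1_def)
    show "(\<lambda>i. \<Sum>\<^sub>\<infinity>x. \<alpha> i x powr p) summable_on I"
      using I(3) by (rule summable_on_cong[THEN iffD1, rotated]) (rule lp)
    show "(\<Sum>\<^sub>\<infinity>i\<in>I. \<Sum>\<^sub>\<infinity>x. \<alpha> i x powr p) \<le> 1"
      using I(4) infsum_cong[of I "\<lambda>i. lp_norm p (\<alpha> i) powr p", OF lp] by simp
  qed simp
  then show ?thesis using that I range by (auto simp: lp_family_def)
qed

lemma Mp_le1_if_lp_family:
  assumes "lp_family p I \<alpha>" "i \<in> I" "0 < p"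
  shows "\<alpha> i \<in> Mp_le1 p"
    and "lp_norm p (\<alpha> i) powr p = (\<Sum>\<^sub>\<infinity>x. \<alpha> i x powr p)"
proof -
  note A = lp_familyD[OF assms(1)]
  show lp: "lp_norm p (\<alpha> i) powr p = (\<Sum>\<^sub>\<infinity>x. \<alpha> i x powr p)"
    using A(1,2)[OF assms(2)] \<open>0 < p\<close> by (simp add: lp_norm_def powr_powr infsum_nonneg)
  have "(\<Sum>\<^sub>\<infinity>x. \<alpha> i x powr p) powr (1 / p) \<le> 1"
    using mass_family_mass_le_1[OF A(3) assms(2)] \<open>0 < p\<close> infsum_nonneg[of UNIV "\<lambda>x. \<alpha> i x powr p"]
    by (intro powr_le1) auto
  then show "\<alpha> i \<in> Mp_le1 p"
    using A(1,2)[OF assms(2)] has_sum_imp_summable[OF A(4)[OF assms(2)]]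
    by (auto simp: Mp_le1_def lp_norm_def)
qed

lemma X_space_if_lp_family:
  assumes "lp_family p I \<alpha>" "0 < p"
  shows "collection_of I \<alpha> \<in> X_space p"
proof -
  note A = lp_familyD[OF assms(1)]
  note lp = Mp_le1_if_lp_family(2)[OF assms(1) _ assms(2)]
  have "(\<lambda>i. lp_norm p (\<alpha> i) powr p) summable_on I"
    using A(3) summable_on_cong[of I "\<lambda>i. lp_norm p (\<alpha> i) powr p", OF lp]
    unfolding mass_family_def by blast
  moreover have "(\<Sum>\<^sub>\<infinity>i\<in>I. lp_norm p (\<alpha> i) powr p) \<le> 1"
    using A(3) infsum_cong[of I "\<lambda>i. lp_norm p (\<alpha> i) powr p", OF lp]
    by (simp add: mass_family_def)
  ultimately show ?thesis
    unfolding X_space_def using Mp_le1_if_lp_family(1)[OF assms(1) _ assms(2)] by blast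
qed

text \<open>All functions in one orbit have the same mass, which is positive if the orbit is not zero, and the
  sum of the masses is finite.\<close>

lemma lp_family_finite_orbits:
  fixes \<alpha> :: "nat \<Rightarrow> 'a::group_add \<Rightarrow> real"
  assumes fam: "lp_family p I \<alpha>" and c: "c \<noteq> orbit (\<lambda>_. 0)"
  shows "finite {i \<in> I. orbit (\<alpha> i) = c}"
proof (rule ccontr)
  let ?F = "{i \<in> I. orbit (\<alpha> i) = c}" and ?m = "\<lambda>i. \<Sum>\<^sub>\<infinity>x. \<alpha> i x powr p"
  assume inf: "infinite ?F"
  then obtain i0 where i0: "i0 \<in> I" "orbit (\<alpha> i0) = c" by (auto dest: infinite_imp_nonempty)
  then have "\<alpha> i0 \<noteq> (\<lambda>_. 0)" using c by auto
  then obtain x where "\<alpha> i0 x \<noteq> 0" by auto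
  note A = lp_familyD[OF fam]
  have "0 < \<alpha> i0 x powr p" using \<open>\<alpha> i0 x \<noteq> 0\<close> by simp
  also have "\<dots> \<le> ?m i0"
    using finite_sum_le_has_sum[OF A(4)[OF i0(1)], of "{x}"] by simp
  finally have site: "0 < ?m i0" .
  have eq: "?m i = ?m i0" if "i \<in> ?F" for i
  proof -
    have "\<alpha> i \<in> orbit (\<alpha> i0)" using that i0 orbit_self[of "\<alpha> i"] by simp
    then obtain s where "\<alpha> i = (\<lambda>x. \<alpha> i0 (- s + x))" by (auto simp: orbit_def)
    then show ?thesis
      using infsum_reindex_bij_betw[OF bij_add_left[of "- s"], of "\<lambda>x. \<alpha> i0 x powr p"] by simp
  qed
  have s: "?m summable_on I" and le: "infsum ?m I \<le> 1" using A(3) by (auto simp: mass_family_def)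
  \<comment> \<open>\<open>N\<close> equal masses would exceed the total mass.\<close>
  obtain N :: nat where N: "1 < of_nat N * ?m i0"
    using ex_less_of_nat_mult[OF site] by blast
  obtain F where F: "F \<subseteq> ?F" "card F = N" "finite F" using infinite_arbitrarily_large[OF inf, of N] by blast
  have "of_nat N * ?m i0 = sum ?m F" using F eq by (simp add: subset_iff)
  also have "\<dots> \<le> infsum ?m I"
    by (rule finite_sum_le_infsum[OF s F(3)]) (use F A(3) mass_family_mass_nonneg in \<open>auto intro: infsum_nonneg\<close>)
  finally show False using N le by simp
qed

lemma has_sum_lp_family_members:
  fixes G :: "('a::group_add \<Rightarrow> real) \<Rightarrow> 'b::{topological_comm_monoid_add}"
  assumes "lp_family p I \<alpha>"
    and "\<And>f s. G (\<lambda>x. f (- s + x)) = G f" "G (\<lambda>_. 0) = 0"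
  shows "((\<lambda>(c, j). G (rep c)) has_sum S) (members (collection_of I \<alpha>)) \<longleftrightarrow> ((\<lambda>i. G (\<alpha> i)) has_sum S) I"
  using has_sum_members[of I \<alpha> G S, OF lp_family_finite_orbits[OF assms(1)]] assms(2,3) by blast

lemma tuple_sum_shift:
  fixes g :: "'a::group_add list \<Rightarrow> real"
  assumes "\<And>s xs. xs \<in> tuples k \<Longrightarrow> g (map (\<lambda>x. s + x) xs) = g xs"
  shows "tuple_sum k g (\<lambda>x. \<mu> (- s + x)) = tuple_sum k g \<mu>"
proof -
  have b: "bij_betw (map (\<lambda>x. - s + x)) (tuples k) (tuples k)"
    by (rule bij_betwI[where g = "map (\<lambda>x. s + x)"]) (auto simp: tuples_def o_def add.assoc[symmetric])
  have "tuple_sum k g \<mu> = (\<Sum>\<^sub>\<infinity>xs\<in>tuples k. g (map (\<lambda>x. - s + x) xs) * prod_list (map \<mu> (map (\<lambda>x. - s + x) xs)))"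
    unfolding tuple_sum_def
    by (rule infsum_reindex_bij_betw[OF b, of "\<lambda>xs. g xs * prod_list (map \<mu> xs)", symmetric])
  also have "\<dots> = tuple_sum k g (\<lambda>x. \<mu> (- s + x))"
    unfolding tuple_sum_def by (rule infsum_cong) (simp add: assms o_def)
  finally show ?thesis by simp
qed

lemma tuple_sum_zero: "k \<ge> 1 \<Longrightarrow> tuple_sum k g (\<lambda>_. 0) = 0"
  unfolding tuple_sum_def by (rule infsum_0) (auto simp: tuples_def map_replicate_const prod_list_replicate)

lemma functional_eq_tuple_sum:
  fixes g :: "'a::group_add list \<Rightarrow> real"
  assumes fam: "lp_family p I \<alpha>" and g: "g \<in> test_functions d k" and k: "k \<ge> 1"
    and d: "proper_left_invariant_metric d"
  shows "functional p k g (collection_of I \<alpha>) = (\<Sum>\<^sub>\<infinity>i\<in>I. tuple_sum k g (\<lambda>x. \<alpha> i x powr p))"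
proof -
  let ?G = "\<lambda>f. tuple_sum k g (\<lambda>x. f x powr p)"
  have inv: "?G (\<lambda>x. f (- s + x)) = ?G f" for f s
    using g tuple_sum_shift[of k g "\<lambda>x. f x powr p" s] by (auto simp: test_functions_def)
  have zero: "?G (\<lambda>_. 0) = 0" using k by (simp add: tuple_sum_zero)
  obtain C where C: "C \<ge> 0" "\<And>xs. xs \<in> tuples k \<Longrightarrow> \<bar>g xs\<bar> \<le> C"
    using test_function_bounded[OF d g k] by blast
  have "((\<lambda>i. ?G (\<alpha> i)) has_sum (\<Sum>\<^sub>\<infinity>i\<in>I. ?G (\<alpha> i))) I"
    by (intro has_sum_infsum mass_family_summable[OF lp_familyD(3)[OF fam]
          mass_family_tuple_sum_le[OF lp_familyD(3)[OF fam] C(2) k] C(1)])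
  then have "((\<lambda>(c, j). ?G (rep c)) has_sum (\<Sum>\<^sub>\<infinity>i\<in>I. ?G (\<alpha> i))) (members (collection_of I \<alpha>))"
    by (rule has_sum_lp_family_members[OF fam, of ?G, OF inv zero, THEN iffD2])
  moreover have "?G (rep c) = (\<Sum>\<^sub>\<infinity>xs\<in>tuples k. g xs * (\<Prod>i<k. rep c (xs ! i) powr p))" for c
    unfolding tuple_sum_def
    by (rule infsum_cong) (simp add: tuples_def prod.list_conv_set_nth lessThan_atLeast0)
  ultimately show ?thesis by (simp add: functional_def infsumI case_prod_unfold)
qed

section \<open>Convergence in the metric on collections\<close>

context
  fixes d :: "'a::group_add \<Rightarrow> 'a \<Rightarrow> real" and k :: "nat \<Rightarrow> nat" and g :: "nat \<Rightarrow> 'a list \<Rightarrow> real"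
    and p :: real
  assumes d: "proper_left_invariant_metric d" and dense: "dense_test_sequence d k g" and p: "0 < p"
begin

lemma test_seq: "k r \<ge> 1" "g r \<in> test_functions d (k r)"
proof -
  have "k r \<ge> 2" using dense by (simp add: dense_test_sequence_def)
  then show "k r \<ge> 1" by simp
  show "g r \<in> test_functions d (k r)" using dense by (simp add: dense_test_sequence_def)
qed

lemma test_seq_le_SUP: "xs \<in> tuples (k r) \<Longrightarrow> \<bar>g r xs\<bar> \<le> (SUP xs\<in>tuples (k r). \<bar>g r xs\<bar>)"
proof -
  obtain C where C: "\<And>xs. xs \<in> tuples (k r) \<Longrightarrow> \<bar>g r xs\<bar> \<le> C"
    by (rule test_function_bounded[OF d test_seq(2) test_seq(1), of r], rule that)
  then have "bdd_above ((\<lambda>xs. \<bar>g r xs\<bar>) ` tuples (k r))" by (auto intro!: bdd_aboveI2)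
  then show "xs \<in> tuples (k r) \<Longrightarrow> \<bar>g r xs\<bar> \<le> (SUP xs\<in>tuples (k r). \<bar>g r xs\<bar>)"
    by (rule cSUP_upper[rotated])
qed

lemma test_seq_SUP_nonneg: "0 \<le> (SUP xs\<in>tuples (k r). \<bar>g r xs\<bar>)"
proof -
  have "replicate (k r) 0 \<in> tuples (k r)" by (simp add: tuples_def)
  from test_seq_le_SUP[OF this] show ?thesis using abs_ge_zero order_trans by blast
qed

lemma abs_functional_le:
  assumes "\<xi> \<in> X_space p"
  shows "\<bar>functional p (k r) (g r) \<xi>\<bar> \<le> (SUP xs\<in>tuples (k r). \<bar>g r xs\<bar>)"
proof (rule lp_family_of_X_space[OF assms p])
  fix I \<alpha> assume I: "\<xi> = collection_of I \<alpha>" "lp_family p I \<alpha>"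
  note A = lp_familyD(3)[OF I(2)]
  show ?thesis
    unfolding I(1) functional_eq_tuple_sum[OF I(2) test_seq(2) test_seq(1) d]
    by (rule mass_family_abs_infsum_le[OF A mass_family_tuple_sum_le[OF A test_seq_le_SUP test_seq(1)]
          test_seq_SUP_nonneg])
qed

lemma D_metric_terms:
  assumes "\<xi> \<in> X_space p" "\<xi>' \<in> X_space p"
  shows "0 \<le> (1 / 2) ^ Suc r / (1 + (SUP xs\<in>tuples (k r). \<bar>g r xs\<bar>)) *
        \<bar>functional p (k r) (g r) \<xi> - functional p (k r) (g r) \<xi>'\<bar>"
    and "(1 / 2) ^ Suc r / (1 + (SUP xs\<in>tuples (k r). \<bar>g r xs\<bar>)) *
        \<bar>functional p (k r) (g r) \<xi> - functional p (k r) (g r) \<xi>'\<bar> \<le> (1 / 2) ^ r"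
proof -
  let ?S = "SUP xs\<in>tuples (k r). \<bar>g r xs\<bar>" and ?F = "functional p (k r) (g r)"
  have S: "0 < 1 + ?S" using test_seq_SUP_nonneg[of r] by simp
  then show "0 \<le> (1 / 2) ^ Suc r / (1 + ?S) * \<bar>?F \<xi> - ?F \<xi>'\<bar>" by simp
  have "\<bar>?F \<xi> - ?F \<xi>'\<bar> \<le> 2 * (1 + ?S)"
    using abs_functional_le[OF assms(1), of r] abs_functional_le[OF assms(2), of r] by simp
  then have "(1 / 2) ^ Suc r / (1 + ?S) * \<bar>?F \<xi> - ?F \<xi>'\<bar> \<le> (1 / 2) ^ Suc r / (1 + ?S) * (2 * (1 + ?S))"
    using S by (intro mult_left_mono) auto
  also have "\<dots> = (1 / 2) ^ r" using S by simp
  finally show "(1 / 2) ^ Suc r / (1 + ?S) * \<bar>?F \<xi> - ?F \<xi>'\<bar> \<le> (1 / 2) ^ r" .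
qed

lemma summable_halves: "summable (\<lambda>r. (1 / 2 :: real) ^ r)"
  by (rule summable_geometric) simp

text \<open>The summands of the metric are dominated by a geometric series, which permits passing to the limit term by term.\<close>

lemma D_metric_tendsto_0_iff:
  assumes \<xi>s: "\<And>n. \<xi>s n \<in> X_space p" and \<xi>: "\<xi> \<in> X_space p"
  shows "(\<lambda>n. D_metric p k g (\<xi>s n) \<xi>) \<longlonglongrightarrow> 0 \<longleftrightarrow>
    (\<forall>r. (\<lambda>n. functional p (k r) (g r) (\<xi>s n)) \<longlonglongrightarrow> functional p (k r) (g r) \<xi>)"
proof
  let ?w = "\<lambda>r. (1 / 2) ^ Suc r / (1 + (SUP xs\<in>tuples (k r). \<bar>g r xs\<bar>))"
  let ?F = "\<lambda>r. functional p (k r) (g r)"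
  note T = D_metric_terms[OF \<xi>s \<xi>]
  {
    assume D: "(\<lambda>n. D_metric p k g (\<xi>s n) \<xi>) \<longlonglongrightarrow> 0"
    show "\<forall>r. (\<lambda>n. ?F r (\<xi>s n)) \<longlonglongrightarrow> ?F r \<xi>"
    proof
      fix r
      have w: "?w r > 0" using test_seq_SUP_nonneg[of r] by simp
      have "\<bar>?F r (\<xi>s n) - ?F r \<xi>\<bar> \<le> D_metric p k g (\<xi>s n) \<xi> / ?w r" for n
      proof -
        have s: "summable (\<lambda>r. ?w r * \<bar>?F r (\<xi>s n) - ?F r \<xi>\<bar>)"
          by (rule summable_comparison_test'[OF summable_halves, of 0])
            (use T in \<open>simp only: real_norm_def abs_of_nonneg\<close>)
        have "(\<Sum>r\<in>{r}. ?w r * \<bar>?F r (\<xi>s n) - ?F r \<xi>\<bar>) \<le> D_metric p k g (\<xi>s n) \<xi>"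
          unfolding D_metric_def by (rule sum_le_suminf[OF s]) (use T in auto)
        then have "?w r * \<bar>?F r (\<xi>s n) - ?F r \<xi>\<bar> \<le> D_metric p k g (\<xi>s n) \<xi>" by simp
        then show ?thesis using w by (simp only: pos_le_divide_eq mult.commute)
      qed
      then have "(\<lambda>n. ?F r (\<xi>s n) - ?F r \<xi>) \<longlonglongrightarrow> 0"
        by (intro Lim_null_comparison[OF always_eventually tendsto_divide_zero[OF D, of "?w r"]] allI)
          (simp only: real_norm_def)
      then show "(\<lambda>n. ?F r (\<xi>s n)) \<longlonglongrightarrow> ?F r \<xi>" by (rule LIM_zero_cancel)
    qed
  next
    assume F: "\<forall>r. (\<lambda>n. ?F r (\<xi>s n)) \<longlonglongrightarrow> ?F r \<xi>"
    have "(\<lambda>n. \<Sum>r. ?w r * \<bar>?F r (\<xi>s n) - ?F r \<xi>\<bar>) \<longlonglongrightarrow> (\<Sum>r. 0)"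
    proof (rule tannerys_theorem[THEN conjunct2, THEN conjunct2])
      show "(\<lambda>n. ?w r * \<bar>?F r (\<xi>s n) - ?F r \<xi>\<bar>) \<longlonglongrightarrow> 0" for r
      proof -
        have "(\<lambda>n. ?w r * \<bar>?F r (\<xi>s n) - ?F r \<xi>\<bar>) \<longlonglongrightarrow> ?w r * \<bar>?F r \<xi> - ?F r \<xi>\<bar>"
          using F by (intro tendsto_mult tendsto_const tendsto_rabs tendsto_diff) auto
        then show ?thesis by simp
      qed
      show "\<forall>\<^sub>F (r, n) in sequentially \<times>\<^sub>F sequentially.
          norm (?w r * \<bar>?F r (\<xi>s n) - ?F r \<xi>\<bar>) \<le> (1 / 2) ^ r"
        by (rule always_eventually) (use T in \<open>simp only: real_norm_def abs_of_nonneg split: prod.split, simp\<close>)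
      show "summable (\<lambda>r. (1 / 2 :: real) ^ r)" by (rule summable_halves)
    qed simp
    then show "(\<lambda>n. D_metric p k g (\<xi>s n) \<xi>) \<longlonglongrightarrow> 0" unfolding D_metric_def by simp
  }
qed

text \<open>The indicator function of a pattern is a test function, hence uniformly close to some \<open>g r\<close>.\<close>

lemma D_metric_limit_pattern_sums:
  assumes famn: "\<And>n. lp_family p (In n) (\<alpha>n n)" and fam: "lp_family p I \<alpha>"
    and D: "(\<lambda>n. D_metric p k g (collection_of (In n) (\<alpha>n n)) (collection_of I \<alpha>)) \<longlonglongrightarrow> 0"
    and ys: "length ys \<ge> 2" "hd ys = 0"
  shows "(\<lambda>n. \<Sum>\<^sub>\<infinity>i\<in>In n. pattern_sum ys (\<lambda>x. \<alpha>n n i x powr p)) \<longlonglongrightarrow>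
      (\<Sum>\<^sub>\<infinity>i\<in>I. pattern_sum ys (\<lambda>x. \<alpha> i x powr p))"
proof (rule LIMSEQ_if_approximated)
  fix e :: real assume "e > 0"
  let ?m = "length ys" and ?h = "\<lambda>xs. if pattern_of xs = ys then 1 else 0 :: real"
  have m: "?m \<ge> 1" "ys \<in> tuples ?m" using ys by (auto simp: tuples_def)
  obtain r where r: "k r = ?m" "\<And>xs. xs \<in> tuples ?m \<Longrightarrow> \<bar>g r xs - ?h xs\<bar> < e"
  proof -
    from dense[unfolded dense_test_sequence_def, THEN conjunct2, THEN spec, THEN mp, OF ys(1)]
    obtain \<sigma> :: "nat \<Rightarrow> nat" where \<sigma>: "strict_mono \<sigma> \<and> (\<forall>j. k (\<sigma> j) = ?m) \<and>
        (\<forall>h\<in>test_functions d ?m. \<forall>\<epsilon>>0. \<exists>j. \<forall>xs\<in>tuples ?m. \<bar>g (\<sigma> j) xs - h xs\<bar> < \<epsilon>)"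
      by (rule exE)
    from \<sigma>[THEN conjunct2, THEN conjunct2, rule_format, OF pattern_indicator_test_function[OF d] \<open>e > 0\<close>, of ys]
    obtain j where "\<forall>xs\<in>tuples ?m. \<bar>g (\<sigma> j) xs - ?h xs\<bar> < e" by (rule exE)
    then show ?thesis using that[of "\<sigma> j"] \<sigma> by simp
  qed
  obtain C where C: "C \<ge> 0" "\<And>xs. xs \<in> tuples ?m \<Longrightarrow> \<bar>g r xs\<bar> \<le> C"
    by (rule test_function_bounded[OF d test_seq(2) test_seq(1), of r], unfold r(1), rule that)
  have close: "\<bar>(\<Sum>\<^sub>\<infinity>i\<in>I'. pattern_sum ys (\<lambda>x. \<alpha>' i x powr p)) - functional p (k r) (g r) (collection_of I' \<alpha>')\<bar> \<le> e"
    if fam': "lp_family p I' \<alpha>'" for I' \<alpha>'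
  proof -
    note A = lp_familyD(3)[OF fam']
    have "\<bar>(\<Sum>\<^sub>\<infinity>i\<in>I'. tuple_sum ?m ?h (\<lambda>x. \<alpha>' i x powr p)) - (\<Sum>\<^sub>\<infinity>i\<in>I'. tuple_sum ?m (g r) (\<lambda>x. \<alpha>' i x powr p))\<bar> \<le> e"
      by (rule mass_family_tuple_sum_close[OF A _ m(1), of ?h "g r" e 1 C])
        (use r(2) C \<open>e > 0\<close> in \<open>auto simp: abs_minus_commute less_imp_le\<close>)
    moreover have "(\<Sum>\<^sub>\<infinity>i\<in>I'. tuple_sum ?m ?h (\<lambda>x. \<alpha>' i x powr p)) = (\<Sum>\<^sub>\<infinity>i\<in>I'. pattern_sum ys (\<lambda>x. \<alpha>' i x powr p))"
      by (rule infsum_cong) (simp add: mass_family_pattern_sum(1)[OF A m(2) ys(2) m(1)])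
    ultimately show ?thesis
      unfolding functional_eq_tuple_sum[OF fam' test_seq(2) test_seq(1) d] by (simp add: r(1))
  qed
  have "(\<lambda>n. functional p (k r) (g r) (collection_of (In n) (\<alpha>n n))) \<longlonglongrightarrow> functional p (k r) (g r) (collection_of I \<alpha>)"
    using D_metric_tendsto_0_iff[of "\<lambda>n. collection_of (In n) (\<alpha>n n)" "collection_of I \<alpha>"]
      X_space_if_lp_family[OF famn p] X_space_if_lp_family[OF fam p] D by simp
  then show "\<exists>A a. (\<forall>\<^sub>F n in sequentially. \<bar>(\<Sum>\<^sub>\<infinity>i\<in>In n. pattern_sum ys (\<lambda>x. \<alpha>n n i x powr p)) - A n\<bar> \<le> e) \<and>
      \<bar>(\<Sum>\<^sub>\<infinity>i\<in>I. pattern_sum ys (\<lambda>x. \<alpha> i x powr p)) - a\<bar> \<le> e \<and> A \<longlonglongrightarrow> a"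
    using close[OF famn] close[OF fam] by (intro exI conjI always_eventually allI)
qed

lemma D_metric_limit_if_pattern_sums_converge:
  assumes famn: "\<And>n. lp_family p (In n) (\<alpha>n n)" and fam: "lp_family p I \<alpha>"
    and conv: "\<And>ys. length ys \<ge> 2 \<Longrightarrow> hd ys = 0 \<Longrightarrow>
      (\<lambda>n. \<Sum>\<^sub>\<infinity>i\<in>In n. pattern_sum ys (\<lambda>x. \<alpha>n n i x powr p)) \<longlonglongrightarrow>
      (\<Sum>\<^sub>\<infinity>i\<in>I. pattern_sum ys (\<lambda>x. \<alpha> i x powr p))"
  shows "(\<lambda>n. D_metric p k g (collection_of (In n) (\<alpha>n n)) (collection_of I \<alpha>)) \<longlonglongrightarrow> 0"
proof -
  have "(\<lambda>n. functional p (k r) (g r) (collection_of (In n) (\<alpha>n n))) \<longlonglongrightarrow> functional p (k r) (g r) (collection_of I \<alpha>)" for r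
    unfolding functional_eq_tuple_sum[OF famn test_seq(2) test_seq(1) d]
      functional_eq_tuple_sum[OF fam test_seq(2) test_seq(1) d]
  proof (rule tuple_sums_converge_if_pattern_sums_converge[OF d test_seq(2) test_seq(1) lp_familyD(3)[OF famn] lp_familyD(3)[OF fam]])
    have "k r \<ge> 2" using dense by (simp add: dense_test_sequence_def)
    then show "(\<lambda>n. \<Sum>\<^sub>\<infinity>i\<in>In n. pattern_sum ys (\<lambda>x. \<alpha>n n i x powr p)) \<longlonglongrightarrow>
      (\<Sum>\<^sub>\<infinity>i\<in>I. pattern_sum ys (\<lambda>x. \<alpha> i x powr p))" if "ys \<in> tuples (k r)" "hd ys = 0" for ys
      using that by (intro conv) (auto simp: tuples_def)
  qed
  then show ?thesis
    using D_metric_tendsto_0_iff[of "\<lambda>n. collection_of (In n) (\<alpha>n n)" "collection_of I \<alpha>"]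
      X_space_if_lp_family[OF famn p] X_space_if_lp_family[OF fam p] by simp
qed

end

section \<open>Compactness\<close>

text \<open>At most \<open>N + 1\<close> points carry mass more than \<open>1 / (N + 1)\<close>.  The enumerations of these finite sets
  for all \<open>N\<close> are merged by \<^const>\<open>prod_encode\<close>; points may be listed repeatedly.  What
  matters is that the bound on the positions does not depend on \<open>\<mu>\<close>.\<close>

lemma large_values_enumeration:
  fixes \<mu> :: "'a \<Rightarrow> real"
  assumes nonneg: "\<And>t. 0 \<le> \<mu> t" and sum: "\<mu> summable_on UNIV" "infsum \<mu> UNIV \<le> 1"
  shows "\<exists>x :: nat \<Rightarrow> 'a. \<forall>N. {t. \<mu> t > 1 / real (Suc N)} \<subseteq> x ` {..\<Sum>l\<le>N. prod_encode (N, l)}"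
proof -
  let ?A = "\<lambda>N. {t. \<mu> t > 1 / real (Suc N)}"
  have card: "card F \<le> Suc N" if F: "finite F" "F \<subseteq> ?A N" for F N
  proof -
    have "real (card F) * (1 / real (Suc N)) = (\<Sum>t\<in>F. 1 / real (Suc N))" by simp
    also have "\<dots> \<le> sum \<mu> F" using F by (intro sum_mono) auto
    also have "\<dots> \<le> 1" using finite_sum_le_infsum[OF sum(1) F(1)] nonneg sum(2) by fastforce
    finally show ?thesis by (simp add: field_simps)
  qed
  have fin: "finite (?A N)" for N
  proof (rule ccontr)
    assume "infinite (?A N)"
    then obtain F where "F \<subseteq> ?A N" "card F = Suc (Suc N)" "finite F"
      using infinite_arbitrarily_large by metis
    then show False using card[of F N] by simp
  qed
  have "\<exists>e. ?A N \<subseteq> e ` {..N}" for N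
  proof -
    obtain e where e: "bij_betw e {0..<card (?A N)} (?A N)"
      using ex_bij_betw_nat_finite[OF fin] by blast
    have "{0..<card (?A N)} \<subseteq> {..N}" using card[OF fin subset_refl, of N] by auto
    then have "?A N \<subseteq> e ` {..N}" using bij_betw_imp_surj_on[OF e] by blast
    then show ?thesis by blast
  qed
  then obtain e where e: "\<And>N. ?A N \<subseteq> e N ` {..N}" by metis
  define x where "x j = (case prod_decode j of (N, l) \<Rightarrow> e N l)" for j
  have "?A N \<subseteq> x ` {..\<Sum>l\<le>N. prod_encode (N, l)}" for N
  proof
    fix t assume "t \<in> ?A N"
    then obtain l where l: "l \<le> N" "t = e N l" using e[of N] by auto
    have "prod_encode (N, l) \<le> (\<Sum>l\<le>N. prod_encode (N, l))"
      by (rule member_le_sum) (use l in auto)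
    moreover have "x (prod_encode (N, l)) = t" by (simp add: x_def l)
    ultimately show "t \<in> x ` {..\<Sum>l\<le>N. prod_encode (N, l)}" by force
  qed
  then show ?thesis by blast
qed

text \<open>\<open>B\<close> will be a translate of a measure, and the factor \<open>e\<close> bounds the measure off the finite set \<open>K\<close>.\<close>

lemma has_sum_tail_le:
  fixes Q B :: "'z \<Rightarrow> real"
  assumes Q: "(Q has_sum l) Z" and B: "(B has_sum b) Z" "b \<le> 1" and K: "finite K" "K \<subseteq> Z"
    and nonneg: "\<And>z. z \<in> Z \<Longrightarrow> 0 \<le> Q z" "\<And>z. z \<in> Z \<Longrightarrow> 0 \<le> B z"
    and le: "\<And>z. z \<in> Z - K \<Longrightarrow> Q z \<le> e * B z" and "e \<ge> 0"
  shows "\<bar>l - sum Q K\<bar> \<le> e"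
proof -
  have Q': "(Q has_sum l - sum Q K) (Z - K)"
    by (rule has_sum_Diff[OF Q _ K(2)]) (use K in auto)
  have B': "(B has_sum b - sum B K) (Z - K)"
    by (rule has_sum_Diff[OF B(1) _ K(2)]) (use K in auto)
  have "0 \<le> l - sum Q K" by (rule has_sum_nonneg[OF Q']) (use nonneg in auto)
  moreover have "l - sum Q K \<le> e * (b - sum B K)"
    by (rule has_sum_mono[OF Q' has_sum_cmult_right[OF B']]) (rule le)
  moreover have "e * (b - sum B K) \<le> e * 1"
    using B(2) sum_nonneg[of K B] nonneg(2) K(2) \<open>e \<ge> 0\<close> by (intro mult_left_mono) (auto simp: subset_iff)
  ultimately show ?thesis by simp
qed

lemma prod_list_le_first_two:
  fixes f :: "'a \<Rightarrow> real"
  assumes "\<And>x. 0 \<le> f x" "\<And>x. f x \<le> 1"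
  shows "prod_list (map f (x # y # zs)) \<le> f x * f y"
proof -
  have "0 \<le> prod_list (map f zs) \<and> prod_list (map f zs) \<le> 1"
    by (induction zs) (use assms in \<open>auto intro: mult_le_one\<close>)
  then have "f x * f y * prod_list (map f zs) \<le> f x * f y * 1"
    using assms by (intro mult_left_mono mult_nonneg_nonneg) auto
  then show ?thesis by (simp add: mult.assoc)
qed

text \<open>With this, the decisions in a diagonal argument can be treated as convergence of
  bounded sequences.\<close>

lemma of_bool_convergent_imp_eventually:
  assumes "(\<lambda>n. of_bool (P n) :: real) \<longlonglongrightarrow> l"
  shows "(\<forall>\<^sub>F n in sequentially. P n) \<or> (\<forall>\<^sub>F n in sequentially. \<not> P n)"
proof -
  have "Cauchy (\<lambda>n. of_bool (P n) :: real)" using assms by (rule LIMSEQ_imp_Cauchy)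
  then obtain N where N: "\<And>m n. m \<ge> N \<Longrightarrow> n \<ge> N \<Longrightarrow> norm (of_bool (P m) - of_bool (P n) :: real) < 1"
    using CauchyD[of _ 1] by force
  have "P n = P N" if "n \<ge> N" for n using N[OF that order_refl] by (auto split: if_splits simp: of_bool_def)
  then show ?thesis unfolding eventually_sequentially by (cases "P N") auto
qed

text \<open>The outcome of the diagonal argument.  The points \<open>y n i\<close> for \<open>i \<le> H N\<close> include all points of
  \<open>\<nu> n\<close>-mass more than \<open>1 / (N + 1)\<close>; the function \<open>\<beta> i\<close> is the limit of \<open>\<nu> n\<close> seen from \<open>y n i\<close>; and
  for each offset \<open>s\<close> it is decided whether \<open>y n j\<close> is at offset \<open>s\<close> from \<open>y n i\<close>.  Being at some fixed
  offset is an equivalence relation on indices, whose classes are the clusters.\<close>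

locale convergent_centres =
  fixes \<nu> :: "nat \<Rightarrow> 'a::group_add \<Rightarrow> real" and y :: "nat \<Rightarrow> nat \<Rightarrow> 'a" and H :: "nat \<Rightarrow> nat"
    and \<beta> :: "nat \<Rightarrow> 'a \<Rightarrow> real"
  assumes nonneg: "\<And>n t. 0 \<le> \<nu> n t"
    and summ: "\<And>n. \<nu> n summable_on UNIV" and le1: "\<And>n. infsum (\<nu> n) UNIV \<le> 1"
    and large: "\<And>n N. {t. \<nu> n t > 1 / real (Suc N)} \<subseteq> y n ` {..H N}"
    and lim: "\<And>i s. (\<lambda>n. \<nu> n (y n i + s)) \<longlonglongrightarrow> \<beta> i s"
    and decided: "\<And>i j s. (\<forall>\<^sub>F n in sequentially. y n j = y n i + s) \<or> (\<forall>\<^sub>F n in sequentially. y n j \<noteq> y n i + s)"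
begin

definition at_offset :: "nat \<Rightarrow> nat \<Rightarrow> 'a \<Rightarrow> bool" where
  "at_offset i j s \<longleftrightarrow> (\<forall>\<^sub>F n in sequentially. y n j = y n i + s)"

lemma not_at_offset: "\<not> at_offset i j s \<Longrightarrow> \<forall>\<^sub>F n in sequentially. y n j \<noteq> y n i + s"
  using decided[of j i s] by (auto simp: at_offset_def)

lemma at_offset_refl: "at_offset i i 0" by (simp add: at_offset_def)

lemma at_offset_sym: "at_offset i j s \<Longrightarrow> at_offset j i (- s)"
  unfolding at_offset_def by (erule eventually_mono) (simp add: add.assoc)

lemma at_offset_trans: "at_offset i j s \<Longrightarrow> at_offset j l t \<Longrightarrow> at_offset i l (s + t)"
  unfolding at_offset_def by (erule (1) eventually_elim2) (simp add: add.assoc)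

lemma at_offset_unique: "at_offset i j s \<Longrightarrow> at_offset i j s' \<Longrightarrow> s = s'"
proof -
  assume "at_offset i j s" "at_offset i j s'"
  then have "\<forall>\<^sub>F n in sequentially. s = s'"
    unfolding at_offset_def by (rule eventually_elim2) simp
  then show "s = s'" by simp
qed

text \<open>The least index of each cluster.\<close>

definition leaders :: "nat set" where
  "leaders = {i. \<forall>j s. at_offset j i s \<longrightarrow> i \<le> j}"

lemma leader_exists: obtains i s where "i \<in> leaders" "i \<le> j" "at_offset i j s"
proof -
  define i where "i = (LEAST i. \<exists>s. at_offset i j s)"
  have ex: "\<exists>s. at_offset i j s" unfolding i_def by (rule LeastI[of _ j]) (use at_offset_refl in blast)
  then obtain s where s: "at_offset i j s" by blast
  have least: "i \<le> j'" if "at_offset j' j s'" for j' s'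
    unfolding i_def by (rule Least_le) (use that in blast)
  have "i \<in> leaders"
    unfolding leaders_def using least at_offset_trans[OF _ s] by blast
  moreover have "i \<le> j" using least[OF at_offset_refl] .
  ultimately show ?thesis using that s by blast
qed

lemma leaders_disjoint:
  assumes "i \<in> leaders" "j \<in> leaders" "at_offset i j s"
  shows "i = j"
  using assms at_offset_sym[OF assms(3)] unfolding leaders_def by (intro antisym) blast+

abbreviation (input) site :: "nat \<Rightarrow> nat \<times> 'a \<Rightarrow> 'a" where
  "site n z \<equiv> y n (fst z) + snd z"

text \<open>Sites around different leaders cannot coincide for infinitely many \<open>n\<close>, as then the leaders would be
  at a fixed offset.\<close>

lemma eventually_site_neq:
  assumes "z \<in> leaders \<times> UNIV" "z' \<in> leaders \<times> UNIV" "z \<noteq> z'"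
  shows "\<forall>\<^sub>F n in sequentially. site n z \<noteq> site n z'"
proof (cases "fst z = fst z'")
  case True
  then have "site n z \<noteq> site n z'" for n using assms(3) by (auto simp: prod_eq_iff)
  then show ?thesis by simp
next
  case False
  then have "\<not> at_offset (fst z) (fst z') (snd z - snd z')"
    using leaders_disjoint[of "fst z" "fst z'"] assms(1,2) by (auto simp: mem_Times_iff)
  then have "\<forall>\<^sub>F n in sequentially. y n (fst z') \<noteq> y n (fst z) + (snd z - snd z')" by (rule not_at_offset)
  then show ?thesis
  proof eventually_elim
    case (elim n)
    show ?case
    proof
      assume "site n z = site n z'"
      then have "y n (fst z) + snd z - snd z' = y n (fst z')" by simp
      then show False using elim by (simp add: add_diff_eq)
    qed
  qed
qed

lemma eventually_site_inj:
  assumes "finite K" "K \<subseteq> leaders \<times> UNIV"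
  shows "\<forall>\<^sub>F n in sequentially. inj_on (site n) K"
proof -
  have "\<forall>\<^sub>F n in sequentially. \<forall>z\<in>K. \<forall>z'\<in>K. z \<noteq> z' \<longrightarrow> site n z \<noteq> site n z'"
  proof (intro eventually_ball_finite assms(1) ballI)
    fix z z' assume "z \<in> K" "z' \<in> K"
    then show "\<forall>\<^sub>F n in sequentially. z \<noteq> z' \<longrightarrow> site n z \<noteq> site n z'"
      using eventually_site_neq[of z z'] assms(2) by (cases "z = z'") auto
  qed
  then show ?thesis by (rule eventually_mono) (auto simp: inj_on_def)
qed

lemma beta_nonneg: "0 \<le> \<beta> i s"
  by (rule tendsto_lowerbound[OF lim]) (auto simp: nonneg)

lemma nu_le_1: "\<nu> n t \<le> 1"
  using finite_sum_le_infsum[OF summ, of "{t}" n] nonneg le1[of n] by simp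

lemma beta_le_1: "\<beta> i s \<le> 1"
  by (rule tendsto_upperbound[OF lim]) (auto simp: nu_le_1)

text \<open>Finitely many sites around leaders are eventually distinct, so that their \<open>\<nu> n\<close>-masses add up to
  at most \<open>1\<close>.\<close>

lemma sum_beta_le_1:
  assumes K: "finite K" "K \<subseteq> leaders \<times> UNIV"
  shows "(\<Sum>z\<in>K. \<beta> (fst z) (snd z)) \<le> 1"
proof (rule tendsto_upperbound)
  show "(\<lambda>n. \<Sum>z\<in>K. \<nu> n (site n z)) \<longlonglongrightarrow> (\<Sum>z\<in>K. \<beta> (fst z) (snd z))"
    by (intro tendsto_sum lim)
  show "\<forall>\<^sub>F n in sequentially. (\<Sum>z\<in>K. \<nu> n (site n z)) \<le> 1"
    using eventually_site_inj[OF K]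
  proof eventually_elim
    case (elim n)
    have "(\<Sum>z\<in>K. \<nu> n (site n z)) = sum (\<nu> n) (site n ` K)" using elim by (simp add: sum.reindex)
    also have "\<dots> \<le> infsum (\<nu> n) UNIV"
      by (rule finite_sum_le_infsum[OF summ]) (use K nonneg in auto)
    finally show ?case using le1[of n] by simp
  qed
qed simp

lemma beta_has_sum:
  obtains b where "((\<lambda>z. \<beta> (fst z) (snd z)) has_sum b) (leaders \<times> UNIV)" "b \<le> 1"
proof -
  let ?B = "\<lambda>z. \<beta> (fst z) (snd z)"
  have s: "?B summable_on (leaders \<times> UNIV)"
    by (rule nonneg_bdd_above_summable_on)
      (auto intro!: bdd_aboveI2[where M = 1] sum_beta_le_1 simp: beta_nonneg)
  moreover have "infsum ?B (leaders \<times> UNIV) \<le> 1"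
    by (rule infsum_le_finite_sums[OF s]) (rule sum_beta_le_1)
  ultimately show ?thesis using that[of "infsum ?B (leaders \<times> UNIV)"] by simp
qed

lemma mass_family_beta: "mass_family leaders \<beta>"
proof -
  obtain b where b: "((\<lambda>z. \<beta> (fst z) (snd z)) has_sum b) (leaders \<times> UNIV)" "b \<le> 1"
    by (rule beta_has_sum)
  then have s: "(\<lambda>(i, s). \<beta> i s) summable_on (leaders \<times> UNIV)"
    by (auto simp: case_prod_unfold summable_on_def)
  have "(\<Sum>\<^sub>\<infinity>i\<in>leaders. infsum (\<beta> i) UNIV) = b"
    using infsum_Sigma'_banach[OF s] infsumI[OF b(1)] by (simp add: case_prod_unfold)
  then show ?thesis
    unfolding mass_family_def
    using b(2) summable_on_Sigma_banach[OF s] summable_on_SigmaD1[OF s] beta_nonneg by auto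
qed

text \<open>The site \<open>y n i + s\<close> eventually has large mass, so it is one of the listed points
  \<open>y n j\<close> with \<open>j \<le> H N\<close>.  There are only finitely many such \<open>j\<close>, so one of them is at offset \<open>s\<close> from \<open>i\<close>.\<close>

lemma large_beta_at_offset:
  assumes i: "i \<in> leaders" and s: "\<beta> i s > 1 / real (Suc N)"
  obtains j where "j \<le> H N" "i \<le> j" "at_offset i j s"
proof -
  have "\<forall>\<^sub>F n in sequentially. \<nu> n (y n i + s) > 1 / real (Suc N)"
    by (rule order_tendstoD(1)[OF lim s])
  then have ev: "\<forall>\<^sub>F n in sequentially. \<exists>j\<in>{..H N}. y n j = y n i + s"
  proof (rule eventually_mono)
    fix n assume "\<nu> n (y n i + s) > 1 / real (Suc N)"
    then have "y n i + s \<in> y n ` {..H N}" by (intro subsetD[OF large]) simp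
    then show "\<exists>j\<in>{..H N}. y n j = y n i + s" by force
  qed
  have "\<exists>j\<in>{..H N}. at_offset i j s"
  proof (rule ccontr)
    assume "\<not> ?thesis"
    then have "\<forall>\<^sub>F n in sequentially. \<forall>j\<in>{..H N}. y n j \<noteq> y n i + s"
      by (intro eventually_ball_finite) (auto intro: not_at_offset)
    with ev have "\<forall>\<^sub>F n in sequentially. False" by eventually_elim blast
    then show False by simp
  qed
  then obtain j where j: "j \<le> H N" "at_offset i j s" by auto
  moreover have "i \<le> j" using i at_offset_sym[OF j(2)] unfolding leaders_def by blast
  ultimately show ?thesis using that by blast
qed

text \<open>The sites around leaders that are occupied by one of the first points of the list.\<close>

definition core :: "nat \<Rightarrow> (nat \<times> 'a) set" where
  "core N = {(i, s). i \<in> leaders \<and> (\<exists>j\<le>H N. i \<le> j \<and> at_offset i j s)}"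

lemma finite_core: "finite (core N)"
proof (rule finite_subset)
  show "core N \<subseteq> (\<lambda>(i, j). (i, THE s. at_offset i j s)) ` ({..H N} \<times> {..H N})"
  proof
    fix z assume "z \<in> core N"
    then obtain i s j where z: "z = (i, s)" "j \<le> H N" "i \<le> j" "at_offset i j s" by (auto simp: core_def)
    have "(THE s. at_offset i j s) = s" using z(4) at_offset_unique by blast
    then show "z \<in> (\<lambda>(i, j). (i, THE s. at_offset i j s)) ` ({..H N} \<times> {..H N})"
      using z by (intro image_eqI[of _ _ "(i, j)"]) auto
  qed
qed simp

lemma eventually_core_site: "\<forall>\<^sub>F n in sequentially. y n ` {..H N} \<subseteq> site n ` core N"
proof -
  have "\<forall>\<^sub>F n in sequentially. y n j \<in> site n ` core N" if "j \<in> {..H N}" for j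
  proof -
    obtain i s where i: "i \<in> leaders" "i \<le> j" "at_offset i j s" by (rule leader_exists)
    then have c: "(i, s) \<in> core N" using that by (auto simp: core_def)
    have "\<forall>\<^sub>F n in sequentially. y n j = y n i + s" using i(3) by (simp add: at_offset_def)
    then show ?thesis
      by (rule eventually_mono) (use c in \<open>auto intro!: image_eqI[of _ _ "(i, s)"]\<close>)
  qed
  then have "\<forall>\<^sub>F n in sequentially. \<forall>j\<in>{..H N}. y n j \<in> site n ` core N"
    by (intro eventually_ball_finite) auto
  then show ?thesis by (rule eventually_mono) blast
qed

text \<open>Both the pattern sum of \<open>\<nu> n\<close> and its limit are approximated by the finite sums over the core,
  which converge.  A point outside the core has mass at most \<open>e\<close>, and as a pattern has a second point \<open>w\<close>, the
  remaining terms are at most \<open>e\<close> times the mass at \<open>t + w\<close>.\<close>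

lemma pattern_sum_converges:
  assumes ys: "length ys \<ge> 2" "hd ys = 0"
  shows "(\<lambda>n. pattern_sum ys (\<nu> n)) \<longlonglongrightarrow> (\<Sum>\<^sub>\<infinity>i\<in>leaders. pattern_sum ys (\<beta> i))"
proof (rule LIMSEQ_if_approximated)
  fix e :: real assume "e > 0"
  then obtain N where "inverse (real (Suc N)) < e" using reals_Archimedean by blast
  then have N: "1 / real (Suc N) \<le> e" by (simp add: inverse_eq_divide)
  obtain w zs where ys_eq: "ys = 0 # w # zs"
    using ys by (cases ys; cases "tl ys") auto
  have tup: "ys \<in> tuples (length ys)" "length ys \<ge> 1" using ys by (auto simp: tuples_def)
  let ?q = "\<lambda>\<mu> t. prod_list (map (\<lambda>y. \<mu> (t + y)) ys)"
  let ?Q = "\<lambda>z. ?q (\<beta> (fst z)) (snd z)"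
  have q_le: "?q \<mu> t \<le> \<mu> t * \<mu> (t + w)" if "\<And>x. 0 \<le> \<mu> x" "\<And>x. \<mu> x \<le> 1" for \<mu> :: "'a \<Rightarrow> real" and t
    unfolding ys_eq using prod_list_le_first_two[of "\<lambda>y. \<mu> (t + y)" 0 w zs] that by simp
  have small: "?q \<mu> t \<le> e * \<mu> (t + w)"
    if "\<And>x. 0 \<le> \<mu> x" "\<And>x. \<mu> x \<le> 1" "\<not> \<mu> t > 1 / real (Suc N)" for \<mu> :: "'a \<Rightarrow> real" and t
  proof -
    have "?q \<mu> t \<le> \<mu> t * \<mu> (t + w)" by (rule q_le[OF that(1,2)])
    also have "\<dots> \<le> e * \<mu> (t + w)" using that N by (intro mult_right_mono) auto
    finally show ?thesis .
  qed
  have q_nonneg: "0 \<le> ?q \<mu> t" if "\<And>x. 0 \<le> \<mu> x" for \<mu> :: "'a \<Rightarrow> real" and t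
    by (rule prod_list_map_nonneg) (rule that)
  define A where "A n = (\<Sum>z\<in>core N. ?q (\<nu> n) (site n z))" for n
  have core: "core N \<subseteq> leaders \<times> UNIV" by (auto simp: core_def)
  have "A \<longlonglongrightarrow> (\<Sum>z\<in>core N. ?Q z)"
  proof -
    have "(\<lambda>n. ?q (\<nu> n) (site n z)) \<longlonglongrightarrow> ?Q z" for z
    proof -
      have "(\<lambda>n. prod_list (map (\<lambda>y'. \<nu> n (y n (fst z) + (snd z + y'))) us))
          \<longlonglongrightarrow> prod_list (map (\<lambda>y'. \<beta> (fst z) (snd z + y')) us)" for us
        by (induction us) (auto intro!: tendsto_mult lim)
      then show ?thesis by (simp add: add.assoc)
    qed
    then show ?thesis unfolding A_def by (intro tendsto_sum)
  qed
  moreover have "\<forall>\<^sub>F n in sequentially. \<bar>pattern_sum ys (\<nu> n) - A n\<bar> \<le> e"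
    using eventually_site_inj[OF finite_core core] eventually_core_site[of N]
  proof eventually_elim
    case (elim n)
    have "A n = sum (?q (\<nu> n)) (site n ` core N)"
      unfolding A_def using elim(1) by (simp add: sum.reindex)
    moreover have "\<bar>pattern_sum ys (\<nu> n) - sum (?q (\<nu> n)) (site n ` core N)\<bar> \<le> e"
    proof (rule has_sum_tail_le)
      show "(?q (\<nu> n) has_sum pattern_sum ys (\<nu> n)) UNIV"
        unfolding pattern_sum_def
        by (rule has_sum_infsum[OF pattern_sum_summable[OF nonneg has_sum_infsum[OF summ] tup(1) ys(2) tup(2)]])
      show "((\<lambda>t. \<nu> n (t + w)) has_sum infsum (\<nu> n) UNIV) UNIV"
        by (subst has_sum_reindex_bij_betw[OF bij_add_right]) (rule has_sum_infsum[OF summ])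
      show "?q (\<nu> n) t \<le> e * \<nu> n (t + w)" if "t \<in> UNIV - site n ` core N" for t
      proof (rule small[OF nonneg nu_le_1 notI])
        assume "\<nu> n t > 1 / real (Suc N)"
        then have "t \<in> y n ` {..H N}" by (intro subsetD[OF large]) simp
        then have "t \<in> site n ` core N" by (rule subsetD[OF elim(2)])
        then show False using that by simp
      qed
    qed (use finite_core \<open>e > 0\<close> le1 nonneg q_nonneg[OF nonneg] in auto)
    ultimately show ?case by simp
  qed
  moreover have "\<bar>(\<Sum>\<^sub>\<infinity>i\<in>leaders. pattern_sum ys (\<beta> i)) - (\<Sum>z\<in>core N. ?Q z)\<bar> \<le> e"
  proof -
    note fam = mass_family_beta
    have inner: "((\<lambda>s. ?q (\<beta> i) s) has_sum pattern_sum ys (\<beta> i)) UNIV" if "i \<in> leaders" for i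
      unfolding pattern_sum_def
      by (rule has_sum_infsum[OF pattern_sum_summable[OF mass_family_nonneg[OF fam that]
              mass_family_has_sum[OF fam that] tup(1) ys(2) tup(2)]])
    have outer: "(\<lambda>i. pattern_sum ys (\<beta> i)) summable_on leaders"
      by (rule mass_family_pattern_sum(2)[OF fam tup(1) ys(2) tup(2)])
    have "(\<lambda>z. ?Q z) summable_on (leaders \<times> UNIV)"
      by (rule summable_on_SigmaI[OF _ outer]) (use inner q_nonneg[OF beta_nonneg] in auto)
    then have Q: "(?Q has_sum (\<Sum>\<^sub>\<infinity>i\<in>leaders. pattern_sum ys (\<beta> i))) (leaders \<times> UNIV)"
      by (intro has_sum_SigmaI[OF _ has_sum_infsum[OF outer]]) (use inner in auto)
    obtain b where b: "((\<lambda>z. \<beta> (fst z) (snd z)) has_sum b) (leaders \<times> UNIV)" "b \<le> 1"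
      by (rule beta_has_sum)
    have bij: "bij_betw (\<lambda>z. (fst z, snd z + w)) (leaders \<times> UNIV) (leaders \<times> UNIV)"
      by (rule bij_betwI[where g = "\<lambda>z. (fst z, snd z - w)"]) auto
    have B: "((\<lambda>z. \<beta> (fst z) (snd z + w)) has_sum b) (leaders \<times> UNIV)"
      using has_sum_reindex_bij_betw[OF bij, of "\<lambda>z. \<beta> (fst z) (snd z)" b] b(1) by simp
    show ?thesis
    proof (rule has_sum_tail_le[OF Q B b(2) finite_core core])
      fix z assume z: "z \<in> leaders \<times> UNIV - core N"
      have "\<not> \<beta> (fst z) (snd z) > 1 / real (Suc N)"
      proof
        assume "\<beta> (fst z) (snd z) > 1 / real (Suc N)"
        then obtain j where "j \<le> H N" "fst z \<le> j" "at_offset (fst z) j (snd z)"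
          using z by (elim large_beta_at_offset[rotated]) auto
        then have "z \<in> core N" using z by (auto simp: core_def case_prod_unfold)
        then show False using z by simp
      qed
      then show "?Q z \<le> e * \<beta> (fst z) (snd z + w)" by (rule small[OF beta_nonneg beta_le_1])
    qed (use \<open>e > 0\<close> beta_nonneg q_nonneg[OF beta_nonneg] in auto)
  qed
  ultimately show "\<exists>A a. (\<forall>\<^sub>F n in sequentially. \<bar>pattern_sum ys (\<nu> n) - A n\<bar> \<le> e) \<and>
      \<bar>(\<Sum>\<^sub>\<infinity>i\<in>leaders. pattern_sum ys (\<beta> i)) - a\<bar> \<le> e \<and> A \<longlonglongrightarrow> a"
    by (intro exI conjI)
qed

end

text \<open>The masses at given offsets from the listed points, and the indicators of the
  events that two listed points are at a given offset, form countably many bounded sequences.\<close>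

lemma pattern_sums_compactness:
  fixes \<mu> :: "nat \<Rightarrow> 'a::{group_add, countable} \<Rightarrow> real"
  assumes nonneg: "\<And>n t. 0 \<le> \<mu> n t" and summ: "\<And>n. \<mu> n summable_on UNIV"
    and le1: "\<And>n. infsum (\<mu> n) UNIV \<le> 1"
  obtains \<sigma> I \<beta> where "strict_mono \<sigma>" "mass_family I \<beta>"
    "\<And>i x. 0 \<le> \<beta> i x \<and> \<beta> i x \<le> 1"
    "\<And>ys. length ys \<ge> 2 \<Longrightarrow> hd ys = 0 \<Longrightarrow>
      (\<lambda>n. pattern_sum ys (\<mu> (\<sigma> n))) \<longlonglongrightarrow> (\<Sum>\<^sub>\<infinity>i\<in>I. pattern_sum ys (\<beta> i))"
proof -
  let ?H = "\<lambda>N. \<Sum>l\<le>N. prod_encode (N, l)"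
  have "\<forall>n. \<exists>x :: nat \<Rightarrow> 'a. \<forall>N. {t. \<mu> n t > 1 / real (Suc N)} \<subseteq> x ` {..?H N}"
    by (intro allI large_values_enumeration nonneg summ le1)
  from choice[OF this] obtain x :: "nat \<Rightarrow> nat \<Rightarrow> 'a"
    where x: "\<forall>n N. {t. \<mu> n t > 1 / real (Suc N)} \<subseteq> x n ` {..?H N}" by (rule exE)
  define f :: "nat \<Rightarrow> (nat \<times> 'a) + (nat \<times> nat \<times> 'a) \<Rightarrow> real" where
    "f n z = (case z of Inl (i, s) \<Rightarrow> \<mu> n (x n i + s) | Inr (i, j, s) \<Rightarrow> of_bool (x n j = x n i + s))" for n z
  have \<mu>_le_1: "\<mu> n t \<le> 1" for n t
    using finite_sum_le_infsum[OF summ, of "{t}" n] nonneg le1[of n] by simp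
  have norm: "norm (f n z) \<le> 1" for n z
    using nonneg \<mu>_le_1 by (auto simp: f_def split: sum.split prod.split)
  obtain \<sigma> where \<sigma>: "strict_mono \<sigma>" "\<And>z. z \<in> UNIV \<Longrightarrow> \<exists>l. (\<lambda>n. f (\<sigma> n) z) \<longlonglongrightarrow> l"
    by (rule function_convergent_subsequence[of UNIV f 1, OF countableI_type norm], rule that)
  define \<beta> where "\<beta> i s = lim (\<lambda>n. f (\<sigma> n) (Inl (i, s)))" for i s
  interpret convergent_centres "\<lambda>n. \<mu> (\<sigma> n)" "\<lambda>n. x (\<sigma> n)" ?H \<beta>
  proof
    show "(\<lambda>n. \<mu> (\<sigma> n) (x (\<sigma> n) i + s)) \<longlonglongrightarrow> \<beta> i s" for i s
      using \<sigma>(2)[OF UNIV_I, of "Inl (i, s)"] convergent_LIMSEQ_iff[of "\<lambda>n. f (\<sigma> n) (Inl (i, s))"]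
      unfolding \<beta>_def by (auto simp: convergent_def f_def)
    show "(\<forall>\<^sub>F n in sequentially. x (\<sigma> n) j = x (\<sigma> n) i + s) \<or>
        (\<forall>\<^sub>F n in sequentially. x (\<sigma> n) j \<noteq> x (\<sigma> n) i + s)" for i j s
      using \<sigma>(2)[OF UNIV_I, of "Inr (i, j, s)"] by (auto simp: f_def dest: of_bool_convergent_imp_eventually)
  qed (use nonneg summ le1 x in auto)
  show ?thesis
    by (rule that[OF \<sigma>(1) mass_family_beta _ pattern_sum_converges]) (simp_all add: beta_nonneg beta_le_1)
qed

section \<open>Decompositions and limit points\<close>

lemma Phi_shift: "Phi (\<lambda>x. f (- s + x)) r = Phi f r"
  unfolding Phi_def
  using infsum_reindex_bij_betw[OF bij_add_left[of "- s"], of "\<lambda>t. f t * cnj (f (t + r))"]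
  by (simp add: add.assoc)

lemma M_Phi_shift: "M_Phi \<iota> (\<lambda>x. f (- s + x)) = M_Phi \<iota> f"
proof -
  have "Phi (\<lambda>x. complex_of_real (f (- s + x))) = Phi (\<lambda>x. complex_of_real (f x))"
    by (rule ext) (rule Phi_shift[of "\<lambda>x. complex_of_real (f x)"])
  then show ?thesis by (simp add: M_Phi_def)
qed

lemma Phi_eq_autocorrelation:
  assumes "(\<lambda>x. (f x)\<^sup>2) summable_on UNIV"
  shows "Phi (\<lambda>x. complex_of_real (f x)) = (\<lambda>s. of_real (autocorrelation f s))"
  by (rule ext) (simp add: Phi_of_real[OF assms] autocorrelation_def)

lemma autocorrelation_0: "autocorrelation f 0 = (\<Sum>\<^sub>\<infinity>x. (f x)\<^sup>2)"
  by (simp add: autocorrelation_def power2_eq_square)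

context multiplier_algebra
begin

context
  fixes p :: real and I :: "nat set" and \<alpha> :: "nat \<Rightarrow> 'a \<Rightarrow> real"
  assumes p: "0 < p" "p \<le> 2" and fam: "lp_family p I \<alpha>"
begin

lemma norm_M_Phi_lp_family: "i \<in> I \<Longrightarrow> norm (M_Phi \<iota> (\<alpha> i)) = autocorrelation (\<alpha> i) 0"
  by (simp add: norm_M_Phi[OF lp_family_square_summable[OF fam p]] autocorrelation_0)

lemma norm_M_Phi_summable: "(\<lambda>i. norm (M_Phi \<iota> (\<alpha> i))) summable_on I"
  using lp_family_autocorrelation_summable[OF fam p, of 0]
  by (rule summable_on_cong[THEN iffD1, rotated]) (simp add: norm_M_Phi_lp_family)

lemma
  shows M_coll_convergent_lp_family: "M_coll_convergent \<iota> (collection_of I \<alpha>)"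
    and M_coll_has_sum: "((\<lambda>i. M_Phi \<iota> (\<alpha> i)) has_sum M_coll \<iota> (collection_of I \<alpha>)) I"
proof -
  have zero: "M_Phi \<iota> (\<lambda>_. 0) = 0" using norm_M_Phi[of "\<lambda>_. 0"] by simp
  note tr = has_sum_lp_family_members[OF fam, of "M_Phi \<iota>", OF M_Phi_shift zero]
  have "((\<lambda>i. M_Phi \<iota> (\<alpha> i)) has_sum (\<Sum>\<^sub>\<infinity>i\<in>I. M_Phi \<iota> (\<alpha> i))) I"
    by (rule has_sum_infsum[OF abs_summable_summable[OF norm_M_Phi_summable]])
  then have h: "((\<lambda>(c, j). M_Phi \<iota> (rep c)) has_sum (\<Sum>\<^sub>\<infinity>i\<in>I. M_Phi \<iota> (\<alpha> i))) (members (collection_of I \<alpha>))"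
    by (rule tr[THEN iffD2])
  then show "M_coll_convergent \<iota> (collection_of I \<alpha>)"
    unfolding M_coll_convergent_def by (rule has_sum_imp_summable)
  have "M_coll \<iota> (collection_of I \<alpha>) = (\<Sum>\<^sub>\<infinity>i\<in>I. M_Phi \<iota> (\<alpha> i))"
    unfolding M_coll_def by (rule infsumI[OF h])
  then show "((\<lambda>i. M_Phi \<iota> (\<alpha> i)) has_sum M_coll \<iota> (collection_of I \<alpha>)) I"
    using has_sum_infsum[OF abs_summable_summable[OF norm_M_Phi_summable]] by simp
qed

text \<open>Matrix coefficients depend continuously on the multiplier, so symbols may be summed.\<close>

lemma has_symbol_M_coll:
  "has_symbol (M_coll \<iota> (collection_of I \<alpha>)) (\<lambda>s. of_real (\<Sum>\<^sub>\<infinity>i\<in>I. autocorrelation (\<alpha> i) s))"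
proof (rule has_symbol_has_sum[OF M_coll_has_sum])
  show "has_symbol (M_Phi \<iota> (\<alpha> i)) (\<lambda>s. of_real (autocorrelation (\<alpha> i) s))" if "i \<in> I" for i
    using has_symbol_M_Phi[OF lp_family_square_summable[OF fam p that]]
    unfolding Phi_eq_autocorrelation[OF lp_family_square_summable[OF fam p that]] .
  show "((\<lambda>i. complex_of_real (autocorrelation (\<alpha> i) s)) has_sum
      of_real (\<Sum>\<^sub>\<infinity>i\<in>I. autocorrelation (\<alpha> i) s)) I" for s
    by (rule has_sum_of_real[OF has_sum_infsum[OF lp_family_autocorrelation_summable[OF fam p]]])
qed

end

end

lemma lp_family_single:
  assumes "f \<in> Mp p" "0 < p"
  shows "lp_family p {0} (\<lambda>_. f)"
proof -
  have f: "\<And>x. 0 \<le> f x" "\<And>x. f x \<le> 1" "(\<lambda>x. f x powr p) summable_on UNIV"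
    "(\<Sum>\<^sub>\<infinity>x. f x powr p) powr (1 / p) = 1"
    using assms(1) by (auto simp: Mp_def lp_norm_def image_subset_iff)
  have "(\<Sum>\<^sub>\<infinity>x. f x powr p) = ((\<Sum>\<^sub>\<infinity>x. f x powr p) powr (1 / p)) powr p"
    using assms(2) by (simp add: powr_powr infsum_nonneg)
  then have "(\<Sum>\<^sub>\<infinity>x. f x powr p) = 1" by (simp add: f(4))
  then show ?thesis using f by (simp add: lp_family_def mass_family_def)
qed

context
  fixes d :: "'a::{group_add, countable} \<Rightarrow> 'a \<Rightarrow> real"
    and k :: "nat \<Rightarrow> nat" and g :: "nat \<Rightarrow> 'a list \<Rightarrow> real"
    and p :: real and f :: "nat \<Rightarrow> 'a \<Rightarrow> real"
  assumes d: "proper_left_invariant_metric d" and dense: "dense_test_sequence d k g"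
    and p: "0 < p" "p < 2" and f: "\<And>n. f n \<in> Mp p"
begin

abbreviation (input) "D \<equiv> D_metric p k g"
abbreviation (input) "limit_points \<equiv> X_limit_points p k g (\<lambda>n. single (f n))"

lemma p_le_2: "p \<le> 2" using p by simp

lemma fam_f: "lp_family p {0} (\<lambda>_. f n)"
  by (rule lp_family_single[OF f p(1)])

lemma square_summable_f: "(\<lambda>x. (f n x)\<^sup>2) summable_on UNIV"
  using lp_family_square_summable[OF fam_f[of n] p(1) p_le_2, of 0] by simp

lemma single_in_X_space: "single (f n) \<in> X_space p"
  unfolding single_def by (rule X_space_if_lp_family[OF fam_f p(1)])

lemma D_nonneg:
  assumes "\<xi> \<in> X_space p"
  shows "0 \<le> D (single (f n)) \<xi>"
proof -
  note T = D_metric_terms[OF d dense p(1) single_in_X_space assms]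
  show ?thesis
    unfolding D_metric_def
    by (intro suminf_nonneg summable_comparison_test'[OF summable_halves[OF d dense p(1)], of 0])
      (use T in \<open>simp_all only: real_norm_def abs_of_nonneg\<close>)
qed

lemma subsequence_to_limit_point:
  assumes "\<xi> \<in> limit_points"
  obtains \<sigma> :: "nat \<Rightarrow> nat" where "strict_mono \<sigma>" "(\<lambda>n. D (single (f (\<sigma> n))) \<xi>) \<longlonglongrightarrow> 0"
proof -
  have X: "\<xi> \<in> X_space p" using assms by (simp add: X_limit_points_def)
  have freq: "\<exists>\<^sub>\<infinity>m. D (single (f m)) \<xi> < inverse (real (Suc n))" for n
    using assms by (simp add: X_limit_points_def)
  obtain \<sigma> :: "nat \<Rightarrow> nat" where \<sigma>: "strict_mono \<sigma>" "\<And>n. D (single (f (\<sigma> n))) \<xi> < inverse (real (Suc n))"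
    by (rule strict_mono_subsequence_frequently[OF freq], rule that)
  have "(\<lambda>n. D (single (f (\<sigma> n))) \<xi>) \<longlonglongrightarrow> 0"
    by (rule tendsto_sandwich[OF _ _ tendsto_const LIMSEQ_inverse_real_of_nat])
      (intro always_eventually allI D_nonneg[OF X] less_imp_le[OF \<sigma>(2)])+
  then show ?thesis using that \<sigma>(1) by blast
qed

lemma limit_point_if_subsequence:
  fixes \<sigma> :: "nat \<Rightarrow> nat"
  assumes "strict_mono \<sigma>" "\<xi> \<in> X_space p" "(\<lambda>n. D (single (f (\<sigma> n))) \<xi>) \<longlonglongrightarrow> 0"
  shows "\<xi> \<in> limit_points"
  unfolding X_limit_points_def
proof (intro CollectI conjI allI impI assms(2))
  fix \<epsilon> :: real assume "\<epsilon> > 0"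
  then have "\<forall>\<^sub>F n in sequentially. D (single (f (\<sigma> n))) \<xi> < \<epsilon>"
    by (rule order_tendstoD(2)[OF assms(3)])
  then obtain N where N: "\<And>n. n \<ge> N \<Longrightarrow> D (single (f (\<sigma> n))) \<xi> < \<epsilon>"
    by (auto simp: eventually_sequentially)
  show "\<exists>\<^sub>\<infinity>n. D (single (f n)) \<xi> < \<epsilon>"
    unfolding INFM_nat
  proof
    fix m
    have "m < \<sigma> (Suc (max m N))"
      using seq_suble[OF assms(1), of "Suc (max m N)"] by simp
    then show "\<exists>n>m. D (single (f n)) \<xi> < \<epsilon>" using N[of "Suc (max m N)"] by auto
  qed
qed

text \<open>Relative sequential compactness of the orbits in the space of collections.\<close>

lemma subsequence_converges_in_X_space:
  fixes \<sigma> :: "nat \<Rightarrow> nat"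
  obtains \<tau> I \<alpha> where "strict_mono \<tau>" "lp_family p I \<alpha>"
    "(\<lambda>n. D (single (f (\<sigma> (\<tau> n)))) (collection_of I \<alpha>)) \<longlonglongrightarrow> 0"
proof -
  let ?\<mu> = "\<lambda>n x. f (\<sigma> n) x powr p"
  note mf = lp_familyD(3)[OF fam_f]
  have s: "?\<mu> n summable_on UNIV" "infsum (?\<mu> n) UNIV \<le> 1" for n
    using mf[of "\<sigma> n"] by (auto simp: mass_family_def)
  obtain \<tau> I \<beta> where \<tau>: "strict_mono \<tau>" "mass_family I \<beta>" "\<And>i x. 0 \<le> \<beta> i x \<and> \<beta> i x \<le> 1"
    "\<And>ys. length ys \<ge> 2 \<Longrightarrow> hd ys = 0 \<Longrightarrow>
      (\<lambda>n. pattern_sum ys (?\<mu> (\<tau> n))) \<longlonglongrightarrow> (\<Sum>\<^sub>\<infinity>i\<in>I. pattern_sum ys (\<beta> i))"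
    by (rule pattern_sums_compactness[of ?\<mu>, OF _ s], simp, rule that)
  \<comment> \<open>The limits are measures, that is, \<open>p\<close>-th powers of the functions sought.\<close>
  define \<alpha> where "\<alpha> i x = \<beta> i x powr (1 / p)" for i x
  have \<alpha>: "\<alpha> i x powr p = \<beta> i x" for i x using \<tau>(3)[of i x] p by (simp add: \<alpha>_def powr_powr)
  have "lp_family p I \<alpha>"
    unfolding lp_family_def \<alpha> using \<tau>(2,3) p by (auto simp: \<alpha>_def intro!: powr_le1)
  moreover have "(\<lambda>n. D (single (f (\<sigma> (\<tau> n)))) (collection_of I \<alpha>)) \<longlonglongrightarrow> 0"
    unfolding single_def
    by (rule D_metric_limit_if_pattern_sums_converge[OF d dense p(1) fam_f \<open>lp_family p I \<alpha>\<close>])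
      (use \<tau>(4) in \<open>simp add: \<alpha>\<close>)
  ultimately show ?thesis using that \<tau>(1) by blast
qed

lemma autocorrelations_converge:
  fixes \<sigma> :: "nat \<Rightarrow> nat"
  assumes "lp_family p I \<alpha>" "(\<lambda>n. D (single (f (\<sigma> n))) (collection_of I \<alpha>)) \<longlonglongrightarrow> 0"
  shows "(\<lambda>n. autocorrelation (f (\<sigma> n)) s) \<longlonglongrightarrow> (\<Sum>\<^sub>\<infinity>i\<in>I. autocorrelation (\<alpha> i) s)"
  using autocorrelations_converge_if_pattern_sums_converge[OF p fam_f assms(1)
      D_metric_limit_pattern_sums[OF d dense p(1) fam_f assms(1) assms(2)[unfolded single_def]]]
  by simp

context
  fixes \<iota> :: "'x::banach \<Rightarrow> ('a ell2 \<Rightarrow>\<^sub>L 'a ell2)"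
  assumes alg: "multiplier_algebra \<iota>"
begin

interpretation multiplier_algebra \<iota> by (rule alg)

abbreviation (input) "Mn n \<equiv> M_Phi \<iota> (f n)"

lemma symbol_Mn: "has_symbol (Mn n) (\<lambda>s. of_real (autocorrelation (f n) s))"
  using has_symbol_M_Phi[OF square_summable_f[of n]]
  unfolding Phi_eq_autocorrelation[OF square_summable_f[of n]] .

lemma norm_Mn: "norm (Mn n) = autocorrelation (f n) 0"
  by (simp add: norm_M_Phi[OF square_summable_f] autocorrelation_0)

lemma norm_Mn_le_1: "norm (Mn n) \<le> 1"
proof -
  note A = lp_familyD[OF fam_f[of n]]
  have "autocorrelation (f n) 0 \<le> (\<Sum>\<^sub>\<infinity>x. f n x powr p)"
    by (rule autocorrelation_bounds(2)[OF p(1) p_le_2]) (use A(1,2,4)[of 0] in auto)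
  also have "\<dots> \<le> 1" using mass_family_mass_le_1[OF A(3), of 0] by simp
  finally show ?thesis by (simp add: norm_Mn)
qed

lemma Mn_converges:
  fixes \<sigma> :: "nat \<Rightarrow> nat"
  assumes fam: "lp_family p I \<alpha>" and D: "(\<lambda>n. D (single (f (\<sigma> n))) (collection_of I \<alpha>)) \<longlonglongrightarrow> 0"
  shows "limitin strong_operator_topology (\<lambda>n. Mn (\<sigma> n)) (M_coll \<iota> (collection_of I \<alpha>)) sequentially"
    and "(\<lambda>n. norm (Mn (\<sigma> n))) \<longlonglongrightarrow> (\<Sum>\<^sub>\<infinity>i\<in>I. norm (M_Phi \<iota> (\<alpha> i)))"
proof -
  note conv = autocorrelations_converge[OF fam D]
  show "limitin strong_operator_topology (\<lambda>n. Mn (\<sigma> n)) (M_coll \<iota> (collection_of I \<alpha>)) sequentially"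
    by (rule strong_convergence_if_symbols_converge[OF symbol_Mn has_symbol_M_coll[OF p(1) p_le_2 fam] norm_Mn_le_1])
      (intro tendsto_of_real conv)
  have "(\<Sum>\<^sub>\<infinity>i\<in>I. norm (M_Phi \<iota> (\<alpha> i))) = (\<Sum>\<^sub>\<infinity>i\<in>I. autocorrelation (\<alpha> i) 0)"
    by (rule infsum_cong) (rule norm_M_Phi_lp_family[OF p(1) p_le_2 fam])
  then show "(\<lambda>n. norm (Mn (\<sigma> n))) \<longlonglongrightarrow> (\<Sum>\<^sub>\<infinity>i\<in>I. norm (M_Phi \<iota> (\<alpha> i)))"
    using conv[of 0] by (simp add: norm_Mn)
qed

lemma M_coll_convergent_limit_points:
  assumes "\<xi> \<in> limit_points"
  shows "M_coll_convergent \<iota> \<xi>"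
proof (rule lp_family_of_X_space[OF _ p(1)])
  show "\<xi> \<in> X_space p" using assms by (simp add: X_limit_points_def)
qed (simp add: M_coll_convergent_lp_family[OF p(1) p_le_2])

lemma decomposition_if_limit_point:
  assumes "\<xi> \<in> limit_points"
  shows "M_coll \<iota> \<xi> \<in> asymp_orth_decompositions Mn (M_Phi \<iota> ` Mp_le1 p)"
proof -
  obtain \<sigma> where \<sigma>: "strict_mono \<sigma>" "(\<lambda>n. D (single (f (\<sigma> n))) \<xi>) \<longlonglongrightarrow> 0"
    by (rule subsequence_to_limit_point[OF assms], rule that)
  have X: "\<xi> \<in> X_space p" using assms by (simp add: X_limit_points_def)
  obtain I \<alpha> where I: "\<xi> = collection_of I \<alpha>" "lp_family p I \<alpha>" "\<And>i. i \<in> I \<Longrightarrow> \<alpha> i \<in> Mp_le1 p"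
    by (rule lp_family_of_X_space[OF X p(1)], rule that)
  note conv = Mn_converges[OF I(2) \<sigma>(2)[unfolded I(1)]]
  show ?thesis
    unfolding asymp_orth_decompositions_def I(1)
  proof (intro CollectI exI conjI)
    show "\<forall>i\<in>I. M_Phi \<iota> (\<alpha> i) \<in> M_Phi \<iota> ` Mp_le1 p" using I(3) by blast
    show "((\<lambda>i. M_Phi \<iota> (\<alpha> i)) has_sum M_coll \<iota> (collection_of I \<alpha>)) I"
      by (rule M_coll_has_sum[OF p(1) p_le_2 I(2)])
    show "(\<lambda>i. norm (M_Phi \<iota> (\<alpha> i))) summable_on I"
      by (rule norm_M_Phi_summable[OF p(1) p_le_2 I(2)])
  qed (rule \<sigma>(1) conv)+
qed

lemma limit_point_if_subsequence_converges:
  fixes \<sigma> :: "nat \<Rightarrow> nat"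
  assumes \<sigma>: "strict_mono \<sigma>"
  obtains \<xi> \<tau> where "\<xi> \<in> limit_points" "strict_mono \<tau>"
    "limitin strong_operator_topology (\<lambda>n. Mn (\<sigma> (\<tau> n))) (M_coll \<iota> \<xi>) sequentially"
proof -
  obtain \<tau> I \<alpha> where \<tau>: "strict_mono \<tau>" "lp_family p I \<alpha>"
    "(\<lambda>n. D (single (f (\<sigma> (\<tau> n)))) (collection_of I \<alpha>)) \<longlonglongrightarrow> 0"
    by (rule subsequence_converges_in_X_space[of \<sigma>], rule that)
  have "strict_mono (\<lambda>n. \<sigma> (\<tau> n))" using strict_mono_o[OF \<sigma> \<tau>(1)] by (simp add: o_def)
  then have "collection_of I \<alpha> \<in> limit_points"
    by (rule limit_point_if_subsequence[OF _ X_space_if_lp_family[OF \<tau>(2) p(1)] \<tau>(3)])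
  then show ?thesis by (rule that[OF _ \<tau>(1) Mn_converges(1)[OF \<tau>(2,3)]])
qed

lemma limit_point_if_strong_limit:
  fixes \<sigma> :: "nat \<Rightarrow> nat"
  assumes "strict_mono \<sigma>" "limitin strong_operator_topology (\<lambda>n. Mn (\<sigma> n)) M sequentially"
  shows "\<exists>\<xi>\<in>limit_points. M = M_coll \<iota> \<xi>"
proof -
  obtain \<xi> \<tau> where \<xi>: "\<xi> \<in> limit_points" "strict_mono \<tau>"
    "limitin strong_operator_topology (\<lambda>n. Mn (\<sigma> (\<tau> n))) (M_coll \<iota> \<xi>) sequentially"
    by (rule limit_point_if_subsequence_converges[OF assms(1)], rule that)
  then show ?thesis using sot_limit_unique[OF assms(2) \<xi>(2,3)] by blast
qed

lemma asymp_orth_decompositions_eq: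
  "asymp_orth_decompositions Mn (M_Phi \<iota> ` Mp_le1 p) = {M_coll \<iota> \<xi> | \<xi>. \<xi> \<in> limit_points}"
proof (intro equalityI subsetI)
  fix M assume "M \<in> asymp_orth_decompositions Mn (M_Phi \<iota> ` Mp_le1 p)"
  then obtain \<sigma> where "strict_mono \<sigma>" "limitin strong_operator_topology (\<lambda>n. Mn (\<sigma> n)) M sequentially"
    unfolding asymp_orth_decompositions_def by blast
  from limit_point_if_strong_limit[OF this] show "M \<in> {M_coll \<iota> \<xi> | \<xi>. \<xi> \<in> limit_points}" by blast
next
  fix M assume "M \<in> {M_coll \<iota> \<xi> | \<xi>. \<xi> \<in> limit_points}"
  then show "M \<in> asymp_orth_decompositions Mn (M_Phi \<iota> ` Mp_le1 p)"
    using decomposition_if_limit_point by blast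
qed

text \<open>The strong operator topology need not be metrizable, so a limit point is not at once a limit along a
  subsequence.  Its symbol, however, is approximated by the symbols of the sequence on finite sets,
  and since the group is countable, these converge to it pointwise along a subsequence.  This determines the
  limit point.\<close>

lemma sot_limit_points_subset:
  "sot_limit_points Mn \<subseteq> asymp_orth_decompositions Mn (M_Phi \<iota> ` Mp_le1 p)"
proof
  fix M assume M: "M \<in> sot_limit_points Mn"
  let ?\<phi> = "\<lambda>n s. complex_of_real (autocorrelation (f n) s)"
  obtain \<psi> where \<psi>: "has_symbol M \<psi>"
    "\<And>F e. finite F \<Longrightarrow> e > 0 \<Longrightarrow> \<exists>\<^sub>\<infinity>n. \<forall>s\<in>F. cmod (?\<phi> n s - \<psi> s) < e"
    by (rule sot_limit_point_has_symbol[OF symbol_Mn M], rule that)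
  let ?P = "\<lambda>n m. \<forall>s\<in>from_nat ` {..n}. cmod (?\<phi> m s - \<psi> s) < inverse (real (Suc n))"
  have freq: "\<exists>\<^sub>\<infinity>m. ?P n m" for n by (rule \<psi>(2)) auto
  obtain \<sigma> :: "nat \<Rightarrow> nat" where \<sigma>: "strict_mono \<sigma>" "\<And>n. ?P n (\<sigma> n)"
    by (rule strict_mono_subsequence_frequently[of ?P, OF freq], rule that)
  have conv: "(\<lambda>n. ?\<phi> (\<sigma> n) s) \<longlonglongrightarrow> \<psi> s" for s
  proof (rule LIM_zero_cancel, rule Lim_null_comparison[OF _ LIMSEQ_inverse_real_of_nat])
    show "\<forall>\<^sub>F n in sequentially. norm (?\<phi> (\<sigma> n) s - \<psi> s) \<le> inverse (real (Suc n))"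
      unfolding eventually_sequentially
    proof (intro exI allI impI)
      fix n assume "to_nat s \<le> n"
      then have "s \<in> from_nat ` {..n}" by (intro image_eqI[of _ _ "to_nat s"]) auto
      then show "norm (?\<phi> (\<sigma> n) s - \<psi> s) \<le> inverse (real (Suc n))"
        using \<sigma>(2)[of n] by (auto intro: less_imp_le)
    qed
  qed
  obtain \<xi> \<tau> where \<xi>: "\<xi> \<in> limit_points" "strict_mono \<tau>"
    "limitin strong_operator_topology (\<lambda>n. Mn (\<sigma> (\<tau> n))) (M_coll \<iota> \<xi>) sequentially"
    by (rule limit_point_if_subsequence_converges[OF \<sigma>(1)], rule that)
  have "has_symbol (M_coll \<iota> \<xi>) \<psi>"
    by (rule strong_limit_has_symbol[OF symbol_Mn \<xi>(3)])
      (rule LIMSEQ_subseq_LIMSEQ[OF conv \<xi>(2), unfolded o_def])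
  then have "M = M_coll \<iota> \<xi>" by (rule has_symbol_unique[OF \<psi>(1)])
  then show "M \<in> asymp_orth_decompositions Mn (M_Phi \<iota> ` Mp_le1 p)"
    using decomposition_if_limit_point[OF \<xi>(1)] by simp
qed

lemma strong_limit_eq_M_coll:
  assumes "limitin strong_operator_topology Mn M sequentially" "\<xi> \<in> limit_points"
  shows "M = M_coll \<iota> \<xi>"
proof -
  obtain \<sigma> where \<sigma>: "strict_mono \<sigma>" "(\<lambda>n. D (single (f (\<sigma> n))) \<xi>) \<longlonglongrightarrow> 0"
    by (rule subsequence_to_limit_point[OF assms(2)], rule that)
  have X: "\<xi> \<in> X_space p" using assms by (simp add: X_limit_points_def)
  obtain I \<alpha> where I: "\<xi> = collection_of I \<alpha>" "lp_family p I \<alpha>" "\<And>i. i \<in> I \<Longrightarrow> \<alpha> i \<in> Mp_le1 p"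
    by (rule lp_family_of_X_space[OF X p(1)], rule that)
  show ?thesis
    using sot_limit_unique[OF assms(1) \<sigma>(1)] Mn_converges(1)[OF I(2) \<sigma>(2)[unfolded I(1)]]
    unfolding I(1) by blast
qed

end

end

theorem theorem1p1:
  fixes d :: "'a::{group_add, countable} \<Rightarrow> 'a \<Rightarrow> real"
    and k :: "nat \<Rightarrow> nat" and g :: "nat \<Rightarrow> 'a list \<Rightarrow> real"
    and p :: real and f :: "nat \<Rightarrow> 'a \<Rightarrow> real"
  assumes "proper_left_invariant_metric d"
    and "dense_test_sequence d k g"
    and "1 \<le> p" and "p < 2"
    and "\<forall>n. f n \<in> Mp p"
  shows "let L = X_limit_points p k g (\<lambda>n. single (f n)) in
    ((\<forall>\<xi>\<in>L. M_coll_convergent Rep_uniform_roe \<xi>) \<and>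
      asymp_orth_decompositions (\<lambda>n. M_Phi Rep_uniform_roe (f n)) (M_Phi Rep_uniform_roe ` Mp_le1 p)
        = {M_coll Rep_uniform_roe \<xi> | \<xi>. \<xi> \<in> L} \<and>
      sot_limit_points (\<lambda>n. M_Phi Rep_uniform_roe (f n))
        \<subseteq> asymp_orth_decompositions (\<lambda>n. M_Phi Rep_uniform_roe (f n)) (M_Phi Rep_uniform_roe ` Mp_le1 p) \<and>
      (\<forall>M. limitin strong_operator_topology (\<lambda>n. M_Phi Rep_uniform_roe (f n)) M sequentially
        \<longrightarrow> (\<forall>\<xi>\<in>L. M = M_coll Rep_uniform_roe \<xi>))) \<and>
    ((\<forall>\<xi>\<in>L. M_coll_convergent Rep_reduced_cstar \<xi>) \<and>
      asymp_orth_decompositions (\<lambda>n. M_Phi Rep_reduced_cstar (f n)) (M_Phi Rep_reduced_cstar ` Mp_le1 p)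
        = {M_coll Rep_reduced_cstar \<xi> | \<xi>. \<xi> \<in> L} \<and>
      sot_limit_points (\<lambda>n. M_Phi Rep_reduced_cstar (f n))
        \<subseteq> asymp_orth_decompositions (\<lambda>n. M_Phi Rep_reduced_cstar (f n)) (M_Phi Rep_reduced_cstar ` Mp_le1 p) \<and>
      (\<forall>M. limitin strong_operator_topology (\<lambda>n. M_Phi Rep_reduced_cstar (f n)) M sequentially
        \<longrightarrow> (\<forall>\<xi>\<in>L. M = M_coll Rep_reduced_cstar \<xi>)))"
proof -
  have p: "0 < p" using assms(3) by simp
  have f: "f n \<in> Mp p" for n using assms(5) by simp
  note ctx = assms(1,2) p assms(4) f
  note roe = multiplier_algebra_uniform_roe and red = multiplier_algebra_reduced_cstar
  show ?thesis
    unfolding Let_def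
    by (intro conjI ballI allI impI
        M_coll_convergent_limit_points[OF ctx roe] M_coll_convergent_limit_points[OF ctx red]
        asymp_orth_decompositions_eq[OF ctx roe] asymp_orth_decompositions_eq[OF ctx red]
        sot_limit_points_subset[OF ctx roe] sot_limit_points_subset[OF ctx red]
        strong_limit_eq_M_coll[OF ctx roe] strong_limit_eq_M_coll[OF ctx red])
qed

end
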